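(* Let $T$ be a geometric theory of topological rings in a language $\mathcal L$ and let $(M,E)$ be a sufficiently saturated dense pair of models of $T$. Let $D\subseteq M$ be special and let $F:M\to M$ be an $\mathcal L^P$-definable function over $D$. Then there is an $\mathcal L_D$-definable function $\widehat F:M\to M$ such that $F$ and $\widehat F$ agree off some small subset of $M$.
   Context: A complete $\mathcal L$-theory $T$, with $\mathcal L$ containing the ring language, is a geometric theory of topological rings if: (i) $T$ eliminates $\exists^\infty$; (ii) in every model, $\mathrm{acl}$ satisfies exchange; (iii) $T$ has definable Skolem functions; (iv) there is an $\mathcal L$-formula $\theta(x,\bar y)$, $x$ a single variable, such that in every model $M$ the sets $\theta(M,\bar a)$ form a basis of a $T_1$ topology without isolated points (products carry the product topology), and $M$ has cell decomposition: for every $A\subseteq M$ the domain of every $A$-definable function $F$ can be partitioned into finitely many $A$-definable cells on each of which $F$ is continuous, a cell being a definable $C\subseteq M^n$ such that for some coordinate projection $\pi$, $\pi(C)$ is open and $\pi|_C$ is a homeomorphism onto $\pi(C)$; (v) every definable subset of $M$ is finite or has non-empty interior; (vi) $M$ is an integral domain with continuous ring operations; (vii) for every $\bar a$ and $b\in\theta(M,\bar a)$ there are an open neighbourhood $V$ of $\bar a$ and $\bar c$ with $b\in\theta(M,\bar c)\subseteq\theta(M,\bar d)$ for all $\bar d\in V$, and the set of $\bar a'$ with $b\in\theta(M,\bar a')\subseteq\theta(M,\bar a)$ has non-empty interior. $\dim(a/B)$ is the $\mathrm{acl}$-dimension. A dense pair of models of $T$ is $(M,E)$ with $M\models T$, $E\preceq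 M$ proper and dense, as an $\mathcal L^P=\mathcal L\cup\{P\}$-structure with $P$ naming $E$. A set $A\subseteq M$ is special if $\dim(a/E)=\dim(a/E\cap A)$ for all finite tuples $a$ from $A$. A set $X\subseteq M^n$ is small (over $A$) if there is an $\mathcal L$-definable (over $A$) function $h:M^m\to M^n$ with $X\subseteq h(E^m)$. *)

theory Defs
  imports "HOL-Analysis.Analysis" "HOL-Algebra.Ring" "HOL-Library.NList"
    "HOL-Library.Equipollence" "HOL-Library.Disjoint_Sets"
begin

section \<open>First-order logic\<close>

record ('f, 'r) lang =
  funs :: "'f set"
  rels :: "'r set"
  farity :: "'f \<Rightarrow> nat"
  rarity :: "'r \<Rightarrow> nat"

datatype 'f trm = Var nat | Fn 'f "'f trm list"

text \<open>Variables are de Bruijn indices into a list of values: \<open>Exi\<close> binds index 0 and shifts the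
  other variables by one.\<close>

datatype ('f, 'r) fm =
    Eql "'f trm" "'f trm"
  | Rel 'r "'f trm list"
  | Neg "('f, 'r) fm"
  | Conj "('f, 'r) fm" "('f, 'r) fm"
  | Exi "('f, 'r) fm"

text \<open>The second argument bounds the free variables: \<open>wf_fm L n \<phi>\<close> says that \<open>\<phi>\<close> is an
  \<open>L\<close>-formula \<open>\<phi>(x\<^sub>0, \<dots>, x\<^sub>n\<^sub>-\<^sub>1)\<close>; in particular \<open>wf_fm L 0 \<phi>\<close> says that it is a sentence.\<close>

fun wf_trm :: "('f, 'r) lang \<Rightarrow> nat \<Rightarrow> 'f trm \<Rightarrow> bool" where
  "wf_trm L n (Var i) \<longleftrightarrow> i < n"
| "wf_trm L n (Fn f ts) \<longleftrightarrow>
     f \<in> funs L \<and> length ts = farity L f \<and> (\<forall>t\<in>set ts. wf_trm L n t)"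

primrec wf_fm :: "('f, 'r) lang \<Rightarrow> nat \<Rightarrow> ('f, 'r) fm \<Rightarrow> bool" where
  "wf_fm L n (Eql s t) \<longleftrightarrow> wf_trm L n s \<and> wf_trm L n t"
| "wf_fm L n (Rel r ts) \<longleftrightarrow>
     r \<in> rels L \<and> length ts = rarity L r \<and> (\<forall>t\<in>set ts. wf_trm L n t)"
| "wf_fm L n (Neg \<phi>) \<longleftrightarrow> wf_fm L n \<phi>"
| "wf_fm L n (Conj \<phi> \<psi>) \<longleftrightarrow> wf_fm L n \<phi> \<and> wf_fm L n \<psi>"
| "wf_fm L n (Exi \<phi>) \<longleftrightarrow> wf_fm L (Suc n) \<phi>"

record ('a, 'f, 'r) struc =
  univ :: "'a set"
  fint :: "'f \<Rightarrow> 'a list \<Rightarrow> 'a"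
  rint :: "'r \<Rightarrow> 'a list set"

text \<open>Values of the interpretations outside the universe, or on lists of the wrong length, are
  irrelevant. The \<open>n\<close>-th power of the universe is the set of lists \<open>nlists n (univ M)\<close>.\<close>

definition is_struc :: "('f, 'r) lang \<Rightarrow> ('a, 'f, 'r) struc \<Rightarrow> bool" where
  "is_struc L M \<longleftrightarrow> univ M \<noteq> {} \<and>
     (\<forall>f\<in>funs L. \<forall>xs\<in>nlists (farity L f) (univ M). fint M f xs \<in> univ M)"

fun evalt :: "('a, 'f, 'r) struc \<Rightarrow> 'a list \<Rightarrow> 'f trm \<Rightarrow> 'a" where
  "evalt M xs (Var i) = xs ! i"
| "evalt M xs (Fn f ts) = fint M f (map (evalt M xs) ts)"

primrec sat :: "('a, 'f, 'r) struc \<Rightarrow> 'a list \<Rightarrow> ('f, 'r) fm \<Rightarrow> bool" where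
  "sat M xs (Eql s t) \<longleftrightarrow> evalt M xs s = evalt M xs t"
| "sat M xs (Rel r ts) \<longleftrightarrow> map (evalt M xs) ts \<in> rint M r"
| "sat M xs (Neg \<phi>) \<longleftrightarrow> \<not> sat M xs \<phi>"
| "sat M xs (Conj \<phi> \<psi>) \<longleftrightarrow> sat M xs \<phi> \<and> sat M xs \<psi>"
| "sat M xs (Exi \<phi>) \<longleftrightarrow> (\<exists>a\<in>univ M. sat M (a # xs) \<phi>)"

definition model :: "('f, 'r) lang \<Rightarrow> ('f, 'r) fm set \<Rightarrow> ('a, 'f, 'r) struc \<Rightarrow> bool" where
  "model L T M \<longleftrightarrow> is_struc L M \<and> (\<forall>\<phi>\<in>T. sat M [] \<phi>)"

text \<open>HOL cannot quantify over models on all types inside a definition, so ``every model'' below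
  means every model whose universe is a subset of one given type \<open>'u\<close>. When \<open>'u\<close> is infinite and
  has at least as many elements as there are formulas, this is no restriction: every property
  required of all models below is first-order in finitely many parameters, so by
  Loewenheim-Skolem it can only fail in some model if it fails in one that fits into \<open>'u\<close>.\<close>

definition complete_theory ::
  "'u itself \<Rightarrow> ('f, 'r) lang \<Rightarrow> ('f, 'r) fm set \<Rightarrow> bool" where
  "complete_theory _ L T \<longleftrightarrow>
     (\<forall>\<phi>\<in>T. wf_fm L 0 \<phi>) \<and>
     (\<exists>M :: ('u, 'f, 'r) struc. model L T M) \<and>
     (\<forall>\<phi>. wf_fm L 0 \<phi> \<longrightarrow>
        (\<forall>M :: ('u, 'f, 'r) struc. model L T M \<longrightarrow> sat M [] \<phi>) \<or>
        (\<forall>M :: ('u, 'f, 'r) struc. model L T M \<longrightarrow> sat M [] (Neg \<phi>)))"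

definition elem_substruc :: "('f, 'r) lang \<Rightarrow> 'a set \<Rightarrow> ('a, 'f, 'r) struc \<Rightarrow> bool" where
  "elem_substruc L E M \<longleftrightarrow> E \<subseteq> univ M \<and> is_struc L (M\<lparr>univ := E\<rparr>) \<and>
     (\<forall>n \<phi>. wf_fm L n \<phi> \<longrightarrow>
        (\<forall>xs\<in>nlists n E. sat (M\<lparr>univ := E\<rparr>) xs \<phi> \<longleftrightarrow> sat M xs \<phi>))"

definition definable ::
  "('f, 'r) lang \<Rightarrow> ('a, 'f, 'r) struc \<Rightarrow> 'a set \<Rightarrow> nat \<Rightarrow> 'a list set \<Rightarrow> bool" where
  "definable L M A n X \<longleftrightarrow> (\<exists>k \<phi>. wf_fm L (n + k) \<phi> \<and>
     (\<exists>ps\<in>nlists k A. X = {xs \<in> nlists n (univ M). sat M (xs @ ps) \<phi>}))"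

definition definable_fun ::
  "('f, 'r) lang \<Rightarrow> ('a, 'f, 'r) struc \<Rightarrow> 'a set \<Rightarrow> nat \<Rightarrow> nat \<Rightarrow> 'a list set \<Rightarrow>
     ('a list \<Rightarrow> 'a list) \<Rightarrow> bool" where
  "definable_fun L M A n m X F \<longleftrightarrow>
     X \<subseteq> nlists n (univ M) \<and> F \<in> X \<rightarrow> nlists m (univ M) \<and>
     definable L M A (n + m) {xs @ F xs | xs. xs \<in> X}"

definition definable_unary_fun ::
  "('f, 'r) lang \<Rightarrow> ('a, 'f, 'r) struc \<Rightarrow> 'a set \<Rightarrow> ('a \<Rightarrow> 'a) \<Rightarrow> bool" where
  "definable_unary_fun L M A F \<longleftrightarrow>
     F \<in> univ M \<rightarrow> univ M \<and> definable L M A 2 {[a, F a] | a. a \<in> univ M}"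

text \<open>\<open>\<kappa>\<^sup>+\<close>-saturation for \<open>\<kappa> = |K|\<close>. A partial 1-type over \<open>A\<close> is given as a set of pairs of a
  formula \<open>\<phi>(x, \<^bold>y)\<close> and parameters from \<open>A\<close> for \<open>\<^bold>y\<close>.\<close>

definition succ_saturated ::
  "('f, 'r) lang \<Rightarrow> ('a, 'f, 'r) struc \<Rightarrow> 'k set \<Rightarrow> bool" where
  "succ_saturated L M K \<longleftrightarrow> (\<forall>A p. A \<subseteq> univ M \<and> A \<lesssim> K \<and>
     (\<forall>(\<phi>, ps)\<in>p. wf_fm L (Suc (length ps)) \<phi> \<and> set ps \<subseteq> A) \<and>
     (\<forall>q\<subseteq>p. finite q \<longrightarrow> (\<exists>a\<in>univ M. \<forall>(\<phi>, ps)\<in>q. sat M (a # ps) \<phi>)) \<longrightarrow>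
     (\<exists>a\<in>univ M. \<forall>(\<phi>, ps)\<in>p. sat M (a # ps) \<phi>))"

section \<open>Algebraic closure and dimension\<close>

definition acl :: "('f, 'r) lang \<Rightarrow> ('a, 'f, 'r) struc \<Rightarrow> 'a set \<Rightarrow> 'a set" where
  "acl L M B = {a. \<exists>X. definable L M B 1 X \<and> finite X \<and> [a] \<in> X}"

definition acl_exchange :: "('f, 'r) lang \<Rightarrow> ('a, 'f, 'r) struc \<Rightarrow> bool" where
  "acl_exchange L M \<longleftrightarrow> (\<forall>B\<subseteq>univ M. \<forall>a\<in>univ M. \<forall>b\<in>univ M.
     a \<in> acl L M (insert b B) - acl L M B \<longrightarrow> b \<in> acl L M (insert a B))"

definition acl_indep ::
  "('f, 'r) lang \<Rightarrow> ('a, 'f, 'r) struc \<Rightarrow> 'a set \<Rightarrow> 'a set \<Rightarrow> bool" where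
  "acl_indep L M B S \<longleftrightarrow> (\<forall>s\<in>S. s \<notin> acl L M (B \<union> (S - {s})))"

text \<open>\<open>dim(a/B)\<close>: the size of a largest subtuple of \<open>a\<close> that is independent over \<open>B\<close>.\<close>

definition acl_dim ::
  "('f, 'r) lang \<Rightarrow> ('a, 'f, 'r) struc \<Rightarrow> 'a list \<Rightarrow> 'a set \<Rightarrow> nat" where
  "acl_dim L M a B = Max (card ` {S. S \<subseteq> set a \<and> acl_indep L M B S})"

definition eliminates_Ex_inf ::
  "'u itself \<Rightarrow> ('f, 'r) lang \<Rightarrow> ('f, 'r) fm set \<Rightarrow> bool" where
  "eliminates_Ex_inf _ L T \<longleftrightarrow> (\<forall>k \<phi>. wf_fm L (Suc k) \<phi> \<longrightarrow>
     (\<exists>N. \<forall>M :: ('u, 'f, 'r) struc. model L T M \<longrightarrow>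
        (\<forall>b\<in>nlists k (univ M).
           finite {a \<in> univ M. sat M (a # b) \<phi>} \<longrightarrow>
           card {a \<in> univ M. sat M (a # b) \<phi>} \<le> N)))"

text \<open>\<open>\<psi>(x, \<^bold>y)\<close> defines, in all models, the graph of a Skolem function for \<open>\<phi>(x, \<^bold>y)\<close>.\<close>

definition definable_skolem_functions ::
  "'u itself \<Rightarrow> ('f, 'r) lang \<Rightarrow> ('f, 'r) fm set \<Rightarrow> bool" where
  "definable_skolem_functions _ L T \<longleftrightarrow> (\<forall>k \<phi>. wf_fm L (Suc k) \<phi> \<longrightarrow>
     (\<exists>\<psi>. wf_fm L (Suc k) \<psi> \<and> (\<forall>M :: ('u, 'f, 'r) struc. model L T M \<longrightarrow>
        (\<forall>b\<in>nlists k (univ M).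
           (\<exists>!a. a \<in> univ M \<and> sat M (a # b) \<psi>) \<and>
           ((\<exists>a\<in>univ M. sat M (a # b) \<phi>) \<longrightarrow>
              (\<forall>a\<in>univ M. sat M (a # b) \<psi> \<longrightarrow> sat M (a # b) \<phi>))))))"

section \<open>Definable topologies and cells\<close>

definition theta_set ::
  "('a, 'f, 'r) struc \<Rightarrow> ('f, 'r) fm \<Rightarrow> 'a list \<Rightarrow> 'a set" where
  "theta_set M \<theta> a = {b \<in> univ M. sat M (b # a) \<theta>}"

definition theta_open ::
  "('a, 'f, 'r) struc \<Rightarrow> nat \<Rightarrow> ('f, 'r) fm \<Rightarrow> 'a set \<Rightarrow> bool" where
  "theta_open M k \<theta> = arbitrary union_of (\<lambda>U. U \<in> theta_set M \<theta> ` nlists k (univ M))"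

definition theta_top ::
  "('a, 'f, 'r) struc \<Rightarrow> nat \<Rightarrow> ('f, 'r) fm \<Rightarrow> 'a topology" where
  "theta_top M k \<theta> = topology (theta_open M k \<theta>)"

text \<open>The product topology on the \<open>n\<close>-th power, transported from functions on \<open>{..<n}\<close> to lists
  of length \<open>n\<close>.\<close>

definition power_top :: "'a topology \<Rightarrow> nat \<Rightarrow> 'a list topology" where
  "power_top X n = pullback_topology (nlists n (topspace X))
     (\<lambda>xs. \<lambda>i\<in>{..<n}. xs ! i) (product_topology (\<lambda>_. X) {..<n})"

text \<open>The coordinate projections on the \<open>n\<close>-th power are the maps \<open>\<lambda>xs. nths xs I\<close> for
  \<open>I \<subseteq> {..<n}\<close>.\<close>

definition cell :: "'a topology \<Rightarrow> nat \<Rightarrow> 'a list set \<Rightarrow> bool" where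
  "cell X n C \<longleftrightarrow> C \<subseteq> nlists n (topspace X) \<and> (\<exists>I\<subseteq>{..<n}.
     let Y = power_top X (card I); C' = (\<lambda>xs. nths xs I) ` C in
       openin Y C' \<and>
       homeomorphic_map (subtopology (power_top X n) C) (subtopology Y C') (\<lambda>xs. nths xs I))"

definition cell_decomposition ::
  "('f, 'r) lang \<Rightarrow> ('a, 'f, 'r) struc \<Rightarrow> 'a topology \<Rightarrow> bool" where
  "cell_decomposition L M X \<longleftrightarrow>
     (\<forall>A\<subseteq>univ M. \<forall>n m Z F. definable_fun L M A n m Z F \<longrightarrow>
        (\<exists>\<C>. finite \<C> \<and> partition_on Z \<C> \<and>
           (\<forall>C\<in>\<C>. definable L M A n C \<and> cell X n C \<and>
              continuous_map (subtopology (power_top X n) C) (power_top X m) F)))"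

section \<open>Geometric theories of topological rings\<close>

datatype ring_sym = ZeroS | OneS | AddS | NegS | MulS

primrec ring_arity :: "ring_sym \<Rightarrow> nat" where
  "ring_arity ZeroS = 0"
| "ring_arity OneS = 0"
| "ring_arity AddS = 2"
| "ring_arity NegS = 1"
| "ring_arity MulS = 2"

definition contains_ring_lang :: "('f, 'r) lang \<Rightarrow> (ring_sym \<Rightarrow> 'f) \<Rightarrow> bool" where
  "contains_ring_lang L \<iota> \<longleftrightarrow>
     inj \<iota> \<and> (\<forall>s. \<iota> s \<in> funs L \<and> farity L (\<iota> s) = ring_arity s)"

definition ring_of :: "(ring_sym \<Rightarrow> 'f) \<Rightarrow> ('a, 'f, 'r) struc \<Rightarrow> 'a ring" where
  "ring_of \<iota> M = \<lparr>carrier = univ M,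
     monoid.mult = (\<lambda>x y. fint M (\<iota> MulS) [x, y]), one = fint M (\<iota> OneS) [],
     zero = fint M (\<iota> ZeroS) [], add = (\<lambda>x y. fint M (\<iota> AddS) [x, y])\<rparr>"

definition topological_domain ::
  "(ring_sym \<Rightarrow> 'f) \<Rightarrow> ('a, 'f, 'r) struc \<Rightarrow> 'a topology \<Rightarrow> bool" where
  "topological_domain \<iota> M X \<longleftrightarrow>
     domain (ring_of \<iota> M) \<and>
     (\<forall>x\<in>univ M. fint M (\<iota> NegS) [x] = a_inv (ring_of \<iota> M) x) \<and>
     continuous_map (prod_topology X X) X (\<lambda>(x, y). fint M (\<iota> AddS) [x, y]) \<and>
     continuous_map (prod_topology X X) X (\<lambda>(x, y). fint M (\<iota> MulS) [x, y]) \<and>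
     continuous_map X X (\<lambda>x. fint M (\<iota> NegS) [x])"

text \<open>\<open>\<theta>(x, \<^bold>y)\<close> has \<open>x\<close> as variable 0, followed by the \<open>k\<close> variables \<open>\<^bold>y\<close>.\<close>

definition topological_ring_structure ::
  "('f, 'r) lang \<Rightarrow> (ring_sym \<Rightarrow> 'f) \<Rightarrow> nat \<Rightarrow> ('f, 'r) fm \<Rightarrow> ('a, 'f, 'r) struc \<Rightarrow> bool" where
  "topological_ring_structure L \<iota> k \<theta> M \<longleftrightarrow> (let X = theta_top M k \<theta> in
     istopology (theta_open M k \<theta>) \<and> topspace X = univ M \<and>
     t1_space X \<and> (\<forall>a\<in>univ M. \<not> openin X {a}) \<and>
     cell_decomposition L M X \<and>
     (\<forall>Z. definable L M (univ M) 1 Z \<longrightarrow> finite Z \<or> X interior_of {a. [a] \<in> Z} \<noteq> {}) \<and>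
     topological_domain \<iota> M X \<and>
     (\<forall>a\<in>nlists k (univ M). \<forall>b\<in>theta_set M \<theta> a.
        (\<exists>V. \<exists>c\<in>nlists k (univ M). openin (power_top X k) V \<and> a \<in> V \<and>
           b \<in> theta_set M \<theta> c \<and> (\<forall>d\<in>V. theta_set M \<theta> c \<subseteq> theta_set M \<theta> d)) \<and>
        power_top X k interior_of {a' \<in> nlists k (univ M).
           b \<in> theta_set M \<theta> a' \<and> theta_set M \<theta> a' \<subseteq> theta_set M \<theta> a} \<noteq> {}))"

definition geometric_theory_top_rings ::
  "'u itself \<Rightarrow> ('f, 'r) lang \<Rightarrow> (ring_sym \<Rightarrow> 'f) \<Rightarrow> ('f, 'r) fm set \<Rightarrow>
     nat \<Rightarrow> ('f, 'r) fm \<Rightarrow> bool" where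
  "geometric_theory_top_rings U L \<iota> T k \<theta> \<longleftrightarrow>
     contains_ring_lang L \<iota> \<and> complete_theory U L T \<and>
     eliminates_Ex_inf U L T \<and>
     (\<forall>M :: ('u, 'f, 'r) struc. model L T M \<longrightarrow> acl_exchange L M) \<and>
     definable_skolem_functions U L T \<and>
     wf_fm L (Suc k) \<theta> \<and>
     (\<forall>M :: ('u, 'f, 'r) struc. model L T M \<longrightarrow> topological_ring_structure L \<iota> k \<theta> M)"

section \<open>Dense pairs\<close>

text \<open>The new predicate \<open>P\<close> is \<open>None\<close>.\<close>

definition pair_lang :: "('f, 'r) lang \<Rightarrow> ('f, 'r option) lang" where
  "pair_lang L = \<lparr>funs = funs L, rels = insert None (Some ` rels L),
     farity = farity L, rarity = case_option 1 (rarity L)\<rparr>"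

definition pair_struc :: "('a, 'f, 'r) struc \<Rightarrow> 'a set \<Rightarrow> ('a, 'f, 'r option) struc" where
  "pair_struc M E = \<lparr>univ = univ M, fint = fint M,
     rint = case_option ((\<lambda>a. [a]) ` E) (rint M)\<rparr>"

definition dense_pair ::
  "('f, 'r) lang \<Rightarrow> ('f, 'r) fm set \<Rightarrow> nat \<Rightarrow> ('f, 'r) fm \<Rightarrow>
     ('a, 'f, 'r) struc \<Rightarrow> 'a set \<Rightarrow> bool" where
  "dense_pair L T k \<theta> M E \<longleftrightarrow> model L T M \<and> elem_substruc L E M \<and> E \<noteq> univ M \<and>
     theta_top M k \<theta> closure_of E = univ M"

text \<open>Sufficiently saturated: \<open>(M, E)\<close> is \<open>\<kappa>\<^sup>+\<close>-saturated, where \<open>\<kappa> = max |L| \<aleph>\<^sub>0\<close> is the number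
  of \<open>L\<close>-formulas.\<close>

definition sufficiently_saturated_pair ::
  "('f, 'r) lang \<Rightarrow> ('a, 'f, 'r) struc \<Rightarrow> 'a set \<Rightarrow> bool" where
  "sufficiently_saturated_pair L M E \<longleftrightarrow>
     succ_saturated (pair_lang L) (pair_struc M E) {\<phi>. \<exists>n. wf_fm L n \<phi>}"

definition special ::
  "('f, 'r) lang \<Rightarrow> ('a, 'f, 'r) struc \<Rightarrow> 'a set \<Rightarrow> 'a set \<Rightarrow> bool" where
  "special L M E A \<longleftrightarrow> A \<subseteq> univ M \<and>
     (\<forall>a\<in>lists A. acl_dim L M a E = acl_dim L M a (E \<inter> A))"

text \<open>\<open>X \<subseteq> M\<^sup>n\<close> is small over \<open>A\<close>; ``small'' without further specification is the case
  \<open>A = univ M\<close>.\<close>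

definition small_over ::
  "('f, 'r) lang \<Rightarrow> ('a, 'f, 'r) struc \<Rightarrow> 'a set \<Rightarrow> 'a set \<Rightarrow> nat \<Rightarrow> 'a list set \<Rightarrow> bool" where
  "small_over L M E A n X \<longleftrightarrow> X \<subseteq> nlists n (univ M) \<and>
     (\<exists>m h. definable_fun L M A m n (nlists m (univ M)) h \<and> X \<subseteq> h ` nlists m E)"

end

theory Submission
  imports Defs "HOL-Algebra.Polynomial_Divisibility"
begin

text \<open>
  By the Skolem functions, algebraic closure \<open>cl\<close> is definable closure. Call a finite set \<open>A\<close>
  good if it is algebraic over \<open>A \<inter> E\<close> together with a subset of \<open>A\<close> independent over \<open>E\<close>; every
  finite subset of a special set lies in a finite good one. Finite \<open>L\<close>-elementary maps between
  good sets that respect \<open>E\<close> form a back-and-forth system: a new element lies in \<open>E\<close> (density and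
  saturation), or outside \<open>cl (E \<union> A)\<close> (codensity and saturation), or is reached by adding
  finitely many elements of \<open>E\<close> first. Hence, off \<open>cl (E \<union> A)\<close>, the \<open>L\<close>-type over \<open>A\<close> determines
  the \<open>L\<^sup>P\<close>-type, and \<open>F b\<close>, having no other conjugate over \<open>A \<union> {b}\<close>, lies in \<open>cl (A \<union> {b})\<close>.
  Saturation turns these two facts into a definition of \<open>F\<close> by finitely many \<open>L\<close>-definable cases
  outside a small set.

  Codensity says that \<open>cl\<close> of a finite set and \<open>n\<close> elements of \<open>E\<close> never covers an infinite definable
  set. It follows by counting dimensions, since for \<open>t \<notin> E\<close> the set contains sums
  \<open>u\<^sub>0 + u\<^sub>1 t + \<dots> + u\<^sub>n t\<^sup>n\<close> with \<open>n + 1\<close> independent coefficients in \<open>E\<close>, and such a sum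
  determines its coefficients.
\<close>

text \<open>Frees the identifier \<open>X\<close>.\<close>

no_notation var (\<open>X\<index>\<close>)

section \<open>Definable predicates and functions\<close>

text \<open>Goodness is what lets an \<open>L\<close>-elementary map respect \<open>E\<close>: an
  element of \<open>E\<close> algebraic over a good \<open>A\<close> is already algebraic over
  \<open>A \<inter> E\<close>, so its image is algebraic over \<open>E\<close> and hence in
  \<open>E\<close>. In the codensity argument, compactness reduces to a fixed bound \<open>n\<close>
  on the number of parameters from \<open>E\<close>, so a sum with \<open>n + 1\<close> coefficients
  suffices. Powers of \<open>t\<close> code a tuple from \<open>E\<close> by one element because a
  nonzero polynomial over a domain has finitely many roots while \<open>t\<close> is not algebraic
  over \<open>E\<close>; the Horner form is used because continuity of \<open>y + t z\<close> at
  \<open>z = 0\<close> places such sums in any infinite definable set. The extension step of the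
  back and forth also lets an element outside the closure of the domain avoid a prescribed image
  \<open>d\<close>; taking \<open>d = F b\<close> is what makes \<open>F b\<close> algebraic.
  Compactness is used twice at the end: to spread an equation for \<open>F b\<close> to an
  \<open>L\<close>-definable piece up to finitely many images of powers of \<open>E\<close>, and to
  cover all generic points by finitely many pieces.\<close>

fun ren_trm :: "(nat \<Rightarrow> nat) \<Rightarrow> 'f trm \<Rightarrow> 'f trm" where
  "ren_trm \<sigma> (Var i) = Var (\<sigma> i)"
| "ren_trm \<sigma> (Fn f ts) = Fn f (map (ren_trm \<sigma>) ts)"

primrec ren_fm :: "('f, 'r) fm \<Rightarrow> (nat \<Rightarrow> nat) \<Rightarrow> ('f, 'r) fm" where
  "ren_fm (Eql s t) \<sigma> = Eql (ren_trm \<sigma> s) (ren_trm \<sigma> t)"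
| "ren_fm (Rel r ts) \<sigma> = Rel r (map (ren_trm \<sigma>) ts)"
| "ren_fm (Neg \<phi>) \<sigma> = Neg (ren_fm \<phi> \<sigma>)"
| "ren_fm (Conj \<phi> \<psi>) \<sigma> = Conj (ren_fm \<phi> \<sigma>) (ren_fm \<psi> \<sigma>)"
| "ren_fm (Exi \<phi>) \<sigma> = Exi (ren_fm \<phi> (case_nat 0 (\<lambda>i. Suc (\<sigma> i))))"

lemma wf_ren_trm:
  assumes "wf_trm L n t" "\<And>i. i < n \<Longrightarrow> \<sigma> i < m"
  shows "wf_trm L m (ren_trm \<sigma> t)"
  using assms by (induction \<sigma> t rule: ren_trm.induct) auto

lemma evalt_ren_trm:
  assumes "wf_trm L n t" "\<And>i. i < n \<Longrightarrow> ys ! \<sigma> i = xs ! i"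
  shows "evalt M ys (ren_trm \<sigma> t) = evalt M xs t"
  using assms by (induction \<sigma> t rule: ren_trm.induct) (auto cong: map_cong simp: comp_def)

lemma wf_ren_fm:
  assumes "wf_fm L n \<phi>" "\<And>i. i < n \<Longrightarrow> \<sigma> i < m"
  shows "wf_fm L m (ren_fm \<phi> \<sigma>)"
  using assms
proof (induction \<phi> arbitrary: n m \<sigma>)
  case (Exi \<phi>)
  show ?case using Exi.prems by (auto intro!: Exi.IH[of "Suc n"] split: nat.split)
qed (auto intro: wf_ren_trm)

lemma sat_ren_fm:
  assumes "wf_fm L n \<phi>" "\<And>i. i < n \<Longrightarrow> ys ! \<sigma> i = xs ! i"
  shows "sat M ys (ren_fm \<phi> \<sigma>) \<longleftrightarrow> sat M xs \<phi>"
  using assms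
proof (induction \<phi> arbitrary: n xs ys \<sigma>)
  case (Eql s t)
  then show ?case using evalt_ren_trm[of L n _ ys \<sigma> xs M] by simp
next
  case (Rel r ts)
  have "map (evalt M ys) (map (ren_trm \<sigma>) ts) = map (evalt M xs) ts"
    using Rel evalt_ren_trm[of L n _ ys \<sigma> xs M] by (auto simp: comp_def)
  then show ?case by (simp only: ren_fm.simps sat.simps)
next
  case (Exi \<phi>)
  have "sat M (a # ys) (ren_fm \<phi> (case_nat 0 (\<lambda>i. Suc (\<sigma> i)))) = sat M (a # xs) \<phi>" for a
    using Exi.prems by (auto intro!: Exi.IH[of "Suc n"] split: nat.split)
  then show ?case by simp
qed (simp_all, blast)

text \<open>Agreement with a formula is required only on tuples from the universe, and parameters
  are passed as trailing entries. Working with such predicates replaces the construction of formulas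
  by closure lemmas.\<close>

definition dpred :: "('f, 'r) lang \<Rightarrow> ('a, 'f, 'r) struc \<Rightarrow> nat \<Rightarrow> ('a list \<Rightarrow> bool) \<Rightarrow> bool" where
  "dpred L M n P \<longleftrightarrow>
     (\<exists>\<phi>. wf_fm L n \<phi> \<and> (\<forall>xs\<in>nlists n (univ M). sat M xs \<phi> \<longleftrightarrow> P xs))"

definition dterm :: "('f, 'r) lang \<Rightarrow> ('a, 'f, 'r) struc \<Rightarrow> nat \<Rightarrow> ('a list \<Rightarrow> 'a) \<Rightarrow> bool" where
  "dterm L M n f \<longleftrightarrow>
     (\<exists>t. wf_trm L n t \<and> (\<forall>xs\<in>nlists n (univ M). evalt M xs t = f xs))"

text \<open>The value is the head of the tuple because \<open>Exi\<close> binds index 0, so it can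
  be quantified away directly.\<close>

definition dfun :: "('f, 'r) lang \<Rightarrow> ('a, 'f, 'r) struc \<Rightarrow> nat \<Rightarrow> ('a list \<Rightarrow> 'a) \<Rightarrow> bool" where
  "dfun L M n f \<longleftrightarrow> f \<in> nlists n (univ M) \<rightarrow> univ M \<and>
     dpred L M (Suc n) (\<lambda>xs. hd xs = f (tl xs))"

text \<open>Reindexings of tuples; they replace substitutions of variables for variables.\<close>

definition selector :: "nat \<Rightarrow> nat \<Rightarrow> ('a list \<Rightarrow> 'a list) \<Rightarrow> bool" where
  "selector n m s \<longleftrightarrow> (\<exists>is. length is = n \<and> set is \<subseteq> {..<m} \<and>
     (\<forall>xs. length xs = m \<longrightarrow> s xs = map ((!) xs) is))"

lemma selector_nth: "i < m \<Longrightarrow> selector (Suc 0) m (\<lambda>xs. [xs ! i])"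
  unfolding selector_def by (rule exI[of _ "[i]"]) auto

lemma selector_append:
  assumes "selector n m s" "selector n' m s'"
  shows "selector (n + n') m (\<lambda>xs. s xs @ s' xs)"
proof -
  obtain "is" js where "length is = n \<and> set is \<subseteq> {..<m} \<and> (\<forall>xs. length xs = m \<longrightarrow> s xs = map ((!) xs) is)"
    "length js = n' \<and> set js \<subseteq> {..<m} \<and> (\<forall>xs. length xs = m \<longrightarrow> s' xs = map ((!) xs) js)"
    using assms unfolding selector_def by blast
  then show ?thesis unfolding selector_def by (intro exI[of _ "is @ js"]) auto
qed

lemma selector_take: "n \<le> m \<Longrightarrow> selector n m (take n)"
  unfolding selector_def by (rule exI[of _ "[0..<n]"]) (auto simp: list_eq_iff_nth_eq)

lemma selector_drop: "selector (m - n) m (drop n)"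
  unfolding selector_def
  by (rule exI[of _ "[n..<m]"]) (auto simp: list_eq_iff_nth_eq)

lemma selector_append_left: "selector n (n + m) (take n)"
  by (rule selector_take) simp

lemma selector_append_right: "selector m (n + m) (drop n)"
  using selector_drop[of "n + m" n] by simp

lemma selector_Cons:
  "i < m \<Longrightarrow> selector n m s \<Longrightarrow> selector (Suc n) m (\<lambda>xs. xs ! i # s xs)"
  using selector_append[OF selector_nth, of i m n s] by simp

lemma selector_comp:
  assumes "selector n m s" "selector m l s'"
  shows "selector n l (\<lambda>xs. s (s' xs))"
proof -
  obtain "is" js where
    i: "length is = n" "set is \<subseteq> {..<m}" "\<And>xs. length xs = m \<Longrightarrow> s xs = map ((!) xs) is" and
    j: "length js = m" "set js \<subseteq> {..<l}" "\<And>xs. length xs = l \<Longrightarrow> s' xs = map ((!) xs) js"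
    using assms unfolding selector_def by blast
  have "map ((!) (map ((!) xs) js)) is = map ((!) xs) (map ((!) js) is)" for xs :: "'a list"
    using i(2) j(1) by auto
  moreover have "set (map ((!) js) is) \<subseteq> {..<l}"
  proof
    fix x assume "x \<in> set (map ((!) js) is)"
    then obtain k where "k \<in> set is" "x = js ! k" by auto
    then show "x \<in> {..<l}" using i(2) j(1,2) by (metis lessThan_iff nth_mem subsetD)
  qed
  ultimately show ?thesis
    unfolding selector_def using i j by (intro exI[of _ "map ((!) js) is"]) auto
qed

lemma selector_sublist_index:
  assumes "set ys \<subseteq> set xs"
  obtains "is" where "length is = length ys" "set is \<subseteq> {..<length xs}" "ys = map ((!) xs) is"
proof -
  have "\<forall>y\<in>set ys. \<exists>i<length xs. xs ! i = y" using assms by (auto simp: in_set_conv_nth)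
  then obtain g where "\<forall>y\<in>set ys. g y < length xs \<and> xs ! g y = y" by metis
  then show ?thesis by (intro that[of "map g ys"]) (auto intro: map_idI[symmetric] simp: map_idI)
qed

lemma selector_mem: "selector n m s \<Longrightarrow> xs \<in> nlists m U \<Longrightarrow> s xs \<in> nlists n U"
  unfolding selector_def nlists_def by (force simp: subset_iff)

section \<open>Closure properties of definable predicates and functions\<close>

lemma dpred_cong:
  "dpred L M n P \<Longrightarrow> (\<And>xs. xs \<in> nlists n (univ M) \<Longrightarrow> P xs \<longleftrightarrow> Q xs) \<Longrightarrow> dpred L M n Q"
  unfolding dpred_def by auto

lemma dpred_sat: "wf_fm L n \<phi> \<Longrightarrow> dpred L M n (\<lambda>xs. sat M xs \<phi>)"
  unfolding dpred_def by auto

lemma dpred_not: "dpred L M n P \<Longrightarrow> dpred L M n (\<lambda>xs. \<not> P xs)"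
  unfolding dpred_def by (metis sat.simps(3) wf_fm.simps(3))

lemma dpred_conj: "dpred L M n P \<Longrightarrow> dpred L M n Q \<Longrightarrow> dpred L M n (\<lambda>xs. P xs \<and> Q xs)"
  unfolding dpred_def by (metis sat.simps(4) wf_fm.simps(4))

lemma dpred_disj: "dpred L M n P \<Longrightarrow> dpred L M n Q \<Longrightarrow> dpred L M n (\<lambda>xs. P xs \<or> Q xs)"
  using dpred_not[OF dpred_conj[OF dpred_not dpred_not]] by (rule dpred_cong) auto

lemma dpred_imp: "dpred L M n P \<Longrightarrow> dpred L M n Q \<Longrightarrow> dpred L M n (\<lambda>xs. P xs \<longrightarrow> Q xs)"
  using dpred_disj[OF dpred_not] by (rule dpred_cong) auto

lemma dpred_ex:
  assumes "dpred L M (Suc n) P" shows "dpred L M n (\<lambda>xs. \<exists>a\<in>univ M. P (a # xs))"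
proof -
  obtain \<phi> where "wf_fm L (Suc n) \<phi>" "\<forall>xs\<in>nlists (Suc n) (univ M). sat M xs \<phi> \<longleftrightarrow> P xs"
    using assms unfolding dpred_def by auto
  then show ?thesis unfolding dpred_def by (intro exI[of _ "Exi \<phi>"]) auto
qed

lemma dpred_all:
  assumes "dpred L M (Suc n) P" shows "dpred L M n (\<lambda>xs. \<forall>a\<in>univ M. P (a # xs))"
  using dpred_not[OF dpred_ex[OF dpred_not[OF assms]]] by simp

lemma dpred_selector:
  assumes "dpred L M n P" "selector n m s" shows "dpred L M m (\<lambda>xs. P (s xs))"
proof -
  obtain \<phi> where \<phi>: "wf_fm L n \<phi>" "\<And>xs. xs \<in> nlists n (univ M) \<Longrightarrow> sat M xs \<phi> \<longleftrightarrow> P xs"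
    using assms(1) unfolding dpred_def by auto
  obtain "is" where i: "length is = n" "set is \<subseteq> {..<m}" "\<And>xs. length xs = m \<Longrightarrow> s xs = map ((!) xs) is"
    using assms(2) unfolding selector_def by auto
  have "sat M xs (ren_fm \<phi> ((!) is)) \<longleftrightarrow> P (s xs)" if "xs \<in> nlists m (univ M)" for xs
    using sat_ren_fm[OF \<phi>(1), of xs "(!) is" "s xs" M] \<phi>(2)[OF selector_mem[OF assms(2) that]] i that
    by auto
  moreover have "wf_fm L m (ren_fm \<phi> ((!) is))"
    using i by (intro wf_ren_fm[OF \<phi>(1)]) (metis lessThan_iff nth_mem subsetD)
  ultimately show ?thesis unfolding dpred_def by auto
qed

lemma dterm_nth: "i < n \<Longrightarrow> dterm L M n (\<lambda>xs. xs ! i)"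
  unfolding dterm_def by (rule exI[of _ "Var i"]) auto

lemma dterm_fun2:
  assumes "g \<in> funs L" "farity L g = 2" "dterm L M n f" "dterm L M n f'"
  shows "dterm L M n (\<lambda>xs. fint M g [f xs, f' xs])"
proof -
  obtain t t' where "wf_trm L n t" "wf_trm L n t'"
    "\<forall>xs\<in>nlists n (univ M). evalt M xs t = f xs" "\<forall>xs\<in>nlists n (univ M). evalt M xs t' = f' xs"
    using assms(3,4) unfolding dterm_def by auto
  then show ?thesis
    unfolding dterm_def using assms(1,2) by (intro exI[of _ "Fn g [t, t']"]) auto
qed

lemma dterm_const:
  assumes "g \<in> funs L" "farity L g = 0" shows "dterm L M n (\<lambda>xs. fint M g [])"
  unfolding dterm_def using assms by (intro exI[of _ "Fn g []"]) auto

lemma dpred_eq: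
  assumes "dterm L M n f" "dterm L M n g" shows "dpred L M n (\<lambda>xs. f xs = g xs)"
proof -
  obtain s t where "wf_trm L n s" "wf_trm L n t"
    "\<forall>xs\<in>nlists n (univ M). evalt M xs s = f xs" "\<forall>xs\<in>nlists n (univ M). evalt M xs t = g xs"
    using assms unfolding dterm_def by auto
  then show ?thesis unfolding dpred_def by (intro exI[of _ "Eql s t"]) auto
qed

lemma dpred_nth_eq: "i < n \<Longrightarrow> j < n \<Longrightarrow> dpred L M n (\<lambda>xs. xs ! i = xs ! j)"
  by (intro dpred_eq dterm_nth)

lemma dpred_True: "dpred L M (Suc n) (\<lambda>_. True)"
  using dpred_nth_eq[of 0 "Suc n" 0] by simp

lemma dfun_mem: "dfun L M n f \<Longrightarrow> b \<in> nlists n (univ M) \<Longrightarrow> f b \<in> univ M"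
  unfolding dfun_def by auto

lemma dfun_dpred:
  assumes "dfun L M n f" "selector n m s" "i < m"
  shows "dpred L M m (\<lambda>xs. xs ! i = f (s xs))"
proof -
  have "dpred L M (Suc n) (\<lambda>xs. hd xs = f (tl xs))" using assms(1) unfolding dfun_def by auto
  from dpred_selector[OF this selector_Cons[OF assms(3,2)]] show ?thesis by simp
qed

text \<open>A function is known only through its graph, so it is substituted by quantifying over its
  value: some \<open>a\<close> lies on the graph and satisfies \<open>P\<close>.\<close>

lemma dpred_subst:
  assumes "dpred L M (Suc n) P" "dfun L M n f" shows "dpred L M n (\<lambda>b. P (f b # b))"
proof -
  have "dpred L M (Suc n) (\<lambda>xs. hd xs = f (tl xs) \<and> P xs)"
    using assms unfolding dfun_def by (auto intro: dpred_conj)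
  from dpred_ex[OF this] show ?thesis
    by (rule dpred_cong) (auto dest: dfun_mem[OF assms(2)])
qed

lemma dfun_selector:
  assumes "dfun L M n f" "selector n m s" shows "dfun L M m (\<lambda>b. f (s b))"
proof -
  have "selector n (Suc m) (\<lambda>xs. s (drop 1 xs))"
    using selector_drop[of "Suc m" 1] by (intro selector_comp[OF assms(2)]) simp
  from dfun_dpred[OF assms(1) this, of 0] have "dpred L M (Suc m) (\<lambda>xs. xs ! 0 = f (s (drop 1 xs)))"
    by simp
  then have "dpred L M (Suc m) (\<lambda>xs. hd xs = f (s (tl xs)))"
    by (rule dpred_cong) (auto simp: in_nlists_Suc_iff)
  then show ?thesis
    unfolding dfun_def using dfun_mem[OF assms(1) selector_mem[OF assms(2)]] by auto
qed

text \<open>Parameters may be rearranged and padded, so all formulas over a finite set can be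
  written over one fixed enumeration \<open>ds\<close> of it.\<close>

lemma dpred_list:
  fixes ds :: "'a list"
  assumes "set ps \<subseteq> set ds" "dpred L M (Suc (length ps)) P"
  obtains Q where "dpred L M (Suc (length ds)) Q" "\<And>x. Q (x # ds) \<longleftrightarrow> P (x # ps)"
proof -
  obtain "is" where i: "length is = length ps" "set is \<subseteq> {..<length ds}" "ps = map ((!) ds) is"
    using selector_sublist_index[OF assms(1)] .
  define s where "s = (\<lambda>xs :: 'a list. map ((!) xs) is)"
  have "selector (length ps) (Suc (length ds)) (\<lambda>xs. s (drop 1 xs))"
  proof (rule selector_comp[of "length ps" "length ds" s])
    show "selector (length ps) (length ds) s"
      unfolding selector_def s_def using i by (intro exI[of _ "is"]) simp
    show "selector (length ds) (Suc (length ds)) (drop 1)"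
      using selector_drop[of "Suc (length ds)" 1] by simp
  qed
  then have "dpred L M (Suc (length ds)) (\<lambda>xs. P (xs ! 0 # s (drop 1 xs)))"
    by (intro dpred_selector[OF assms(2)] selector_Cons) auto
  then show ?thesis by (rule that) (use i(3) in \<open>simp add: s_def\<close>)
qed

lemma dfun_if:
  assumes "dfun L M n f" "dfun L M n g" "dpred L M n P"
  shows "dfun L M n (\<lambda>xs. if P xs then f xs else g xs)"
proof -
  have s: "selector n (Suc n) (drop 1)" using selector_drop[of "Suc n" 1] by simp
  have P: "dpred L M (Suc n) (\<lambda>xs. P (drop 1 xs))" by (rule dpred_selector[OF assms(3) s])
  have "dpred L M (Suc n) (\<lambda>xs. (P (drop 1 xs) \<and> hd xs = f (tl xs)) \<or> (\<not> P (drop 1 xs) \<and> hd xs = g (tl xs)))"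
    using assms(1,2) P by (intro dpred_disj dpred_conj dpred_not) (auto simp: dfun_def)
  then have "dpred L M (Suc n) (\<lambda>xs. hd xs = (if P (tl xs) then f (tl xs) else g (tl xs)))"
    by (rule dpred_cong) (auto simp: in_nlists_Suc_iff)
  then show ?thesis using assms(1,2) unfolding dfun_def by auto
qed

text \<open>As simplification rules these loop on assumptions \<open>xs \<in> nlists (length xs) A\<close> and on
  \<open>nlists_def\<close>.\<close>

declare nlistsE_length [simp del] nlistsE_set [simp del]

section \<open>The pregeometry of algebraic closure\<close>

lemma definable_mono: "definable L M A n X \<Longrightarrow> A \<subseteq> B \<Longrightarrow> definable L M B n X"
  unfolding definable_def by (meson nlists_mono subsetD)

lemma acl_mono: "A \<subseteq> B \<Longrightarrow> acl L M A \<subseteq> acl L M B"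
  unfolding acl_def using definable_mono[of L M A 1 _ B] by auto

lemma acl_monoD: "a \<in> acl L M A \<Longrightarrow> A \<subseteq> B \<Longrightarrow> a \<in> acl L M B"
  using acl_mono by (rule subsetD)

lemma acl_subset_univ: "acl L M A \<subseteq> univ M"
  unfolding acl_def definable_def by auto

lemma acl_iff_sat:
  "a \<in> acl L M A \<longleftrightarrow> a \<in> univ M \<and> (\<exists>ps \<phi>. set ps \<subseteq> A \<and> wf_fm L (Suc (length ps)) \<phi> \<and>
     sat M (a # ps) \<phi> \<and> finite {x \<in> univ M. sat M (x # ps) \<phi>})"
proof -
  have eq: "{xs \<in> nlists 1 (univ M). sat M (xs @ ps) \<phi>} = (\<lambda>x. [x]) ` {x \<in> univ M. sat M (x # ps) \<phi>}"
    for ps \<phi>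
    by (auto simp: in_nlists_Suc_iff)
  have fin: "finite ((\<lambda>x. [x]) ` Y) \<longleftrightarrow> finite Y" for Y :: "'a set"
    by (rule finite_image_iff) (auto simp: inj_on_def)
  show ?thesis
  proof
    assume "a \<in> acl L M A"
    then obtain Y where "definable L M A 1 Y" and Y: "finite Y" "[a] \<in> Y"
      unfolding acl_def by auto
    then obtain k \<phi> ps where "wf_fm L (1 + k) \<phi>" "ps \<in> nlists k A"
      "Y = (\<lambda>x. [x]) ` {x \<in> univ M. sat M (x # ps) \<phi>}"
      unfolding definable_def eq by auto
    with Y show "a \<in> univ M \<and> (\<exists>ps \<phi>. set ps \<subseteq> A \<and> wf_fm L (Suc (length ps)) \<phi> \<and>
        sat M (a # ps) \<phi> \<and> finite {x \<in> univ M. sat M (x # ps) \<phi>})"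
      unfolding fin nlists_def by (intro conjI exI[of _ ps] exI[of _ \<phi>]) (auto simp: fin)
  next
    assume R: "a \<in> univ M \<and> (\<exists>ps \<phi>. set ps \<subseteq> A \<and> wf_fm L (Suc (length ps)) \<phi> \<and>
        sat M (a # ps) \<phi> \<and> finite {x \<in> univ M. sat M (x # ps) \<phi>})"
    then obtain ps \<phi> where p: "set ps \<subseteq> A" "wf_fm L (Suc (length ps)) \<phi>" "sat M (a # ps) \<phi>"
        "finite {x \<in> univ M. sat M (x # ps) \<phi>}" by blast
    have "ps \<in> nlists (length ps) A" "wf_fm L (1 + length ps) \<phi>" using p(1,2) by (auto intro: nlistsI)
    then have "definable L M A 1 ((\<lambda>x. [x]) ` {x \<in> univ M. sat M (x # ps) \<phi>})"
      unfolding definable_def eq by blast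
    with p R show "a \<in> acl L M A" unfolding acl_def by (auto simp: fin)
  qed
qed

lemma acl_finitary:
  assumes "a \<in> acl L M A" obtains bs where "set bs \<subseteq> A" "a \<in> acl L M (set bs)"
  using assms unfolding acl_iff_sat by blast

locale geometric_struc =
  fixes L :: "('f, 'r) lang" and M :: "('a, 'f, 'r) struc"
  assumes exch: "acl_exchange L M"
    and skolem: "\<And>n P. dpred L M (Suc n) P \<Longrightarrow> \<exists>f. dfun L M n f \<and>
      (\<forall>b\<in>nlists n (univ M). (\<exists>a\<in>univ M. P (a # b)) \<longrightarrow> P (f b # b))"
begin

abbreviation "U \<equiv> univ M"
abbreviation "cl \<equiv> acl L M"

text \<open>A Skolem function picks one of the finitely many solutions; if it is not
  \<open>x\<close>, exclude this solution from \<open>P\<close> and repeat with fewer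
  solutions.\<close>

lemma finite_definable_dfun:
  assumes "dpred L M (Suc n) P" "bs \<in> nlists n U" "finite {x \<in> U. P (x # bs)}" "x \<in> U" "P (x # bs)"
  shows "\<exists>f. dfun L M n f \<and> x = f bs"
  using assms
proof (induction "card {x \<in> U. P (x # bs)}" arbitrary: P rule: less_induct)
  case less
  obtain f where f: "dfun L M n f" "\<forall>b\<in>nlists n U. (\<exists>a\<in>U. P (a # b)) \<longrightarrow> P (f b # b)"
    using skolem[OF less.prems(1)] by auto
  show ?case
  proof (cases "x = f bs")
    case False
    define P' where "P' = (\<lambda>xs. P xs \<and> \<not> hd xs = f (tl xs))"
    have *: "dpred L M (Suc n) P'"
      unfolding P'_def using f(1) less.prems(1) by (auto simp: dfun_def intro: dpred_conj dpred_not)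
    have "f bs \<in> U" "P (f bs # bs)" using f less.prems dfun_mem[OF f(1), of bs] by auto
    then have sub: "{x \<in> U. P' (x # bs)} \<subset> {x \<in> U. P (x # bs)}"
      by (auto simp: P'_def)
    show ?thesis
    proof (rule less.hyps)
      show "card {x \<in> U. P' (x # bs)} < card {x \<in> U. P (x # bs)}"
        using less.prems(3) sub by (rule psubset_card_mono)
      show "finite {x \<in> U. P' (x # bs)}" using sub less.prems(3) finite_subset by blast
      show "P' (x # bs)" using False less.prems(5) by (simp add: P'_def)
    qed (use * less.prems in auto)
  qed (use f in auto)
qed

text \<open>The form in which algebraicity is used below: \<open>f\<close> can be evaluated at other
  tuples too, so algebraicity becomes uniform in the parameters and passes along elementary
  maps.\<close>

lemma in_acl_iff:
  assumes "set bs \<subseteq> U"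
  shows "a \<in> cl (set bs) \<longleftrightarrow> (\<exists>f. dfun L M (length bs) f \<and> a = f bs)"
proof
  assume "a \<in> cl (set bs)"
  then obtain ps \<phi> where ps: "a \<in> U" "set ps \<subseteq> set bs" "wf_fm L (Suc (length ps)) \<phi>"
    "sat M (a # ps) \<phi>" "finite {x \<in> U. sat M (x # ps) \<phi>}"
    unfolding acl_iff_sat by auto
  obtain P where P: "dpred L M (Suc (length bs)) P" "\<And>x. P (x # bs) \<longleftrightarrow> sat M (x # ps) \<phi>"
    using dpred_list[OF ps(2) dpred_sat[OF ps(3), of M]] by metis
  have "bs \<in> nlists (length bs) U" using assms by (intro nlistsI refl)
  moreover have "finite {x \<in> U. P (x # bs)}" "P (a # bs)" unfolding P(2) using ps by simp_all
  ultimately show "\<exists>f. dfun L M (length bs) f \<and> a = f bs"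
    using P(1) ps(1) by (intro finite_definable_dfun)
next
  assume "\<exists>f. dfun L M (length bs) f \<and> a = f bs"
  then obtain f where f: "dfun L M (length bs) f" "a = f bs" by auto
  have bs: "bs \<in> nlists (length bs) U" using assms by (intro nlistsI refl)
  obtain \<phi> where \<phi>: "wf_fm L (Suc (length bs)) \<phi>"
    "\<forall>xs\<in>nlists (Suc (length bs)) U. sat M xs \<phi> \<longleftrightarrow> hd xs = f (tl xs)"
    using f(1) unfolding dfun_def dpred_def by auto
  have "sat M (x # bs) \<phi> \<longleftrightarrow> x = a" if "x \<in> U" for x
    using \<phi>(2) f(2) bs that by simp
  then have "{x \<in> U. sat M (x # bs) \<phi>} \<subseteq> {a}" "sat M (a # bs) \<phi>"
    using dfun_mem[OF f(1) bs] f(2) by auto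
  then show "a \<in> cl (set bs)"
    unfolding acl_iff_sat using dfun_mem[OF f(1) bs] f(2) \<phi>(1) finite_subset by blast
qed

lemma dfun_nth:
  assumes "i < n" shows "dfun L M n (\<lambda>xs. xs ! i)"
proof -
  have "dpred L M (Suc n) (\<lambda>xs. hd xs = tl xs ! i)"
    using assms by (intro dpred_cong[OF dpred_nth_eq[of 0 "Suc n" "Suc i"]]) (auto simp: in_nlists_Suc_iff)
  then show ?thesis unfolding dfun_def using nlistsE_nth_in[OF _ assms] by auto
qed

lemma acl_superset: assumes "A \<subseteq> U" shows "A \<subseteq> cl A"
proof
  fix a assume "a \<in> A"
  then have "a \<in> cl (set [a])"
    using assms dfun_nth[of 0 1] by (subst in_acl_iff) auto
  then show "a \<in> cl A" using acl_mono[of "{a}" A L M] \<open>a \<in> A\<close> by auto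
qed

lemma dfun_comp_Cons:
  assumes "dfun L M (Suc n) f" "dfun L M n g" shows "dfun L M n (\<lambda>b. f (g b # b))"
proof -
  have "dfun L M (Suc n) (\<lambda>xs. g (drop 1 xs))"
    using selector_drop[of "Suc n" 1] by (intro dfun_selector[OF assms(2)]) simp
  moreover have "dpred L M (Suc (Suc n)) (\<lambda>xs. xs ! 1 = f (xs ! 0 # drop 2 xs))"
    using selector_drop[of "Suc (Suc n)" 2] by (intro dfun_dpred[OF assms(1)] selector_Cons) simp_all
  ultimately have "dpred L M (Suc n) (\<lambda>xs. (g (drop 1 xs) # xs) ! 1 = f ((g (drop 1 xs) # xs) ! 0 # drop 2 (g (drop 1 xs) # xs)))"
    by (rule dpred_subst[rotated])
  then have "dpred L M (Suc n) (\<lambda>xs. hd xs = f (g (tl xs) # tl xs))"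
    by (rule dpred_cong) (auto simp: in_nlists_Suc_iff)
  then show ?thesis
    unfolding dfun_def using dfun_mem[OF assms(1)] dfun_mem[OF assms(2)] by auto
qed

text \<open>Substitute the function that gives \<open>b\<close> into the one that gives
  \<open>a\<close>, after writing both over a common tuple \<open>cs\<close>.\<close>

lemma acl_cut:
  assumes "A \<subseteq> U" "b \<in> cl A" "a \<in> cl (insert b A)" shows "a \<in> cl A"
proof -
  obtain ps where ps: "set ps \<subseteq> insert b A" "a \<in> cl (set ps)" using assms(3) by (rule acl_finitary)
  obtain rs where rs: "set rs \<subseteq> A" "b \<in> cl (set rs)" using assms(2) by (rule acl_finitary)
  define cs where "cs = filter (\<lambda>x. x \<in> A) ps @ rs"
  have cs: "set cs \<subseteq> A" "set ps \<subseteq> set (b # cs)" "set rs \<subseteq> set cs" using ps rs by (auto simp: cs_def)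
  have b: "b \<in> U" using assms(2) acl_subset_univ[of L M A] by auto
  obtain f where f: "dfun L M (Suc (length cs)) f" "a = f (b # cs)"
    using in_acl_iff[of "b # cs" a] ps(2) acl_mono[OF cs(2), of L M] cs(1) assms(1) b by auto
  obtain g where g: "dfun L M (length cs) g" "b = g cs"
    using in_acl_iff[of cs b] rs(2) acl_mono[OF cs(3), of L M] cs(1) assms(1) by auto
  have "a \<in> cl (set cs)"
    using dfun_comp_Cons[OF f(1) g(1)] f(2) g(2) cs(1) assms(1) by (subst in_acl_iff) auto
  then show ?thesis using acl_mono[OF cs(1), of L M] by auto
qed

lemma acl_trans:
  assumes "a \<in> cl B" "B \<subseteq> cl A" "A \<subseteq> U" shows "a \<in> cl A"
proof -
  obtain bs where bs: "set bs \<subseteq> B" "a \<in> cl (set bs)" using assms(1) by (rule acl_finitary)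
  have "a \<in> cl A" if "set bs \<subseteq> cl A" "a \<in> cl (A \<union> set bs)" for bs
    using that
  proof (induction bs)
    case (Cons b bs)
    have "b \<in> cl (A \<union> set bs)" using Cons.prems acl_mono[of A "A \<union> set bs" L M] by auto
    moreover have "A \<union> set bs \<subseteq> U" using Cons.prems assms(3) acl_subset_univ[of L M A] by auto
    ultimately have "a \<in> cl (A \<union> set bs)" using Cons.prems(2) acl_cut[of "A \<union> set bs" b a] by simp
    then show ?case using Cons.IH Cons.prems(1) by simp
  qed simp
  from this[of bs] show ?thesis using bs assms(2) acl_mono[of "set bs" "A \<union> set bs" L M] by auto
qed

lemma acl_exchangeD:
  assumes "A \<subseteq> U" "b \<in> U" "a \<in> cl (insert b A)" "a \<notin> cl A" shows "b \<in> cl (insert a A)"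
  using assms exch acl_subset_univ[of L M "insert b A"] unfolding acl_exchange_def by blast

text \<open>Add the elements of \<open>S\<close> one at a time; exchange applies to the one that
  first makes \<open>a\<close> algebraic.\<close>

lemma acl_exchange_finite:
  assumes "finite S" "S \<subseteq> U" "A \<subseteq> U" "a \<in> cl (A \<union> S)" "a \<notin> cl A"
  shows "\<exists>s\<in>S. s \<in> cl (insert a (A \<union> (S - {s})))"
  using assms
proof (induction S)
  case (insert x S)
  show ?case
  proof (cases "a \<in> cl (A \<union> S)")
    case True
    then obtain s where s: "s \<in> S" "s \<in> cl (insert a (A \<union> (S - {s})))" using insert by auto
    then show ?thesis
      using acl_monoD[OF s(2), of "insert a (A \<union> (insert x S - {s}))"] by blast
  next
    case False
    then have "x \<in> cl (insert a (A \<union> S))"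
      using insert.prems acl_exchangeD[of "A \<union> S" x a] by simp
    then show ?thesis
      using acl_mono[of "insert a (A \<union> S)" "insert a (A \<union> (insert x S - {x}))" L M] insert.hyps by auto
  qed
qed simp

text \<open>If adding \<open>x\<close> made an old \<open>s\<close> dependent, exchange would put
  \<open>x\<close> into the closure of \<open>B \<union> S\<close>.\<close>

lemma acl_indep_insert:
  assumes "acl_indep L M B S" "x \<notin> cl (B \<union> S)" "x \<in> U" "B \<subseteq> U" "S \<subseteq> U"
  shows "acl_indep L M B (insert x S)"
  unfolding acl_indep_def
proof
  fix s assume s: "s \<in> insert x S"
  show "s \<notin> cl (B \<union> (insert x S - {s}))"
  proof (cases "s = x")
    case True
    then show ?thesis
      using assms(2) acl_mono[of "B \<union> (insert x S - {x})" "B \<union> S" L M] by auto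
  next
    case False
    then have "s \<notin> cl (B \<union> (S - {s}))" "s \<in> S" using s assms(1) unfolding acl_indep_def by auto
    moreover have "insert s (B \<union> (S - {s})) = B \<union> S" "B \<union> (insert x S - {s}) = insert x (B \<union> (S - {s}))"
      using \<open>s \<in> S\<close> False by auto
    ultimately show ?thesis using assms acl_exchangeD[of "B \<union> (S - {s})" x s] by auto
  qed
qed

lemma maximal_acl_indep:
  assumes "finite A" "A \<subseteq> U" "B \<subseteq> U"
  shows "\<exists>S\<subseteq>A. acl_indep L M B S \<and> A \<subseteq> cl (B \<union> S)"
  using assms
proof (induction A)
  case (insert x A)
  then obtain S where S: "S \<subseteq> A" "acl_indep L M B S" "A \<subseteq> cl (B \<union> S)" by auto
  have BS: "B \<union> S \<subseteq> cl (B \<union> S)" using S insert.prems by (intro acl_superset) auto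
  show ?case
  proof (cases "x \<in> cl (B \<union> S)")
    case False
    then have "acl_indep L M B (insert x S)" using S insert.prems by (intro acl_indep_insert) auto
    moreover have "insert x A \<subseteq> cl (B \<union> insert x S)"
      using S(1,3) insert.prems acl_mono[of "B \<union> S" "B \<union> insert x S" L M] acl_superset[of "B \<union> insert x S"]
      by blast
    ultimately show ?thesis using S by (intro exI[of _ "insert x S"]) auto
  qed (use S in auto)
qed (auto simp: acl_indep_def)

text \<open>Each entry is independent of the later ones, which suits lists built by prepending a new
  generic element.\<close>

primrec ind_list :: "'a set \<Rightarrow> 'a list \<Rightarrow> bool" where
  "ind_list B [] \<longleftrightarrow> True"
| "ind_list B (u # us) \<longleftrightarrow> u \<notin> cl (B \<union> set us) \<and> ind_list B us"

text \<open>Steinitz exchange: every entry of \<open>us\<close> takes the place of one element of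
  \<open>S\<close>, and \<open>S'\<close> holds those not yet replaced. A new \<open>u\<close> is
  algebraic over the earlier entries and \<open>S'\<close>, and exchange finds the element that it
  replaces.\<close>

lemma steinitz:
  assumes "ind_list B us" "set us \<subseteq> cl (B \<union> S)" "finite S" "S \<subseteq> U" "B \<subseteq> U"
  shows "\<exists>S'\<subseteq>S. card S' + length us \<le> card S \<and> S \<subseteq> cl (B \<union> set us \<union> S')"
  using assms
proof (induction us)
  case Nil
  then show ?case using acl_superset[of "B \<union> S"] by auto
next
  case (Cons u us)
  then obtain S' where S': "S' \<subseteq> S" "card S' + length us \<le> card S" "S \<subseteq> cl (B \<union> set us \<union> S')"
    by auto
  have us: "set (u # us) \<subseteq> U" using Cons.prems acl_subset_univ[of L M "B \<union> S"] by auto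
  have fin: "finite S'" using S'(1) Cons.prems(3) by (rule finite_subset)
  have "B \<union> set us \<union> S' \<subseteq> U" using S' Cons.prems us by auto
  then have "B \<union> S \<subseteq> cl (B \<union> set us \<union> S')"
    using S'(3) acl_superset[of "B \<union> set us \<union> S'"] by auto
  then have "u \<in> cl ((B \<union> set us) \<union> S')"
    using acl_trans[of u "B \<union> S" "B \<union> set us \<union> S'"] Cons.prems S' us by auto
  from acl_exchange_finite[OF fin _ _ this]
  obtain s where s: "s \<in> S'" "s \<in> cl (insert u (B \<union> set us \<union> (S' - {s})))"
    using Cons.prems S' us by auto
  have card: "card (S' - {s}) + length (u # us) \<le> card S"
    using S'(2) s(1) fin card_gt_0_iff[of S'] by (auto simp: card_Diff_singleton)
  let ?C = "B \<union> set (u # us) \<union> (S' - {s})"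
  have C: "?C \<subseteq> U" using Cons.prems S' us by auto
  have "s \<in> cl ?C" using s(2) by (simp add: Un_assoc)
  then have "B \<union> set us \<union> S' \<subseteq> cl ?C" using acl_superset[OF C] by auto
  then have "S \<subseteq> cl ?C" using S'(3) acl_trans[OF _ _ C] by blast
  then show ?case using card S'(1) by (intro exI[of _ "S' - {s}"]) auto
qed

lemma ind_list_length:
  assumes "ind_list B us" "set us \<subseteq> cl (B \<union> S)" "finite S" "S \<subseteq> U" "B \<subseteq> U"
  shows "length us \<le> card S"
  using steinitz[OF assms] by auto

end

section \<open>Definable sets and elementary maps\<close>

text \<open>Sets of elements instead of one-element lists: types become families of sets, and
  compactness speaks of their intersections. The same notion serves \<open>L\<close> and the
  language of the pair.\<close>

definition dset :: "('f, 'r) lang \<Rightarrow> ('a, 'f, 'r) struc \<Rightarrow> 'a set \<Rightarrow> 'a set \<Rightarrow> bool" where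
  "dset L M A X \<longleftrightarrow> (\<exists>ps P. set ps \<subseteq> A \<and> dpred L M (Suc (length ps)) P \<and>
     X = {x \<in> univ M. P (x # ps)})"

lemma dset_mono: "dset L M A X \<Longrightarrow> A \<subseteq> B \<Longrightarrow> dset L M B X"
  unfolding dset_def by blast

lemma dset_subset_univ: "dset L M A X \<Longrightarrow> X \<subseteq> univ M"
  unfolding dset_def by auto

lemma dset_Collect:
  "set ps \<subseteq> A \<Longrightarrow> dpred L M (Suc (length ps)) P \<Longrightarrow> dset L M A {x \<in> univ M. P (x # ps)}"
  unfolding dset_def by blast

lemma dset_univ: "dset L M A (univ M)"
  using dset_Collect[of "[]" A L M "\<lambda>_. True"] dpred_True by auto

lemma dset_Compl: assumes "dset L M A X" shows "dset L M A (univ M - X)"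
proof -
  obtain ps P where "set ps \<subseteq> A" "dpred L M (Suc (length ps)) P" "X = {x \<in> univ M. P (x # ps)}"
    using assms unfolding dset_def by auto
  moreover from this have "univ M - X = {x \<in> univ M. \<not> P (x # ps)}" by auto
  ultimately show ?thesis using dset_Collect[OF _ dpred_not, of ps A L M P] by simp
qed

lemma dset_Int: assumes "dset L M A X" "dset L M A Y" shows "dset L M A (X \<inter> Y)"
proof -
  obtain ps P where p: "set ps \<subseteq> A" "dpred L M (Suc (length ps)) P" "X = {x \<in> univ M. P (x # ps)}"
    using assms(1) unfolding dset_def by auto
  obtain qs Q where q: "set qs \<subseteq> A" "dpred L M (Suc (length qs)) Q" "Y = {x \<in> univ M. Q (x # qs)}"
    using assms(2) unfolding dset_def by auto
  let ?m = "Suc (length (ps @ qs))"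
  have "dpred L M ?m (\<lambda>xs. P (take (Suc (length ps)) xs))"
    by (intro dpred_selector[OF p(2)] selector_take) simp
  moreover have "selector (length qs) ?m (drop (Suc (length ps)))"
    using selector_drop[of ?m "Suc (length ps)"] by simp
  then have "dpred L M ?m (\<lambda>xs. Q (xs ! 0 # drop (Suc (length ps)) xs))"
    by (intro dpred_selector[OF q(2)] selector_Cons) simp_all
  ultimately have "dset L M A {x \<in> univ M. P (take (Suc (length ps)) (x # ps @ qs)) \<and>
      Q ((x # ps @ qs) ! 0 # drop (Suc (length ps)) (x # ps @ qs))}"
    using p(1) q(1) by (intro dset_Collect dpred_conj) auto
  moreover have "\<dots> = X \<inter> Y" using p(3) q(3) by auto
  ultimately show ?thesis by simp
qed

lemma dset_Inter:
  "finite \<G> \<Longrightarrow> (\<And>X. X \<in> \<G> \<Longrightarrow> dset L M A X) \<Longrightarrow> dset L M A (univ M \<inter> \<Inter>\<G>)"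
proof (induction \<G> rule: finite_induct)
  case (insert X \<G>)
  have "univ M \<inter> \<Inter>(insert X \<G>) = X \<inter> (univ M \<inter> \<Inter>\<G>)" by auto
  then show ?case using insert by (auto intro!: dset_Int)
qed (simp add: dset_univ)

lemma dset_finitary:
  assumes "dset L M A X" obtains B where "finite B" "B \<subseteq> A" "dset L M B X"
  using assms unfolding dset_def by (metis List.finite_set order_refl)

lemma dset_list:
  assumes "dset L M (set ds) X"
  obtains P where "dpred L M (Suc (length ds)) P" "X = {x \<in> univ M. P (x # ds)}"
proof -
  obtain ps P where p: "set ps \<subseteq> set ds" "dpred L M (Suc (length ps)) P" "X = {x \<in> univ M. P (x # ps)}"
    using assms unfolding dset_def by auto
  obtain Q where "dpred L M (Suc (length ds)) Q" "\<And>x. Q (x # ds) \<longleftrightarrow> P (x # ps)"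
    using dpred_list[OF p(1,2)] by metis
  then show ?thesis using that p(3) by simp
qed

lemma definable_dpred:
  assumes "set ps \<subseteq> A" "dpred L M (n + length ps) P" "A \<subseteq> univ M"
  shows "definable L M A n {xs \<in> nlists n (univ M). P (xs @ ps)}"
proof -
  obtain \<phi> where \<phi>: "wf_fm L (n + length ps) \<phi>"
    "\<And>xs. xs \<in> nlists (n + length ps) (univ M) \<Longrightarrow> sat M xs \<phi> \<longleftrightarrow> P xs"
    using assms(2) unfolding dpred_def by auto
  have "xs @ ps \<in> nlists (n + length ps) (univ M)" if "xs \<in> nlists n (univ M)" for xs
    using that assms(1,3) by (auto simp: nlists_def)
  then have "{xs \<in> nlists n (univ M). P (xs @ ps)} = {xs \<in> nlists n (univ M). sat M (xs @ ps) \<phi>}"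
    using \<phi>(2) by blast
  moreover have "ps \<in> nlists (length ps) A" using assms(1) by (intro nlistsI refl)
  ultimately show ?thesis unfolding definable_def using \<phi>(1) by blast
qed

text \<open>A set of pairs, so that extending means inserting a pair and inverting means taking the
  converse. Since equality is a formula, \<open>Z\<close> is automatically the graph of an injective
  map.\<close>

definition elem_map :: "('f, 'r) lang \<Rightarrow> ('a, 'f, 'r) struc \<Rightarrow> ('a \<times> 'a) set \<Rightarrow> bool" where
  "elem_map L M Z \<longleftrightarrow> Z \<subseteq> univ M \<times> univ M \<and>
     (\<forall>ws P. set ws \<subseteq> Z \<longrightarrow> dpred L M (length ws) P \<longrightarrow> (P (map fst ws) \<longleftrightarrow> P (map snd ws)))"

lemma elem_mapD:
  "elem_map L M Z \<Longrightarrow> set ws \<subseteq> Z \<Longrightarrow> dpred L M (length ws) P \<Longrightarrow> P (map fst ws) \<longleftrightarrow> P (map snd ws)"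
  unfolding elem_map_def by blast

lemma elem_map_mono: "elem_map L M Z \<Longrightarrow> W \<subseteq> Z \<Longrightarrow> elem_map L M W"
  unfolding elem_map_def by blast

lemma elem_map_converse: assumes "elem_map L M Z" shows "elem_map L M (Z\<inverse>)"
  unfolding elem_map_def
proof (intro conjI allI impI)
  fix ws P assume "set ws \<subseteq> Z\<inverse>" "dpred L M (length ws) P"
  then have "P (map fst (map prod.swap ws)) \<longleftrightarrow> P (map snd (map prod.swap ws))"
    by (intro elem_mapD[OF assms]) auto
  then show "P (map fst ws) \<longleftrightarrow> P (map snd ws)" by (simp add: comp_def)
qed (use assms in \<open>auto simp: elem_map_def\<close>)

text \<open>One enumeration and one direction suffice: other tuples are selected from the
  enumeration, and the reverse implication is the forward one for the negation.\<close>

lemma elem_map_list: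
  assumes "set zs \<subseteq> univ M \<times> univ M"
    and "\<And>P. dpred L M (length zs) P \<Longrightarrow> P (map fst zs) \<Longrightarrow> P (map snd zs)"
  shows "elem_map L M (set zs)"
  unfolding elem_map_def
proof (intro conjI allI impI assms(1))
  fix ws P assume ws: "set ws \<subseteq> set zs" and P: "dpred L M (length ws) P"
  obtain "is" where i: "length is = length ws" "set is \<subseteq> {..<length zs}" "ws = map ((!) zs) is"
    using selector_sublist_index[OF ws] .
  define Q where "Q = (\<lambda>xs. P (map ((!) xs) is))"
  have Q: "dpred L M (length zs) Q"
    unfolding Q_def using i(1,2) by (intro dpred_selector[OF P]) (auto simp: selector_def)
  have "map ((!) (map g zs)) is = map g ws" for g :: "'a \<times> 'a \<Rightarrow> 'a"
    using i(2,3) by auto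
  then have "P (map g ws) \<longleftrightarrow> Q (map g zs)" for g :: "'a \<times> 'a \<Rightarrow> 'a"
    by (simp add: Q_def)
  then show "P (map fst ws) \<longleftrightarrow> P (map snd ws)"
    using assms(2)[OF Q] assms(2)[OF dpred_not[OF Q]] by auto
qed

lemma image_Id_on [simp]: "fst ` Id_on A = A" "snd ` Id_on A = A"
  by force+

lemma elem_map_Id_on: "A \<subseteq> univ M \<Longrightarrow> elem_map L M (Id_on A)"
  unfolding elem_map_def
proof (intro conjI allI impI)
  fix ws :: "('a \<times> 'a) list" and P :: "'a list \<Rightarrow> bool" assume "set ws \<subseteq> Id_on A"
  then have "map fst ws = map snd ws" by (auto simp: Id_on_def)
  then show "P (map fst ws) \<longleftrightarrow> P (map snd ws)" by (simp only:)
qed auto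

section \<open>Elementary maps and algebraic closure\<close>

context geometric_struc
begin

lemma finite_definable_acl:
  assumes "set bs \<subseteq> U" "dpred L M (Suc (length bs)) P" "finite {x \<in> U. P (x # bs)}"
  shows "{x \<in> U. P (x # bs)} \<subseteq> cl (set bs)"
proof
  fix x assume x: "x \<in> {x \<in> U. P (x # bs)}"
  have "bs \<in> nlists (length bs) U" using assms(1) by (intro nlistsI refl)
  then show "x \<in> cl (set bs)"
    unfolding in_acl_iff[OF assms(1)] using x finite_definable_dfun[OF assms(2) _ assms(3)] by blast
qed

text \<open>\<open>R\<close> is a disjunction of equations \<open>y = f bs\<close>. It makes sense
  at every tuple \<open>b\<close>, where its solutions are algebraic over \<open>b\<close>, so it
  can carry finiteness along an elementary map.\<close>

lemma finite_subset_acl_definable: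
  assumes "finite Y" "Y \<subseteq> cl (set bs)" "set bs \<subseteq> U"
  shows "\<exists>R. dpred L M (Suc (length bs)) R \<and> (\<forall>y\<in>Y. R (y # bs)) \<and>
    (\<forall>b\<in>nlists (length bs) U. \<forall>x\<in>U. R (x # b) \<longrightarrow> x \<in> cl (set b))"
  using assms
proof (induction Y)
  case empty
  show ?case using dpred_not[OF dpred_True] by (intro exI[of _ "\<lambda>_. False"]) auto
next
  case (insert y Y)
  then obtain R where R: "dpred L M (Suc (length bs)) R" "\<forall>y\<in>Y. R (y # bs)"
    "\<forall>b\<in>nlists (length bs) U. \<forall>x\<in>U. R (x # b) \<longrightarrow> x \<in> cl (set b)" by auto
  obtain f where f: "dfun L M (length bs) f" "y = f bs"
    using insert.prems in_acl_iff by auto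
  have "dpred L M (Suc (length bs)) (\<lambda>xs. R xs \<or> hd xs = f (tl xs))"
    using f(1) R(1) by (intro dpred_disj) (auto simp: dfun_def)
  moreover have "f b \<in> cl (set b)" if "b \<in> nlists (length bs) U" for b
  proof -
    have "set b \<subseteq> U" "dfun L M (length b) f"
      using f(1) nlistsE_set[OF that] nlistsE_length[OF that] by auto
    then show ?thesis using in_acl_iff by blast
  qed
  ultimately show ?case using R f(2) by (intro exI[of _ "\<lambda>xs. R xs \<or> hd xs = f (tl xs)"]) auto
qed

text \<open>If \<open>P\<close> had finitely many solutions over the range, it would imply a formula
  \<open>R\<close> whose solutions are always algebraic. That \<open>P\<close> implies
  \<open>R\<close> is a formula about the parameters, so it also holds over the domain and makes
  \<open>c\<close> algebraic.\<close>

lemma elem_map_infinite: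
  assumes "elem_map L M (set zs)" "dpred L M (Suc (length zs)) P" "c \<in> U" "P (c # map fst zs)"
    "c \<notin> cl (set (map fst zs))"
  shows "infinite {x \<in> U. P (x # map snd zs)}"
proof
  assume fin: "finite {x \<in> U. P (x # map snd zs)}"
  have sub: "set (map fst zs) \<subseteq> U" "set (map snd zs) \<subseteq> U" using assms(1) by (auto simp: elem_map_def)
  have "{x \<in> U. P (x # map snd zs)} \<subseteq> cl (set (map snd zs))"
    using fin assms(2) sub(2) by (intro finite_definable_acl) auto
  from finite_subset_acl_definable[OF fin this sub(2)]
  obtain R where R: "dpred L M (Suc (length zs)) R" "\<forall>x\<in>U. P (x # map snd zs) \<longrightarrow> R (x # map snd zs)"
    "\<forall>b\<in>nlists (length zs) U. \<forall>x\<in>U. R (x # b) \<longrightarrow> x \<in> cl (set b)" by auto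
  have "\<forall>x\<in>U. P (x # map fst zs) \<longrightarrow> R (x # map fst zs)"
    using elem_mapD[OF assms(1) _ dpred_all[OF dpred_imp[OF assms(2) R(1)]]] R(2) by simp
  then have "R (c # map fst zs)" using assms(3,4) by blast
  moreover have "map fst zs \<in> nlists (length zs) U" using sub(1) by (intro nlistsI) auto
  ultimately show False using R(3) assms(3,5) by blast
qed

text \<open>The map preserves the equation that expresses \<open>c\<close> as a value of a function
  at a tuple from the domain of \<open>W\<close>.\<close>

lemma elem_map_acl:
  assumes "elem_map L M Z" "W \<subseteq> Z" "(c, c') \<in> Z" "c \<in> cl (fst ` W)"
  shows "c' \<in> cl (snd ` W)"
proof -
  obtain bs where bs: "set bs \<subseteq> fst ` W" "c \<in> cl (set bs)" using assms(4) by (rule acl_finitary)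
  have "\<forall>b\<in>set bs. \<exists>w\<in>W. fst w = b" using bs(1) by auto
  then obtain g where g: "\<forall>b\<in>set bs. g b \<in> W \<and> fst (g b) = b" by metis
  define ws where "ws = map g bs"
  have ws: "map fst ws = bs" "set ws \<subseteq> W" using g by (auto simp: ws_def intro: map_idI)
  have sub: "set bs \<subseteq> U" "set (map snd ws) \<subseteq> U"
    using ws assms(1,2) bs(1) unfolding elem_map_def by fastforce+
  obtain f where f: "dfun L M (length bs) f" "c = f bs" using in_acl_iff sub bs(2) by auto
  have "dpred L M (length ((c, c') # ws)) (\<lambda>xs. hd xs = f (tl xs))"
    using f(1) ws(1) by (auto simp: dfun_def)
  from elem_mapD[OF assms(1) _ this] have "c' = f (map snd ws)" using f(2) ws assms(2,3) by auto
  then have "c' \<in> cl (set (map snd ws))" using in_acl_iff[OF sub(2)] f(1) ws(1) by auto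
  then show ?thesis by (rule acl_monoD) (use ws(2) in auto)
qed

lemma elem_map_dfun:
  assumes "elem_map L M (set zs)" "dfun L M (length zs) f"
  shows "elem_map L M (insert (f (map fst zs), f (map snd zs)) (set zs))"
proof -
  have zs: "set zs \<subseteq> U \<times> U" using assms(1) by (auto simp: elem_map_def)
  then have "map fst zs \<in> nlists (length zs) U" "map snd zs \<in> nlists (length zs) U"
    by (auto intro!: nlistsI)
  then have mem: "f (map fst zs) \<in> U" "f (map snd zs) \<in> U" using dfun_mem[OF assms(2)] by auto
  have "elem_map L M (set ((f (map fst zs), f (map snd zs)) # zs))"
  proof (rule elem_map_list)
    fix P assume "dpred L M (length ((f (map fst zs), f (map snd zs)) # zs)) P"
      "P (map fst ((f (map fst zs), f (map snd zs)) # zs))"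
    moreover from this have "dpred L M (length zs) (\<lambda>b. P (f b # b))"
      using assms(2) by (intro dpred_subst) auto
    ultimately show "P (map snd ((f (map fst zs), f (map snd zs)) # zs))"
      using elem_mapD[OF assms(1) order_refl] by auto
  qed (use zs mem in auto)
  then show ?thesis by simp
qed

lemma elem_map_insert_acl:
  assumes "finite Z" "elem_map L M Z" "c \<in> cl (fst ` Z)"
  obtains c' where "elem_map L M (insert (c, c') Z)"
proof -
  obtain zs where zs: "set zs = Z" using finite_list[OF assms(1)] ..
  have "set (map fst zs) \<subseteq> U" using assms(2) zs by (auto simp: elem_map_def)
  then obtain f where "dfun L M (length zs) f" "c = f (map fst zs)"
    using in_acl_iff[of "map fst zs" c] assms(3) zs by auto
  then show ?thesis using elem_map_dfun[of zs f] assms(2) zs that by auto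
qed

section \<open>Special sets\<close>

text \<open>For finite \<open>A\<close> this expresses that \<open>A\<close> is independent from
  \<open>E\<close> over \<open>A \<inter> E\<close>. A single witness \<open>S\<close> is convenient
  because each one-point extension either keeps it or enlarges it by the new element.\<close>

definition good :: "'a set \<Rightarrow> 'a set \<Rightarrow> bool" where
  "good E A \<longleftrightarrow> (\<exists>S\<subseteq>A. acl_indep L M E S \<and> A \<subseteq> cl (S \<union> (A \<inter> E)))"

lemma good_insert_mem:
  assumes "good E A" "c \<in> E" "E \<subseteq> U" "A \<subseteq> U" shows "good E (insert c A)"
proof -
  obtain S where S: "S \<subseteq> A" "acl_indep L M E S" "A \<subseteq> cl (S \<union> (A \<inter> E))"
    using assms(1) unfolding good_def by auto
  have "S \<union> (A \<inter> E) \<subseteq> S \<union> (insert c A \<inter> E)" by auto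
  then have "A \<subseteq> cl (S \<union> (insert c A \<inter> E))" by (rule order_trans[OF S(3) acl_mono])
  moreover have "S \<union> (insert c A \<inter> E) \<subseteq> U" using S assms by auto
  then have "c \<in> cl (S \<union> (insert c A \<inter> E))" by (rule subsetD[OF acl_superset]) (use assms in simp)
  ultimately show ?thesis using S unfolding good_def by (intro exI[of _ S]) auto
qed

lemma good_insert_acl:
  assumes "good E A" "c \<in> cl A" "E \<subseteq> U" "A \<subseteq> U" shows "good E (insert c A)"
proof -
  obtain S where S: "S \<subseteq> A" "acl_indep L M E S" "A \<subseteq> cl (S \<union> (A \<inter> E))"
    using assms(1) unfolding good_def by auto
  have "S \<union> (A \<inter> E) \<subseteq> U" using S assms by auto
  then have "c \<in> cl (S \<union> (A \<inter> E))" by (rule acl_trans[OF assms(2) S(3)])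
  then have "insert c A \<subseteq> cl (S \<union> (A \<inter> E))" using S(3) by simp
  moreover have "cl (S \<union> (A \<inter> E)) \<subseteq> cl (S \<union> (insert c A \<inter> E))" by (rule acl_mono) auto
  ultimately have "insert c A \<subseteq> cl (S \<union> (insert c A \<inter> E))" by (rule order_trans)
  then show ?thesis using S unfolding good_def by (intro exI[of _ S]) auto
qed

lemma good_insert_generic:
  assumes "good E A" "c \<notin> cl (E \<union> A)" "c \<in> U" "E \<subseteq> U" "A \<subseteq> U" shows "good E (insert c A)"
proof -
  obtain S where S: "S \<subseteq> A" "acl_indep L M E S" "A \<subseteq> cl (S \<union> (A \<inter> E))"
    using assms(1) unfolding good_def by auto
  have "c \<notin> cl (E \<union> S)" using assms(2) acl_monoD[of c L M "E \<union> S" "E \<union> A"] S by auto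
  then have "acl_indep L M E (insert c S)" using S assms by (intro acl_indep_insert) auto
  moreover have "S \<union> (A \<inter> E) \<subseteq> insert c S \<union> (insert c A \<inter> E)" by auto
  then have "A \<subseteq> cl (insert c S \<union> (insert c A \<inter> E))" by (rule order_trans[OF S(3) acl_mono])
  moreover have "insert c S \<union> (insert c A \<inter> E) \<subseteq> U" using S assms by auto
  then have "c \<in> cl (insert c S \<union> (insert c A \<inter> E))" by (rule subsetD[OF acl_superset]) simp
  ultimately show ?thesis using S unfolding good_def by (intro exI[of _ "insert c S"]) auto
qed

text \<open>Otherwise exchange would make some \<open>s\<close> in \<open>S\<close> algebraic over
  \<open>c\<close>, \<open>A \<inter> E\<close> and the rest of \<open>S\<close>, against the
  independence of \<open>S\<close> over \<open>E\<close>.\<close>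

lemma good_acl_Int:
  assumes "good E A" "c \<in> cl A" "c \<in> E" "E \<subseteq> U" "A \<subseteq> U" "finite A"
  shows "c \<in> cl (A \<inter> E)"
proof (rule ccontr)
  assume c: "c \<notin> cl (A \<inter> E)"
  obtain S where S: "S \<subseteq> A" "acl_indep L M E S" "A \<subseteq> cl (S \<union> (A \<inter> E))"
    using assms(1) unfolding good_def by auto
  have sub: "S \<union> (A \<inter> E) \<subseteq> U" using S assms by auto
  then have "c \<in> cl ((A \<inter> E) \<union> S)" using acl_trans[OF assms(2) S(3)] by (simp add: Un_commute)
  then obtain s where s: "s \<in> S" "s \<in> cl (insert c ((A \<inter> E) \<union> (S - {s})))"
    using acl_exchange_finite[of S "A \<inter> E" c] c S sub finite_subset[OF S(1) assms(6)] by auto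
  have "s \<in> cl (E \<union> (S - {s}))" using s(2) by (rule acl_monoD) (use assms(3) in auto)
  then show False using S(2) s(1) unfolding acl_indep_def by auto
qed

text \<open>Apply the equality of dimensions to an enumeration of \<open>S\<close>: a largest subset
  independent over \<open>E\<close> has at least as many elements as \<open>S\<close>, hence is
  \<open>S\<close>.\<close>

lemma special_acl_indep:
  assumes "special L M E D" "S \<subseteq> D" "finite S" "acl_indep L M (E \<inter> D) S"
  shows "acl_indep L M E S"
proof -
  obtain as where as: "set as = S" using finite_list[OF assms(3)] ..
  have fin: "finite (card ` {S'. S' \<subseteq> set as \<and> acl_indep L M B S'})" for B by auto
  have "card S \<le> acl_dim L M as (E \<inter> D)"
    unfolding acl_dim_def using assms(4) as by (intro Max_ge[OF fin]) auto
  also have "\<dots> = acl_dim L M as E" using assms(1,2) as unfolding special_def by (metis in_lists_conv_set subsetD)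
  finally have le: "card S \<le> acl_dim L M as E" .
  have "{} \<in> {S'. S' \<subseteq> set as \<and> acl_indep L M E S'}" by (auto simp: acl_indep_def)
  then have "acl_dim L M as E \<in> card ` {S'. S' \<subseteq> set as \<and> acl_indep L M E S'}"
    unfolding acl_dim_def by (intro Max_in[OF fin]) blast
  then obtain S' where "S' \<subseteq> S" "acl_indep L M E S'" "card S \<le> card S'" using le as by auto
  then show ?thesis using card_seteq[OF assms(3)] by blast
qed

text \<open>\<open>A\<close> may lack the elements of \<open>E\<close> over which its members are
  algebraic; the finitely many that occur are added. They lie in \<open>D\<close>, so no parameters
  outside \<open>D\<close> arise.\<close>

lemma special_good:
  assumes "special L M E D" "finite A" "A \<subseteq> D" "E \<subseteq> U"
  obtains A' where "A \<subseteq> A'" "A' \<subseteq> D" "finite A'" "good E A'"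
proof -
  have D: "D \<subseteq> U" using assms(1) by (simp add: special_def)
  obtain S where S: "S \<subseteq> A" "acl_indep L M (E \<inter> D) S" "A \<subseteq> cl ((E \<inter> D) \<union> S)"
    using maximal_acl_indep[OF assms(2), of "E \<inter> D"] assms D by auto
  have "\<forall>a\<in>A. \<exists>bs. set bs \<subseteq> (E \<inter> D) \<union> S \<and> a \<in> cl (set bs)"
    using S(3) by (meson acl_finitary subsetD)
  then obtain g where g: "\<forall>a\<in>A. set (g a) \<subseteq> (E \<inter> D) \<union> S \<and> a \<in> cl (set (g a))" by metis
  define A' where "A' = A \<union> (\<Union>a\<in>A. set (g a) \<inter> E)"
  have A': "A \<subseteq> A'" "A' \<subseteq> D" "finite A'"
    using assms(2,3) g S(1) by (auto simp: A'_def)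
  have "S \<subseteq> A'" "acl_indep L M E S"
    using special_acl_indep[OF assms(1) _ _ S(2)] S(1) assms(2,3) A' finite_subset[OF S(1)] by auto
  moreover have "A' \<subseteq> cl (S \<union> (A' \<inter> E))"
  proof
    have sub: "S \<union> (A' \<inter> E) \<subseteq> U" using S(1) A'(1,2) D by blast
    fix a assume a: "a \<in> A'"
    show "a \<in> cl (S \<union> (A' \<inter> E))"
    proof (cases "a \<in> A")
      case True
      then have "set (g a) \<subseteq> S \<union> (A' \<inter> E)" using g by (auto simp: A'_def)
      then show ?thesis using g True acl_monoD by metis
    next
      case False
      then show ?thesis using a acl_superset[OF sub] by (auto simp: A'_def)
    qed
  qed
  ultimately show ?thesis using A' that unfolding good_def by blast
qed

end

section \<open>Pairs\<close>

lemma univ_pair [simp]: "univ (pair_struc M E) = univ M"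
  by (simp add: pair_struc_def)

lemma evalt_pair [simp]: "evalt (pair_struc M E) xs t = evalt M xs t"
  by (induction M xs t rule: evalt.induct) (auto simp: pair_struc_def cong: map_cong)

lemma wf_trm_pair [simp]: "wf_trm (pair_lang L) n t \<longleftrightarrow> wf_trm L n t"
  by (induction L n t rule: wf_trm.induct) (auto simp: pair_lang_def)

lemma rels_pair [simp]:
  "rels (pair_lang L) = insert None (Some ` rels L)"
  "rarity (pair_lang L) None = 1" "rarity (pair_lang L) (Some r) = rarity L r"
  by (simp_all add: pair_lang_def)

lemma wf_fm_pair: "wf_fm L n \<phi> \<Longrightarrow> wf_fm (pair_lang L) n (map_fm id Some \<phi>)"
  by (induction \<phi> arbitrary: n) (auto simp: trm.map_id)

lemma sat_pair: "sat (pair_struc M E) xs (map_fm id Some \<phi>) \<longleftrightarrow> sat M xs \<phi>"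
proof (induction \<phi> arbitrary: xs)
  case (Rel r ts)
  have "map (evalt (pair_struc M E) xs) (map (map_trm id) ts) = map (evalt M xs) ts"
    by (simp add: trm.map_id0)
  then show ?case by (simp only: fm.map sat.simps) (simp add: pair_struc_def)
qed (simp_all add: trm.map_id)

lemma dpred_pair: "dpred L M n P \<Longrightarrow> dpred (pair_lang L) (pair_struc M E) n P"
  unfolding dpred_def using wf_fm_pair sat_pair by (metis univ_pair)

lemma dset_pair: "dset L M A X \<Longrightarrow> dset (pair_lang L) (pair_struc M E) A X"
  unfolding dset_def using dpred_pair by (metis univ_pair)

lemma dpred_mem_E: "i < n \<Longrightarrow> dpred (pair_lang L) (pair_struc M E) n (\<lambda>xs. xs ! i \<in> E)"
  unfolding dpred_def
  by (intro exI[of _ "Rel None [Var i]"]) (auto simp: pair_lang_def pair_struc_def)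

lemma dpred_ex_E:
  assumes "dpred (pair_lang L) (pair_struc M E) (m + n) P" "E \<subseteq> univ M"
  shows "dpred (pair_lang L) (pair_struc M E) n (\<lambda>xs. \<exists>es\<in>nlists m E. P (es @ xs))"
  using assms(1)
proof (induction m arbitrary: P)
  case (Suc m)
  have "dpred (pair_lang L) (pair_struc M E) (Suc (m + n)) (\<lambda>xs. xs ! 0 \<in> E \<and> P xs)"
    using Suc.prems by (intro dpred_conj dpred_mem_E) auto
  from Suc.IH[OF dpred_ex[OF this]] show ?case
    by (rule dpred_cong) (use assms(2) in \<open>force simp: in_nlists_Suc_iff\<close>)
qed simp

section \<open>Horner sums\<close>

text \<open>\<open>eval\<close> accepts leading zeros but a polynomial has none, so the coefficient
  list is normalized before roots are counted.\<close>

lemma (in domain) finite_roots_list: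
  assumes "set p \<subseteq> carrier R" "\<exists>c\<in>set p. c \<noteq> \<zero>"
  shows "finite {x \<in> carrier R. eval p x = \<zero>}"
proof -
  have n: "normalize p \<noteq> []" using assms(2) by (induction p) auto
  have "polynomial (carrier R) (normalize p)"
    using assms(1) by (rule normalize_gives_polynomial)
  then have "finite {x. is_root (normalize p) x}"
    by (intro finite_number_of_roots) (simp add: univ_poly_carrier)
  moreover have "{x \<in> carrier R. eval p x = \<zero>} \<subseteq> {x. is_root (normalize p) x}"
    using n eval_normalize[OF assms(1)] by (auto simp: is_root_def)
  ultimately show ?thesis by (rule finite_subset[rotated])
qed

text \<open>The lowest coefficient comes first, so that prepending \<open>u\<close> to a sum
  \<open>z\<close> gives \<open>u + t z\<close>.\<close>

primrec horner :: "('a, 'b) ring_scheme \<Rightarrow> 'a \<Rightarrow> 'a list \<Rightarrow> 'a" where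
  "horner R t [] = \<zero>\<^bsub>R\<^esub>"
| "horner R t (u # us) = u \<oplus>\<^bsub>R\<^esub> t \<otimes>\<^bsub>R\<^esub> horner R t us"

lemma (in ring) horner_closed: "t \<in> carrier R \<Longrightarrow> set us \<subseteq> carrier R \<Longrightarrow> horner R t us \<in> carrier R"
  by (induction us) auto

lemma (in ring) set_map2_minus:
  assumes "set us \<subseteq> carrier R" "set vs \<subseteq> carrier R"
  shows "set (map2 (\<lambda>x y. x \<ominus> y) us vs) \<subseteq> carrier R"
proof
  fix z assume "z \<in> set (map2 (\<lambda>x y. x \<ominus> y) us vs)"
  then obtain x y where "(x, y) \<in> set (zip us vs)" "z = x \<ominus> y" by auto
  moreover from this(1) have "x \<in> carrier R" "y \<in> carrier R"
    using assms set_zip_leftD[of x y us vs] set_zip_rightD[of x y us vs] by auto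
  ultimately show "z \<in> carrier R" by simp
qed

text \<open>Makes root counting available for differences of Horner sums; the list is reversed
  because \<open>eval\<close> reads the highest coefficient first.\<close>

lemma (in cring) eval_rev_minus:
  assumes "length us = length vs" "set us \<subseteq> carrier R" "set vs \<subseteq> carrier R" "t \<in> carrier R"
  shows "eval (rev (map2 (\<lambda>x y. x \<ominus> y) us vs)) t = horner R t us \<ominus> horner R t vs"
  using assms
proof (induction us vs rule: list_induct2)
  case Nil
  then show ?case by (simp add: minus_eq)
next
  case (Cons u us v vs)
  let ?p = "rev (map2 (\<lambda>x y. x \<ominus> y) us vs)"
  have mem: "u \<in> carrier R" "v \<in> carrier R" "horner R t us \<in> carrier R" "horner R t vs \<in> carrier R"
    using Cons.prems horner_closed by auto
  have "set ?p \<subseteq> carrier R" using set_map2_minus[of us vs] Cons.prems by simp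
  then have "eval (?p @ [u \<ominus> v]) t = eval ?p t \<otimes> t \<oplus> (u \<ominus> v)"
    using mem Cons.prems by (intro eval_append_aux) auto
  also have "\<dots> = (horner R t us \<ominus> horner R t vs) \<otimes> t \<oplus> (u \<ominus> v)" using Cons by auto
  also have "\<dots> = (u \<oplus> t \<otimes> horner R t us) \<ominus> (v \<oplus> t \<otimes> horner R t vs)"
    using mem Cons.prems(3) by algebra
  finally show ?case by simp
qed

lemma (in domain) finite_horner_eq:
  assumes "length us = length vs" "set us \<subseteq> carrier R" "set vs \<subseteq> carrier R" "us \<noteq> vs"
  shows "finite {t \<in> carrier R. horner R t us = horner R t vs}"
proof -
  let ?p = "rev (map2 (\<lambda>x y. x \<ominus> y) us vs)"
  obtain i where i: "i < length us" "us ! i \<noteq> vs ! i"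
    using assms(1,4) by (auto simp: list_eq_iff_nth_eq)
  then have mem: "us ! i \<in> carrier R" "vs ! i \<in> carrier R" using assms(1-3) by (auto dest: nth_mem)
  then have "us ! i \<ominus> vs ! i \<noteq> \<zero>" using i(2) by (simp add: r_right_minus_eq)
  moreover have "us ! i \<ominus> vs ! i \<in> set ?p"
    using i(1) assms(1) by (force simp: set_zip)
  moreover have "set ?p \<subseteq> carrier R"
    using set_map2_minus[OF assms(2,3)] by simp
  ultimately have "finite {t \<in> carrier R. eval ?p t = \<zero>}"
    using finite_roots_list by blast
  then show ?thesis
    by (rule finite_subset[rotated])
      (use eval_rev_minus[OF assms(1-3)] horner_closed assms in \<open>auto simp: r_right_minus_eq\<close>)
qed

lemma ring_of_simps:
  "carrier (ring_of \<iota> M) = univ M" "zero (ring_of \<iota> M) = fint M (\<iota> ZeroS) []"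
  "add (ring_of \<iota> M) x y = fint M (\<iota> AddS) [x, y]" "monoid.mult (ring_of \<iota> M) x y = fint M (\<iota> MulS) [x, y]"
  by (simp_all add: ring_of_def)

lemma dterm_horner:
  assumes "contains_ring_lang L \<iota>" "i < m" "selector n m s"
  shows "dterm L M m (\<lambda>xs. horner (ring_of \<iota> M) (xs ! i) (s xs))"
proof -
  have \<iota>: "\<iota> c \<in> funs L" "farity L (\<iota> c) = ring_arity c" for c
    using assms(1) by (auto simp: contains_ring_lang_def)
  obtain "is" where i: "length is = n" "set is \<subseteq> {..<m}" "\<And>xs. length xs = m \<Longrightarrow> s xs = map ((!) xs) is"
    using assms(3) unfolding selector_def by auto
  have "dterm L M m (\<lambda>xs. horner (ring_of \<iota> M) (xs ! i) (map ((!) xs) is))" if "set is \<subseteq> {..<m}" for "is"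
    using that
  proof (induction "is")
    case Nil
    then show ?case by (auto simp: ring_of_simps \<iota> intro!: dterm_const)
  next
    case (Cons j js)
    then show ?case using assms(2) by (auto simp: ring_of_simps \<iota> intro!: dterm_fun2 dterm_nth)
  qed
  from this[OF i(2)] show ?thesis
    unfolding dterm_def using i(3) nlistsE_length by metis
qed

section \<open>Codensity\<close>

text \<open>The topology enters only through \<open>dense\<close> and \<open>affine\<close>.\<close>

locale dense_pair_struc = geometric_struc L M
  for L :: "('f, 'r) lang" and M :: "('a, 'f, 'r) struc" +
  fixes E :: "'a set" and \<iota> :: "ring_sym \<Rightarrow> 'f"
  assumes struc: "is_struc L M"
    and E_sub: "E \<subseteq> univ M"
    and E_acl: "acl L M E \<subseteq> E"
    and E_proper: "E \<noteq> univ M"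
    and ring_lang: "contains_ring_lang L \<iota>"
    and ring_domain: "domain (ring_of \<iota> M)"
    and dense: "\<And>X. dset L M (univ M) X \<Longrightarrow> infinite X \<Longrightarrow> X \<inter> E \<noteq> {}"
    and affine: "\<And>X t. dset L M (univ M) X \<Longrightarrow> infinite X \<Longrightarrow> t \<in> univ M \<Longrightarrow>
      \<exists>Y Z. dset L M (univ M) Y \<and> infinite Y \<and> dset L M (univ M) Z \<and> infinite Z \<and>
        (\<forall>y\<in>Y. \<forall>z\<in>Z. y \<oplus>\<^bsub>ring_of \<iota> M\<^esub> t \<otimes>\<^bsub>ring_of \<iota> M\<^esub> z \<in> X)"
    and saturated: "\<And>A \<F>. finite A \<Longrightarrow> A \<subseteq> univ M \<Longrightarrow>
      (\<And>X. X \<in> \<F> \<Longrightarrow> dset (pair_lang L) (pair_struc M E) A X) \<Longrightarrow>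
      (\<And>\<G>. finite \<G> \<Longrightarrow> \<G> \<subseteq> \<F> \<Longrightarrow> univ M \<inter> \<Inter>\<G> \<noteq> {}) \<Longrightarrow> univ M \<inter> \<Inter>\<F> \<noteq> {}"
begin

abbreviation "LP \<equiv> pair_lang L"
abbreviation "MP \<equiv> pair_struc M E"
abbreviation "R \<equiv> ring_of \<iota> M"

interpretation R: domain R by (rule ring_domain)

text \<open>The equation in \<open>t\<close> is a formula over the coefficients and has finitely
  many solutions by root counting.\<close>

lemma horner_eq_acl:
  assumes "length us = length vs" "set us \<subseteq> U" "set vs \<subseteq> U" "us \<noteq> vs" "t \<in> U"
    "horner R t us = horner R t vs"
  shows "t \<in> cl (set us \<union> set vs)"
proof -
  let ?n = "length us"
  define P where "P = (\<lambda>xs. horner R (xs ! 0) (take ?n (drop 1 xs)) = horner R (xs ! 0) (drop (Suc ?n) xs))"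
  have m: "Suc (length (us @ vs)) = Suc (?n + ?n)" using assms(1) by simp
  have s1: "selector (?n + ?n) (Suc (?n + ?n)) (drop 1)"
    using selector_drop[of "Suc (?n + ?n)" 1] by simp
  have s2: "selector ?n (Suc (?n + ?n)) (drop (Suc ?n))"
    using selector_drop[of "Suc (?n + ?n)" "Suc ?n"] by simp
  have "dpred L M (Suc (length (us @ vs))) P"
    unfolding P_def m using ring_lang
    by (intro dpred_eq dterm_horner[OF _ _ selector_comp[OF selector_append_left s1]] dterm_horner[OF _ _ s2]) simp_all
  moreover have P: "P (x # us @ vs) \<longleftrightarrow> horner R x us = horner R x vs" for x by (simp add: P_def)
  have "finite {x \<in> U. P (x # us @ vs)}"
    unfolding P using R.finite_horner_eq[OF assms(1)] assms(2-4) by (simp add: ring_of_simps)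
  ultimately have "{x \<in> U. P (x # us @ vs)} \<subseteq> cl (set (us @ vs))"
    using assms(2,3) by (intro finite_definable_acl) auto
  then show ?thesis using assms(5,6) P by auto
qed

text \<open>A partial type of the pair over \<open>B\<close> that is compatible with every
  non-algebraic \<open>L\<close>-type. Two instances matter: lying in \<open>E\<close> but outside
  \<open>cl N\<close> (density), and lying outside \<open>cl (E \<union> N)\<close>
  (codensity).\<close>

definition rich :: "'a set \<Rightarrow> 'a set set \<Rightarrow> bool" where
  "rich B \<Q> \<longleftrightarrow> (\<forall>Q\<in>\<Q>. dset LP MP B Q) \<and>
     (\<forall>\<G>\<subseteq>\<Q>. finite \<G> \<longrightarrow> (\<forall>X. dset L M U X \<longrightarrow> infinite X \<longrightarrow> X \<inter> \<Inter>\<G> \<noteq> {}))"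

lemma realize:
  assumes "finite A" "A \<subseteq> U" "\<And>Y. Y \<in> \<Y> \<Longrightarrow> dset L M A Y"
    and inf: "\<And>\<G>. finite \<G> \<Longrightarrow> \<G> \<subseteq> \<Y> \<Longrightarrow> infinite (U \<inter> \<Inter>\<G>)"
    and "finite B" "B \<subseteq> U" "rich B \<Q>"
  shows "\<exists>x\<in>U. x \<in> \<Inter>\<Y> \<and> x \<in> \<Inter>\<Q>"
proof -
  have "U \<inter> \<Inter>(\<Y> \<union> \<Q>) \<noteq> {}"
  proof (rule saturated)
    fix X assume "X \<in> \<Y> \<union> \<Q>"
    then consider "X \<in> \<Y>" | "X \<in> \<Q>" by auto
    then show "dset LP MP (A \<union> B) X"
    proof cases
      case 1
      then show ?thesis using dset_mono[OF dset_pair[OF assms(3)]] by simp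
    next
      case 2
      then have "dset LP MP B X" using assms(7) by (simp add: rich_def)
      then show ?thesis by (rule dset_mono) simp
    qed
  next
    fix \<G> assume \<G>: "finite \<G>" "\<G> \<subseteq> \<Y> \<union> \<Q>"
    have "dset L M U (U \<inter> \<Inter>(\<G> \<inter> \<Y>))"
      using \<G>(1) dset_mono[OF assms(3,2)] by (intro dset_Inter) auto
    moreover have "infinite (U \<inter> \<Inter>(\<G> \<inter> \<Y>))" using \<G>(1) by (intro inf) auto
    moreover have "\<G> \<inter> \<Q> \<subseteq> \<Q>" "finite (\<G> \<inter> \<Q>)" using \<G>(1) by auto
    ultimately have "U \<inter> \<Inter>(\<G> \<inter> \<Y>) \<inter> \<Inter>(\<G> \<inter> \<Q>) \<noteq> {}"
      using assms(7) unfolding rich_def by blast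
    moreover have "U \<inter> \<Inter>(\<G> \<inter> \<Y>) \<inter> \<Inter>(\<G> \<inter> \<Q>) \<subseteq> U \<inter> \<Inter>\<G>" using \<G>(2) by auto
    ultimately show "U \<inter> \<Inter>\<G> \<noteq> {}" by blast
  qed (use assms in auto)
  then show ?thesis by auto
qed

text \<open>The type of \<open>c\<close> over the domain, read over the range, consists of infinite
  sets because \<open>c\<close> is not algebraic; richness then yields an image that also satisfies
  \<open>\<Q>\<close>.\<close>

lemma elem_map_extend:
  assumes "finite Z" "elem_map L M Z" "c \<in> U" "c \<notin> cl (fst ` Z)" "finite B" "B \<subseteq> U" "rich B \<Q>"
  obtains c' where "c' \<in> U" "c' \<in> \<Inter>\<Q>" "elem_map L M (insert (c, c') Z)"
proof -
  obtain zs where zs: "set zs = Z" using finite_list[OF assms(1)] ..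
  let ?a = "map fst zs" and ?b = "map snd zs"
  have sub: "set ?a \<subseteq> U" "set ?b \<subseteq> U" using assms(2) zs by (auto simp: elem_map_def)
  define \<Y> where "\<Y> = {{x \<in> U. P (x # ?b)} |P. dpred L M (Suc (length zs)) P \<and> P (c # ?a)}"
  have "\<exists>x\<in>U. x \<in> \<Inter>\<Y> \<and> x \<in> \<Inter>\<Q>"
  proof (rule realize[where A = "set ?b" and B = B])
    fix Y assume "Y \<in> \<Y>"
    then show "dset L M (set ?b) Y" using dset_Collect[of ?b "set ?b" L M] by (auto simp: \<Y>_def)
  next
    fix \<G> assume "finite \<G>" "\<G> \<subseteq> \<Y>"
    \<comment> \<open>Conjunction makes the type closed under finite intersection, so finitely many
      members are bounded below by a single formula true of \<open>c\<close>.\<close>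
    then have "\<exists>P. dpred L M (Suc (length zs)) P \<and> P (c # ?a) \<and> {x \<in> U. P (x # ?b)} \<subseteq> U \<inter> \<Inter>\<G>"
    proof (induction \<G>)
      case empty
      then show ?case using dpred_True by (intro exI[of _ "\<lambda>_. True"]) auto
    next
      case (insert Y \<G>)
      then obtain P Q where "dpred L M (Suc (length zs)) P" "P (c # ?a)" "{x \<in> U. P (x # ?b)} \<subseteq> U \<inter> \<Inter>\<G>"
        "dpred L M (Suc (length zs)) Q" "Q (c # ?a)" "Y = {x \<in> U. Q (x # ?b)}"
        unfolding \<Y>_def by blast
      then show ?case
        by (intro exI[of _ "\<lambda>xs. P xs \<and> Q xs"]) (auto intro: dpred_conj)
    qed
    then obtain P where P: "dpred L M (Suc (length zs)) P" "P (c # ?a)" "{x \<in> U. P (x # ?b)} \<subseteq> U \<inter> \<Inter>\<G>"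
      by auto
    have "infinite {x \<in> U. P (x # ?b)}"
      using elem_map_infinite[of zs P c] assms(2-4) P(1,2) zs by simp
    then show "infinite (U \<inter> \<Inter>\<G>)" using P(3) finite_subset by blast
  qed (use assms sub zs in auto)
  then obtain c' where c': "c' \<in> U" "c' \<in> \<Inter>\<Y>" "c' \<in> \<Inter>\<Q>" by auto
  have "elem_map L M (set ((c, c') # zs))"
  proof (rule elem_map_list)
    show "set ((c, c') # zs) \<subseteq> U \<times> U" using assms(2,3) c' zs by (auto simp: elem_map_def)
    fix P assume "dpred L M (length ((c, c') # zs)) P" "P (map fst ((c, c') # zs))"
    then have "{x \<in> U. P (x # ?b)} \<in> \<Y>" unfolding \<Y>_def by auto
    then show "P (map snd ((c, c') # zs))" using c'(2) by auto
  qed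
  then show ?thesis using that c' zs by auto
qed

section \<open>Generic elements of \<open>E\<close>\<close>

lemma dset_diff_finite:
  assumes "dset L M U X" "finite F" "F \<subseteq> U" shows "dset L M U (X - F)"
proof -
  have "dset L M U (U - {y})" if "y \<in> U" for y
  proof -
    have "dset L M U {x \<in> U. (x # [y]) ! 0 = (x # [y]) ! 1}"
      using that dpred_nth_eq[of 0 "Suc (length [y])" 1 L M] by (intro dset_Collect) auto
    moreover have "{x \<in> U. (x # [y]) ! 0 = (x # [y]) ! 1} = {y}" using that by auto
    ultimately show ?thesis using dset_Compl by metis
  qed
  then have "dset L M U (U \<inter> \<Inter>((\<lambda>y. U - {y}) ` F))"
    using assms(2,3) by (intro dset_Inter) auto
  moreover have "X - F = X \<inter> (U \<inter> \<Inter>((\<lambda>y. U - {y}) ` F))"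
    using dset_subset_univ[OF assms(1)] by auto
  ultimately show ?thesis using dset_Int[OF assms(1)] by simp
qed

text \<open>A finite part removes only finitely many points from \<open>X\<close>, and density still
  gives an element of \<open>E\<close>. The removed points are definable over \<open>N\<close>
  because algebraic elements are values of definable functions.\<close>

lemma rich_E:
  assumes "finite N" "N \<subseteq> U" shows "rich N (insert E ((\<lambda>y. U - {y}) ` cl N))"
  unfolding rich_def
proof (intro conjI ballI allI impI)
  fix Q assume "Q \<in> insert E ((\<lambda>y. U - {y}) ` cl N)"
  then consider "Q = E" | y where "y \<in> cl N" "Q = U - {y}" by auto
  then show "dset LP MP N Q"
  proof cases
    case 1
    have "dset LP MP N {x \<in> univ MP. (x # []) ! 0 \<in> E}"
      by (intro dset_Collect dpred_mem_E) auto
    moreover have "{x \<in> univ MP. (x # []) ! 0 \<in> E} = E" using E_sub by auto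
    ultimately show ?thesis using 1 by simp
  next
    case 2
    obtain ns where ns: "set ns = N" using finite_list[OF assms(1)] ..
    then obtain f where f: "dfun L M (length ns) f" "y = f ns" using 2(1) assms(2) in_acl_iff by auto
    have "dset L M N {x \<in> U. hd (x # ns) = f (tl (x # ns))}"
      using f(1) ns by (intro dset_Collect) (auto simp: dfun_def)
    moreover have "{x \<in> U. hd (x # ns) = f (tl (x # ns))} = {y}"
      using f(2) 2(1) acl_subset_univ[of L M N] by auto
    ultimately show ?thesis using 2(2) dset_pair dset_Compl by metis
  qed
next
  fix \<G> X assume \<G>: "\<G> \<subseteq> insert E ((\<lambda>y. U - {y}) ` cl N)" "finite \<G>" and X: "dset L M U X" "infinite X"
  have "\<G> - {E} \<subseteq> (\<lambda>y. U - {y}) ` cl N" "finite (\<G> - {E})" using \<G> by auto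
  then obtain F where F: "F \<subseteq> cl N" "finite F" "\<G> - {E} = (\<lambda>y. U - {y}) ` F"
    using finite_subset_image by metis
  have FU: "F \<subseteq> U" by (rule order_trans[OF F(1) acl_subset_univ])
  obtain x where x: "x \<in> X" "x \<notin> F" "x \<in> E"
    using dense[OF dset_diff_finite[OF X(1) F(2) FU] Diff_infinite_finite[OF F(2) X(2)]] by auto
  have "x \<in> Y" if "Y \<in> \<G>" for Y
  proof (cases "Y = E")
    case False
    with that have "Y \<in> \<G> - {E}" by simp
    then have "Y \<in> (\<lambda>y. U - {y}) ` F" unfolding F(3) .
    then obtain y where "y \<in> F" "Y = U - {y}" by auto
    then show ?thesis using x E_sub by auto
  qed (use x in auto)
  then show "X \<inter> \<Inter>\<G> \<noteq> {}" using x(1) by auto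
qed

lemma Inter_rich_E:
  assumes "x \<in> \<Inter>(insert E ((\<lambda>y. U - {y}) ` cl N))" shows "x \<in> E" "x \<notin> cl N"
proof -
  show "x \<in> E" by (rule InterD[OF assms insertI1])
  show "x \<notin> cl N"
  proof
    assume "x \<in> cl N"
    then have "U - {x} \<in> (\<lambda>y. U - {y}) ` cl N" by (rule imageI)
    then have "x \<in> U - {x}" by (intro InterD[OF assms] insertI2)
    then show False by simp
  qed
qed

lemma generic_in_E:
  assumes "dset L M U X" "infinite X" "finite N" "N \<subseteq> U"
  obtains u where "u \<in> X" "u \<in> E" "u \<notin> cl N"
proof -
  obtain A where A: "finite A" "A \<subseteq> U" "dset L M A X" using assms(1) by (rule dset_finitary)
  have "\<exists>x\<in>U. x \<in> \<Inter>{X} \<and> x \<in> \<Inter>(insert E ((\<lambda>y. U - {y}) ` cl N))"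
  proof (rule realize[OF A(1,2) _ _ assms(3,4) rich_E[OF assms(3,4)]])
    fix \<G> assume "\<G> \<subseteq> {X}"
    then have "X \<subseteq> U \<inter> \<Inter>\<G>" using dset_subset_univ[OF assms(1)] by auto
    then show "infinite (U \<inter> \<Inter>\<G>)" using assms(2) finite_subset by blast
  qed (use A in auto)
  then obtain x where "x \<in> X" "x \<in> \<Inter>(insert E ((\<lambda>y. U - {y}) ` cl N))" by auto
  then show ?thesis using Inter_rich_E that by metis
qed

text \<open>\<open>affine\<close> gives infinite \<open>Y\<close> and \<open>Z\<close> with all
  \<open>y + t z\<close> in \<open>X\<close>. The tail of the coefficients comes from the induction
  hypothesis for \<open>Z\<close>; the new first coefficient is taken in
  \<open>Y \<inter> E\<close>, generic over \<open>N\<close> and the tail.\<close>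

lemma horner_dense:
  assumes "dset L M U X" "infinite X" "finite N" "N \<subseteq> U" "t \<in> U"
  shows "\<exists>us. length us = Suc n \<and> set us \<subseteq> E \<and> ind_list N us \<and> horner R t us \<in> X"
  using assms(1,2)
proof (induction n arbitrary: X)
  case 0
  obtain u where u: "u \<in> X" "u \<in> E" "u \<notin> cl N" using 0 assms(3,4) by (rule generic_in_E)
  then have "horner R t [u] = u" using E_sub assms(5) by (auto simp: ring_of_simps(1))
  then show ?case using u by (intro exI[of _ "[u]"]) (auto simp del: horner.simps)
next
  case (Suc n)
  obtain Y Z where Y: "dset L M U Y" "infinite Y" and Z: "dset L M U Z" "infinite Z"
    and YZ: "\<forall>y\<in>Y. \<forall>z\<in>Z. y \<oplus>\<^bsub>R\<^esub> t \<otimes>\<^bsub>R\<^esub> z \<in> X"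
    using affine[OF Suc.prems assms(5)] by auto
  obtain us where us: "length us = Suc n" "set us \<subseteq> E" "ind_list N us" "horner R t us \<in> Z"
    using Suc.IH[OF Z] by auto
  obtain u where "u \<in> Y" "u \<in> E" "u \<notin> cl (N \<union> set us)"
    using Y by (rule generic_in_E[of _ "N \<union> set us"]) (use assms us E_sub in auto)
  then show ?case using us YZ by (intro exI[of _ "u # us"]) auto
qed

text \<open>\<open>vs\<close> is built from the end of the list, over fixed \<open>B\<close> and
  \<open>t\<close>. The set \<open>W\<close> contains the whole original tuple throughout, so
  \<open>t\<close> stays non-algebraic over the old and new entries together.\<close>

lemma conjugate_tuple:
  assumes "finite B" "B \<subseteq> U" "t \<in> U" "finite W" "W \<subseteq> U" "t \<notin> cl (B \<union> W)" "set us \<subseteq> W"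
  shows "\<exists>vs. length vs = length us \<and> elem_map L M (Id_on (insert t B) \<union> set (zip us vs)) \<and>
    t \<notin> cl (B \<union> W \<union> set vs) \<and> (vs = us \<longrightarrow> set us \<subseteq> cl B)"
  using assms(7)
proof (induction us)
  case Nil
  then show ?case using elem_map_Id_on[of "insert t B" M L] assms by auto
next
  case (Cons u us)
  then obtain vs where vs: "length vs = length us"
    "elem_map L M (Id_on (insert t B) \<union> set (zip us vs))"
    "t \<notin> cl (B \<union> W \<union> set vs)" "vs = us \<longrightarrow> set us \<subseteq> cl B" by auto
  let ?Z = "Id_on (insert t B) \<union> set (zip us vs)"
  have fin: "finite ?Z" using assms(1) by (auto simp: Id_on_def)
  have fst: "fst ` (Id_on C \<union> set (zip us vs)) = C \<union> set us" for C
    using vs(1) map_fst_zip[of us vs] by (auto simp: image_Un Id_on_def simp flip: list.set_map) force+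
  have snd: "snd ` (Id_on C \<union> set (zip us vs)) = C \<union> set vs" for C
    using vs(1) map_snd_zip[of us vs] by (auto simp: image_Un Id_on_def simp flip: list.set_map) force+
  have u: "u \<in> W" "u \<in> U" "set us \<subseteq> W" using Cons.prems assms(5) by auto
  have "snd ` ?Z \<subseteq> snd ` (U \<times> U)" using vs(2) unfolding elem_map_def by (intro image_mono) simp
  then have vsU: "set vs \<subseteq> U" using snd by auto
  have subU: "B \<union> W \<union> set vs \<subseteq> U" using assms vsU by auto
  show ?case
  proof (cases "u \<in> cl (insert t (B \<union> set us))")
    case True
    \<comment> \<open>Since \<open>t\<close> is not algebraic over \<open>B \<union> W\<close>,
      exchange shows that \<open>u\<close> is algebraic over \<open>B\<close> and \<open>us\<close>
      alone. Its image is then algebraic over \<open>B\<close> and \<open>vs\<close>, so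
      \<open>t\<close> stays outside the closure.\<close>
    have u_cl: "u \<in> cl (B \<union> set us)"
    proof (rule ccontr)
      assume "u \<notin> cl (B \<union> set us)"
      then have "t \<in> cl (insert u (B \<union> set us))"
        using acl_exchangeD[of "B \<union> set us" t u] True u assms by auto
      then show False using assms(6) u acl_monoD[of t L M "insert u (B \<union> set us)" "B \<union> W"] by auto
    qed
    have "u \<in> cl (fst ` ?Z)" using True fst by simp
    then obtain v where v: "elem_map L M (insert (u, v) ?Z)"
      using elem_map_insert_acl[OF fin vs(2)] by blast
    have "v \<in> cl (snd ` (Id_on B \<union> set (zip us vs)))"
    proof (rule elem_map_acl[OF v])
      show "u \<in> cl (fst ` (Id_on B \<union> set (zip us vs)))" using u_cl fst by simp
    qed auto
    then have "v \<in> cl (B \<union> set vs)" using snd by simp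
    then have "v \<in> cl (B \<union> W \<union> set vs)" by (rule acl_monoD) auto
    then have "t \<notin> cl (insert v (B \<union> W \<union> set vs))"
      using acl_cut[OF subU, of v t] vs(3) by auto
    moreover have "set (u # us) \<subseteq> cl B" if "v # vs = u # us"
    proof -
      have us: "set us \<subseteq> cl B" using that vs(4) by auto
      then have "B \<union> set us \<subseteq> cl B" using acl_superset[OF assms(2)] by auto
      then show ?thesis using us acl_trans[OF u_cl _ assms(2)] by auto
    qed
    ultimately show ?thesis using v vs(1) by (intro exI[of _ "v # vs"]) (auto simp: Un_insert_right)
  next
    case False
    \<comment> \<open>Now \<open>v\<close> can avoid the closure of \<open>t\<close>,
      \<open>B\<close>, \<open>W\<close> and \<open>vs\<close>. By exchange \<open>t\<close> stays
      outside, and \<open>v\<close> differs from \<open>u\<close> because \<open>u\<close> is in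
      \<open>W\<close>.\<close>
    let ?N = "insert t (B \<union> W \<union> set vs)"
    have N: "finite ?N" "?N \<subseteq> U" using assms subU by auto
    have "u \<notin> cl (fst ` ?Z)" using False fst by simp
    then obtain v where v: "v \<in> U" "v \<notin> cl ?N" "elem_map L M (insert (u, v) ?Z)"
      using elem_map_extend[OF fin vs(2) u(2) _ N rich_E[OF N]] Inter_rich_E(2) by metis
    have "t \<notin> cl (insert v (B \<union> W \<union> set vs))"
      using acl_exchangeD[OF subU v(1), of t] vs(3) v(2) by auto
    moreover have "v \<noteq> u" using v(2) u(1) acl_superset[OF N(2)] by auto
    ultimately show ?thesis using v(3) vs(1) by (intro exI[of _ "v # vs"]) (auto simp: Un_insert_right)
  qed
qed

text \<open>A Horner sum \<open>x\<close> at \<open>t\<close> with more than \<open>n\<close> independent coefficients is not algebraic over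
  \<open>t\<close> and \<open>n\<close> elements of \<open>E\<close>: otherwise \<open>x\<close> is fixed when the coefficients are replaced by a
  generic conjugate over these elements, and then \<open>t\<close> is a root of the difference.\<close>

lemma generic_not_acl_tuple:
  assumes "finite C" "C \<subseteq> U" "t \<in> U" "t \<notin> cl (E \<union> C)" "dset L M U X" "infinite X"
  shows "\<exists>x\<in>X. \<forall>es. set es \<subseteq> E \<longrightarrow> length es \<le> n \<longrightarrow> x \<notin> cl (insert t (C \<union> set es))"
proof -
  obtain us where us: "length us = Suc n" "set us \<subseteq> E" "ind_list C us" "horner R t us \<in> X"
    using horner_dense[OF assms(5,6,1,2,3)] by blast
  have "horner R t us \<notin> cl (insert t (C \<union> set es))" if es: "set es \<subseteq> E" "length es \<le> n" for es
  proof
    assume x: "horner R t us \<in> cl (insert t (C \<union> set es))"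
    let ?B = "C \<union> set es"
    have B: "finite ?B" "?B \<subseteq> U" "set us \<subseteq> U" using assms(1,2) es(1) us(2) E_sub by auto
    have "t \<notin> cl (?B \<union> set us)"
      using assms(4) acl_monoD[of t L M "?B \<union> set us" "E \<union> C"] es(1) us(2) by auto
    from conjugate_tuple[OF B(1,2) assms(3) _ B(3) this order_refl]
    obtain vs where vs: "length vs = length us"
      "elem_map L M (Id_on (insert t ?B) \<union> set (zip us vs))"
      "t \<notin> cl (?B \<union> set us \<union> set vs)" "vs = us \<longrightarrow> set us \<subseteq> cl ?B" by auto
    obtain bs where bs: "set bs = ?B" using finite_list[OF B(1)] ..
    have "set (t # bs) \<subseteq> U" "set (t # bs) = insert t ?B" using bs B assms(3) by auto
    then obtain f where f: "dfun L M (length (t # bs)) f" "horner R t us = f (t # bs)"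
      using x in_acl_iff[of "t # bs"] by metis
    define P where "P = (\<lambda>xs. horner R (xs ! 0) (drop (Suc (length bs)) xs) = f (take (Suc (length bs)) xs))"
    let ?ws = "(t, t) # map (\<lambda>b. (b, b)) bs @ zip us vs"
    let ?m = "length ?ws"
    have m: "?m = Suc (length bs) + length us" using vs(1) by simp
    have s1: "selector (Suc (length bs)) ?m (take (Suc (length bs)))"
      by (rule selector_take) simp
    have s2: "selector (length us) (Suc ?m) (drop (Suc (Suc (length bs))))"
      using selector_drop[of "Suc ?m" "Suc (Suc (length bs))"] m by simp
    have "dpred L M (Suc ?m) (\<lambda>xs. xs ! 0 = horner R (xs ! 1) (drop (Suc (Suc (length bs))) xs))"
      by (intro dpred_eq dterm_nth dterm_horner[OF ring_lang _ s2]) auto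
    from dpred_subst[OF this dfun_selector[OF _ s1]] f(1)
    have "dpred L M ?m P"
      by (auto simp: P_def eq_commute)
    moreover have "set ?ws \<subseteq> Id_on (insert t ?B) \<union> set (zip us vs)" using bs by auto
    ultimately have "P (map fst ?ws) \<longleftrightarrow> P (map snd ?ws)" by (intro elem_mapD[OF vs(2)])
    moreover have "map fst ?ws = t # bs @ us" "map snd ?ws = t # bs @ vs"
      using vs(1) by (auto simp: comp_def)
    ultimately have eq: "horner R t us = horner R t vs" using f(2) by (simp add: P_def)
    have "set (zip us vs) \<subseteq> U \<times> U" using vs(2) by (simp add: elem_map_def)
    then have "set (map snd (zip us vs)) \<subseteq> U" by auto
    then have "set vs \<subseteq> U" using vs(1) by simp
    then have "us = vs"
      using horner_eq_acl[OF vs(1)[symmetric] B(3) _ _ assms(3) eq]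
        acl_monoD[of t L M "set us \<union> set vs" "?B \<union> set us \<union> set vs"] vs(3) by auto
    \<comment> \<open>With \<open>vs = us\<close>, the coefficients are algebraic over
      \<open>C\<close> and \<open>es\<close>. As they are independent over \<open>C\<close>,
      Steinitz bounds their number \<open>Suc n\<close> by the at most \<open>n\<close> elements of
      \<open>es\<close>.\<close>
    then have "length us \<le> card (set es)"
      using ind_list_length[OF us(3), of "set es"] vs(4) assms(2) es(1) E_sub by auto
    then show False using us(1) es(2) card_length[of es] by auto
  qed
  then show ?thesis using us(4) by blast
qed

text \<open>Reduction to a basis: \<open>S\<close> is a basis over \<open>E\<close> of
  \<open>N\<close> together with a point \<open>t0\<close> outside \<open>E\<close>, which makes it
  nonempty. One element of \<open>S\<close> serves as \<open>t\<close>; \<open>C\<close> consists of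
  the others and of the finitely many elements of \<open>E\<close> needed to recover
  \<open>N\<close>.\<close>

lemma codense:
  assumes "finite N" "N \<subseteq> U" "dset L M U X" "infinite X"
  shows "\<exists>x\<in>X. \<forall>es. set es \<subseteq> E \<longrightarrow> length es \<le> n \<longrightarrow> x \<notin> cl (N \<union> set es)"
proof -
  obtain t0 where t0: "t0 \<in> U" "t0 \<notin> E" using E_proper E_sub by auto
  have N': "finite (insert t0 N)" "insert t0 N \<subseteq> U" using assms(1,2) t0 by auto
  obtain S where S: "S \<subseteq> insert t0 N" "acl_indep L M E S" "insert t0 N \<subseteq> cl (E \<union> S)"
    using maximal_acl_indep[OF N' E_sub] by auto
  have SU: "S \<subseteq> U" "finite S" using S(1) N' finite_subset by auto
  have "S \<noteq> {}" using S(3) t0 E_acl by auto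
  then obtain t where t: "t \<in> S" by auto
  have "\<forall>a\<in>N. \<exists>bs. set bs \<subseteq> E \<union> S \<and> a \<in> cl (set bs)"
    using S(3) by (meson acl_finitary insert_subset subsetD)
  then obtain g where g: "\<forall>a\<in>N. set (g a) \<subseteq> E \<union> S \<and> a \<in> cl (set (g a))" by metis
  define E0 where "E0 = (\<Union>a\<in>N. set (g a)) \<inter> E"
  have E0: "finite E0" "E0 \<subseteq> E" using assms(1) by (auto simp: E0_def)
  define C where "C = (S - {t}) \<union> E0"
  have C: "finite C" "C \<subseteq> U" "insert t C = S \<union> E0" using SU E0 E_sub t by (auto simp: C_def)
  have "t \<notin> cl (E \<union> (S - {t}))" using S(2) t by (auto simp: acl_indep_def)
  moreover have "E \<union> C = E \<union> (S - {t})" using E0 by (auto simp: C_def)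
  ultimately obtain x where x: "x \<in> X"
    "\<And>es. set es \<subseteq> E \<Longrightarrow> length es \<le> n \<Longrightarrow> x \<notin> cl (insert t (C \<union> set es))"
    using generic_not_acl_tuple[OF C(1,2) _ _ assms(3,4), of t n] t SU by auto
  have N_cl: "N \<subseteq> cl (S \<union> E0)"
  proof
    fix a assume a: "a \<in> N"
    then have "set (g a) \<subseteq> S \<union> E0" using g by (auto simp: E0_def)
    moreover have "a \<in> cl (set (g a))" using g a by auto
    ultimately show "a \<in> cl (S \<union> E0)" by (rule acl_monoD[rotated])
  qed
  have "x \<notin> cl (N \<union> set es)" if es: "set es \<subseteq> E" "length es \<le> n" for es
  proof
    assume "x \<in> cl (N \<union> set es)"
    moreover have sub: "S \<union> E0 \<union> set es \<subseteq> U" using SU E0 E_sub es by auto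
    have "cl (S \<union> E0) \<subseteq> cl (S \<union> E0 \<union> set es)" by (rule acl_mono) auto
    then have "N \<union> set es \<subseteq> cl (S \<union> E0 \<union> set es)"
      using N_cl acl_superset[OF sub] by auto
    ultimately have "x \<in> cl (S \<union> E0 \<union> set es)" using sub by (rule acl_trans)
    moreover have "S \<union> E0 \<union> set es = insert t (C \<union> set es)" using C(3) by auto
    ultimately show False using x(2)[OF es] by simp
  qed
  then show ?thesis using x(1) by blast
qed

definition span_E :: "'a list \<Rightarrow> nat \<Rightarrow> ('a list \<Rightarrow> 'a) \<Rightarrow> 'a set" where
  "span_E ns m f = {x \<in> U. \<exists>es\<in>nlists m E. x = f (es @ ns)}"

text \<open>The partial type over \<open>ns\<close> of an element outside
  \<open>cl (E \<union> set ns)\<close>. Finite parts of it have small complements, which become the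
  exceptional set of the theorem.\<close>

definition span_compls :: "'a list \<Rightarrow> 'a set set" where
  "span_compls ns = {U - span_E ns m f |m f. dfun L M (m + length ns) f}"

lemma dset_span_E:
  assumes "dfun L M (m + length ns) f" shows "dset LP MP (set ns) (span_E ns m f)"
proof -
  \<comment> \<open>In the tuple \<open>es @ x # ns\<close> the element \<open>x\<close> has index
    \<open>m\<close>; quantifying away the first \<open>m\<close> entries then leaves
    \<open>x # ns\<close>.\<close>
  have "dpred L M (m + Suc (length ns)) (\<lambda>xs. xs ! m = f (take m xs @ drop (Suc m) xs))"
  proof (rule dfun_dpred[OF assms])
    have "selector (length ns) (m + Suc (length ns)) (drop (Suc m))"
      using selector_drop[of "m + Suc (length ns)" "Suc m"] by simp
    then show "selector (m + length ns) (m + Suc (length ns)) (\<lambda>xs. take m xs @ drop (Suc m) xs)"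
      by (intro selector_append selector_take) auto
  qed simp
  from dpred_ex_E[OF dpred_pair[OF this] E_sub]
  have "dset LP MP (set ns) {x \<in> univ MP. \<exists>es\<in>nlists m E. (es @ x # ns) ! m =
      f (take m (es @ x # ns) @ drop (Suc m) (es @ x # ns))}"
    by (intro dset_Collect) auto
  moreover have "\<dots> = span_E ns m f"
    unfolding span_E_def by (auto simp: nlistsE_length nth_append)
  ultimately show ?thesis by simp
qed

lemma in_acl_E_iff:
  assumes "set ns \<subseteq> U" "x \<in> U"
  shows "x \<notin> cl (E \<union> set ns) \<longleftrightarrow> x \<in> \<Inter>(span_compls ns)"
proof
  assume x: "x \<notin> cl (E \<union> set ns)"
  have "x \<notin> span_E ns m f" if "dfun L M (m + length ns) f" for m f
  proof
    assume "x \<in> span_E ns m f"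
    then obtain es where es: "es \<in> nlists m E" "x = f (es @ ns)" by (auto simp: span_E_def)
    have "x \<in> cl (set (es @ ns))"
      using that es(2) assms(1) nlistsE_set[OF es(1)] nlistsE_length[OF es(1)] E_sub
      by (subst in_acl_iff) auto
    then have "x \<in> cl (E \<union> set ns)" by (rule acl_monoD) (use nlistsE_set[OF es(1)] in auto)
    then show False using x by simp
  qed
  then show "x \<in> \<Inter>(span_compls ns)" using assms(2) by (auto simp: span_compls_def)
next
  assume x: "x \<in> \<Inter>(span_compls ns)"
  show "x \<notin> cl (E \<union> set ns)"
  proof
    assume "x \<in> cl (E \<union> set ns)"
    then obtain bs where bs: "set bs \<subseteq> E \<union> set ns" "x \<in> cl (set bs)" by (rule acl_finitary)
    define es where "es = filter (\<lambda>b. b \<in> E) bs"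
    have es: "set es \<subseteq> E" "set bs \<subseteq> set (es @ ns)" using bs(1) by (auto simp: es_def)
    have "x \<in> cl (set (es @ ns))" using bs(2) es(2) by (rule acl_monoD)
    then obtain f where f: "dfun L M (length es + length ns) f" "x = f (es @ ns)"
      using in_acl_iff[of "es @ ns" x] es(1) E_sub assms(1) by auto
    have "es \<in> nlists (length es) E" using es(1) by (intro nlistsI refl)
    then have "x \<in> span_E ns (length es) f" using assms(2) f(2) by (auto simp: span_E_def)
    then show False using x f(1) by (auto simp: span_compls_def)
  qed
qed

text \<open>Finitely many functions take at most \<open>n\<close> arguments from \<open>E\<close>
  for some \<open>n\<close>, so \<open>codense\<close> with this \<open>n\<close> avoids all their
  values at once.\<close>

lemma rich_span_compls:
  assumes "set ns \<subseteq> U" shows "rich (set ns) (span_compls ns)"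
  unfolding rich_def
proof (intro conjI ballI allI impI)
  fix Q assume "Q \<in> span_compls ns"
  then show "dset LP MP (set ns) Q"
    using dset_Compl[OF dset_span_E] by (auto simp: span_compls_def)
next
  fix \<G> X assume \<G>: "\<G> \<subseteq> span_compls ns" "finite \<G>" and X: "dset L M U X" "infinite X"
  have "\<forall>Q\<in>\<G>. \<exists>m f. Q = U - span_E ns m f \<and> dfun L M (m + length ns) f"
    using \<G>(1) by (auto simp: span_compls_def)
  then obtain m f where mf: "\<forall>Q\<in>\<G>. Q = U - span_E ns (m Q) (f Q) \<and> dfun L M (m Q + length ns) (f Q)"
    by metis
  obtain n where n: "\<forall>Q\<in>\<G>. m Q \<le> n"
    using \<G>(2) finite_nat_set_iff_bounded_le[of "m ` \<G>"] by auto
  obtain x where x: "x \<in> X" "\<And>es. set es \<subseteq> E \<Longrightarrow> length es \<le> n \<Longrightarrow> x \<notin> cl (set ns \<union> set es)"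
    using codense[OF _ assms X, of n] by auto
  have "x \<in> Q" if Q: "Q \<in> \<G>" for Q
  proof -
    have "x \<notin> span_E ns (m Q) (f Q)"
    proof
      assume "x \<in> span_E ns (m Q) (f Q)"
      then obtain es where es: "es \<in> nlists (m Q) E" "x = f Q (es @ ns)" by (auto simp: span_E_def)
      have e: "set es \<subseteq> E" "length es = m Q" using nlistsE_set[OF es(1)] nlistsE_length[OF es(1)] by simp_all
      have "dfun L M (length (es @ ns)) (f Q)" using mf Q e by auto
      then have "x \<in> cl (set (es @ ns))"
        using es(2) assms e E_sub by (subst in_acl_iff) auto
      then show False using x(2)[of es] e n Q by (auto simp: Un_commute)
    qed
    then show ?thesis using mf Q x(1) dset_subset_univ[OF X(1)] by blast
  qed
  then show "X \<inter> \<Inter>\<G> \<noteq> {}" using x(1) by auto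
qed

section \<open>Back and forth\<close>

lemma dfun_evalt:
  assumes "wf_trm L n t" shows "dfun L M n (\<lambda>xs. evalt M xs t)"
proof -
  have "evalt M xs t \<in> U" if "xs \<in> nlists n U" for xs
    using assms
  proof (induction t)
    case (Fn f ts)
    then have "map (evalt M xs) ts \<in> nlists (farity L f) U" by (auto intro!: nlistsI)
    then show ?case using struc Fn.prems by (auto simp: is_struc_def)
  qed (use that in \<open>auto simp: nlistsE_nth_in\<close>)
  moreover have "dterm L M (Suc n) (\<lambda>xs. evalt M (tl xs) t)"
    unfolding dterm_def
  proof (intro exI conjI ballI)
    show "wf_trm L (Suc n) (ren_trm Suc t)" by (rule wf_ren_trm[OF assms]) simp
    fix xs assume "xs \<in> nlists (Suc n) U"
    then show "evalt M xs (ren_trm Suc t) = evalt M (tl xs) t"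
      by (intro evalt_ren_trm[OF assms]) (auto simp: in_nlists_Suc_iff)
  qed
  then have "dpred L M (Suc n) (\<lambda>xs. xs ! 0 = evalt M (tl xs) t)"
    by (intro dpred_eq dterm_nth) simp
  then have "dpred L M (Suc n) (\<lambda>xs. hd xs = evalt M (tl xs) t)"
    by (rule dpred_cong) (auto simp: in_nlists_Suc_iff)
  ultimately show ?thesis unfolding dfun_def by auto
qed

text \<open>Symmetric in the two sides, so that the back step is the forth step for the
  converse.\<close>

definition pair_iso :: "('a \<times> 'a) set \<Rightarrow> bool" where
  "pair_iso Z \<longleftrightarrow> finite Z \<and> elem_map L M Z \<and> (\<forall>(x, y)\<in>Z. x \<in> E \<longleftrightarrow> y \<in> E) \<and>
     good E (fst ` Z) \<and> good E (snd ` Z)"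

lemma pair_iso_sub: "pair_iso Z \<Longrightarrow> fst ` Z \<subseteq> U \<and> snd ` Z \<subseteq> U"
  by (auto simp: pair_iso_def elem_map_def)

lemma pair_iso_converse: assumes "pair_iso Z" shows "pair_iso (Z\<inverse>)"
proof -
  have "fst ` (Z\<inverse>) = snd ` Z" "snd ` (Z\<inverse>) = fst ` Z" by force+
  then show ?thesis using assms elem_map_converse[of L M Z] by (auto simp: pair_iso_def)
qed

text \<open>Goodness makes \<open>c\<close> algebraic over the part of the domain in
  \<open>E\<close>; its image is algebraic over elements of \<open>E\<close>, and \<open>E\<close>
  is algebraically closed.\<close>

lemma pair_iso_acl_mem_E:
  assumes "pair_iso Z" "elem_map L M (insert (c, c') Z)" "c \<in> cl (fst ` Z)" "c \<in> E"
  shows "c' \<in> E"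
proof -
  let ?W = "{w \<in> Z. fst w \<in> E}"
  have "fst ` ?W = fst ` Z \<inter> E" by auto
  then have "c \<in> cl (fst ` ?W)"
    using assms good_acl_Int[OF _ assms(3,4) E_sub] pair_iso_sub[OF assms(1)]
    by (auto simp: pair_iso_def)
  then have "c' \<in> cl (snd ` ?W)" by (intro elem_map_acl[OF assms(2)]) auto
  moreover have "snd ` ?W \<subseteq> E" using assms(1) by (auto simp: pair_iso_def)
  ultimately have "c' \<in> cl E" by (rule acl_monoD)
  then show ?thesis using E_acl by auto
qed

lemma extend_acl:
  assumes "pair_iso Z" "c \<in> cl (fst ` Z)"
  obtains c' where "pair_iso (insert (c, c') Z)"
proof -
  have Z: "finite Z" "elem_map L M Z" using assms(1) by (auto simp: pair_iso_def)
  obtain c' where c': "elem_map L M (insert (c, c') Z)"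
    using elem_map_insert_acl[OF Z assms(2)] .
  have c'_cl: "c' \<in> cl (snd ` Z)" by (rule elem_map_acl[OF c' _ _ assms(2)]) auto
  have "elem_map L M (insert (c', c) (Z\<inverse>))"
    using elem_map_converse[OF c'] by (rule elem_map_mono) auto
  moreover have "fst ` (Z\<inverse>) = snd ` Z" by force
  ultimately have "c \<in> E" if "c' \<in> E"
    using pair_iso_acl_mem_E[OF pair_iso_converse[OF assms(1)]] c'_cl that by auto
  moreover have "c' \<in> E" if "c \<in> E" using pair_iso_acl_mem_E[OF assms(1) c' assms(2) that] .
  ultimately have "pair_iso (insert (c, c') Z)"
    using assms c' c'_cl good_insert_acl[OF _ _ E_sub] pair_iso_sub[OF assms(1)]
    by (auto simp: pair_iso_def)
  then show ?thesis by (rule that)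
qed

lemma extend_E:
  assumes "pair_iso Z" "c \<in> E" "c \<notin> cl (fst ` Z)" "finite N" "N \<subseteq> U"
  obtains c' where "pair_iso (insert (c, c') Z)" "c' \<in> E" "c' \<notin> cl N"
proof -
  have Z: "finite Z" "elem_map L M Z" "c \<in> U" using assms(1,2) E_sub by (auto simp: pair_iso_def)
  obtain c' where c': "c' \<in> \<Inter>(insert E ((\<lambda>y. U - {y}) ` cl N))" "elem_map L M (insert (c, c') Z)"
    using elem_map_extend[OF Z assms(3-5) rich_E[OF assms(4,5)]] by metis
  have "c' \<in> E" "c' \<notin> cl N" using Inter_rich_E[OF c'(1)] .
  moreover from this have "pair_iso (insert (c, c') Z)"
    using assms(1,2) c'(2) good_insert_mem[OF _ _ E_sub] pair_iso_sub[OF assms(1)]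
    by (auto simp: pair_iso_def)
  ultimately show ?thesis using that by blast
qed

lemma extend_generic:
  assumes "pair_iso Z" "c \<in> U" "c \<notin> cl (E \<union> fst ` Z)" "finite N" "N \<subseteq> U"
  obtains c' where "pair_iso (insert (c, c') Z)" "c' \<notin> cl (E \<union> N)"
proof -
  have Z: "finite Z" "elem_map L M Z" "finite (N \<union> snd ` Z)" "N \<union> snd ` Z \<subseteq> U"
    using assms pair_iso_sub[OF assms(1)] by (auto simp: pair_iso_def)
  obtain ns where ns: "set ns = N \<union> snd ` Z" using finite_list[OF Z(3)] ..
  have nsU: "set ns \<subseteq> U" using ns Z(4) by simp
  have "c \<notin> cl (fst ` Z)" using assms(3) acl_monoD[of c L M "fst ` Z" "E \<union> fst ` Z"] by auto
  then obtain c' where c': "c' \<in> U" "c' \<in> \<Inter>(span_compls ns)" "elem_map L M (insert (c, c') Z)"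
    using elem_map_extend[OF Z(1,2) assms(2) _ _ nsU rich_span_compls[OF nsU]] by auto
  have gen: "c' \<notin> cl (E \<union> (N \<union> snd ` Z))" using in_acl_E_iff[OF nsU c'(1)] c'(2) ns by simp
  then have 1: "c' \<notin> cl (E \<union> snd ` Z)" "c' \<notin> cl (E \<union> N)"
    using acl_monoD[of c' L M "E \<union> snd ` Z" "E \<union> (N \<union> snd ` Z)"]
      acl_monoD[of c' L M "E \<union> N" "E \<union> (N \<union> snd ` Z)"] by auto
  have "c \<notin> E" "c' \<notin> E"
    using assms(3) 1(2) acl_superset[of "E \<union> fst ` Z"] acl_superset[of "E \<union> N"]
      E_sub assms(5) pair_iso_sub[OF assms(1)] by auto
  then have "pair_iso (insert (c, c') Z)"
    using assms(1-3) c' 1 good_insert_generic[OF _ _ _ E_sub] pair_iso_sub[OF assms(1)]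
    by (auto simp: pair_iso_def)
  then show ?thesis using 1(2) by (rule that)
qed

text \<open>The elements of \<open>es\<close> are added one by one until \<open>c\<close> becomes
  algebraic over the domain. Avoiding an arbitrary \<open>d\<close> serves to show later that an
  element which no such map can move is algebraic over the domain.\<close>

lemma extend_acl_E:
  assumes "pair_iso Z" "set es \<subseteq> E" "c \<in> cl (fst ` Z \<union> set es)" "d \<in> U"
  shows "\<exists>c' Z'. Z \<subseteq> Z' \<and> (c, c') \<in> Z' \<and> pair_iso Z' \<and> (c \<notin> cl (fst ` Z) \<longrightarrow> c' \<noteq> d)"
  using assms(1-3)
proof (induction es arbitrary: Z)
  case Nil
  then have "c \<in> cl (fst ` Z)" by simp
  with Nil.prems(1) obtain c' where "pair_iso (insert (c, c') Z)" by (rule extend_acl)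
  with \<open>c \<in> cl (fst ` Z)\<close> show ?case by (intro exI[of _ c'] exI[of _ "insert (c, c') Z"]) auto
next
  case (Cons e es)
  note sub = pair_iso_sub[OF Cons.prems(1)]
  have e: "e \<in> E" "e \<in> U" using Cons.prems E_sub by auto
  show ?case
  proof (cases "c \<in> cl (fst ` Z)")
    case True
    with Cons.prems(1) obtain c' where "pair_iso (insert (c, c') Z)" by (rule extend_acl)
    with True show ?thesis by (intro exI[of _ c'] exI[of _ "insert (c, c') Z"]) auto
  next
    case c: False
    obtain e' where e': "pair_iso (insert (e, e') Z)" "e \<notin> cl (fst ` Z) \<longrightarrow> e' \<notin> cl (insert d (snd ` Z))"
    proof (cases "e \<in> cl (fst ` Z)")
      case True
      with Cons.prems(1) obtain e' where "pair_iso (insert (e, e') Z)" by (rule extend_acl)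
      then show ?thesis using that True by blast
    next
      case False
      have "finite (insert d (snd ` Z))" "insert d (snd ` Z) \<subseteq> U"
        using Cons.prems(1) sub assms(4) by (auto simp: pair_iso_def)
      from extend_E[OF Cons.prems(1) e(1) False this] show ?thesis using that by blast
    qed
    let ?Z = "insert (e, e') Z"
    show ?thesis
    proof (cases "c \<in> cl (fst ` ?Z)")
      case True
      from e'(1) True obtain c' where c': "pair_iso (insert (c, c') ?Z)" by (rule extend_acl)
      have True': "c \<in> cl (insert e (fst ` Z))" using True by simp
      have sub': "fst ` Z \<subseteq> U" using sub by simp
      \<comment> \<open>\<open>c\<close> became algebraic by adding \<open>e\<close>, so by exchange
        \<open>e\<close> is algebraic over \<open>c\<close> and the domain of \<open>Z\<close>, and
        \<open>e'\<close> over \<open>c'\<close> and the range. But \<open>e'\<close> was chosen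
        outside the closure of \<open>d\<close> and the range, so \<open>c'\<close> is not
        \<open>d\<close>.\<close>
      have e_notin: "e \<notin> cl (fst ` Z)" using acl_cut[OF sub' _ True'] c by auto
      have "e \<in> cl (insert c (fst ` Z))" by (rule acl_exchangeD[OF sub' e(2) True' c])
      then have "e \<in> cl (fst ` insert (c, c') Z)" by simp
      moreover have "elem_map L M (insert (c, c') ?Z)" using c' by (simp add: pair_iso_def)
      ultimately have "e' \<in> cl (snd ` insert (c, c') Z)"
        by (intro elem_map_acl[of "insert (c, c') ?Z" _ e]) auto
      then have "c' \<noteq> d" using e'(2) e_notin by auto
      then show ?thesis using c' by (intro exI[of _ c'] exI[of _ "insert (c, c') ?Z"]) auto
    next
      case False
      have "fst ` ?Z \<union> set es = fst ` Z \<union> set (e # es)" by auto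
      then obtain c' Z' where "?Z \<subseteq> Z'" "(c, c') \<in> Z'" "pair_iso Z'" "c' \<noteq> d"
        using Cons.IH[OF e'(1)] Cons.prems False by auto
      then show ?thesis by blast
    qed
  qed
qed

lemma pair_iso_extend:
  assumes "pair_iso Z" "c \<in> U" "d \<in> U"
  shows "\<exists>c' Z'. Z \<subseteq> Z' \<and> (c, c') \<in> Z' \<and> pair_iso Z' \<and> (c \<notin> cl (fst ` Z) \<longrightarrow> c' \<noteq> d)"
proof (cases "c \<in> cl (E \<union> fst ` Z)")
  case True
  then obtain bs where bs: "set bs \<subseteq> E \<union> fst ` Z" "c \<in> cl (set bs)" by (rule acl_finitary)
  let ?es = "filter (\<lambda>b. b \<in> E) bs"
  have "c \<in> cl (fst ` Z \<union> set ?es)" using bs(2) by (rule acl_monoD) (use bs(1) in auto)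
  then show ?thesis using assms by (intro extend_acl_E[where es = ?es]) auto
next
  case False
  have d: "finite {d}" "{d} \<subseteq> U" using assms(3) by auto
  obtain c' where c': "pair_iso (insert (c, c') Z)" "c' \<notin> cl (E \<union> {d})"
    using extend_generic[OF assms(1,2) False d] .
  have "d \<in> cl (E \<union> {d})" using acl_superset[of "E \<union> {d}"] E_sub assms(3) by auto
  then have "c' \<noteq> d" using c'(2) by auto
  then show ?thesis using c'(1) by blast
qed

lemma pair_iso_sat:
  assumes "pair_iso Z" "set ws \<subseteq> Z" "wf_fm LP (length ws) \<phi>"
  shows "sat MP (map fst ws) \<phi> \<longleftrightarrow> sat MP (map snd ws) \<phi>"
  using assms
proof (induction \<phi> arbitrary: ws Z)
  case (Eql s t)
  have "dpred L M (length ws) (\<lambda>xs. evalt M xs s = evalt M xs t)"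
    using Eql.prems(3) by (intro dpred_eq) (auto simp: dterm_def)
  then show ?case using elem_mapD[of L M Z ws] Eql.prems(1,2) by (simp add: pair_iso_def)
next
  case (Rel r ts)
  show ?case
  proof (cases r)
    case None
    then obtain t where t: "ts = [t]" "wf_trm L (length ws) t"
      using Rel.prems(3) by (auto simp: length_Suc_conv)
    \<comment> \<open>The value of a term need not lie in the domain, but it is algebraic over it,
      so \<open>Z\<close> extends to it. Elementarity identifies its image with the value of the
      same term.\<close>
    have "evalt M (map snd ws) t \<in> E" if "pair_iso Z" "set ws \<subseteq> Z" "wf_trm L (length ws) t"
        "evalt M (map fst ws) t \<in> E" for Z ws
    proof -
      note Z = that(1)
      have sub: "set (map fst ws) \<subseteq> U" using pair_iso_sub[OF that(1)] that(2) by auto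
      have f: "dfun L M (length ws) (\<lambda>xs. evalt M xs t)" using that(3) by (rule dfun_evalt)
      then have "evalt M (map fst ws) t \<in> cl (set (map fst ws))"
        using in_acl_iff[OF sub] by auto
      then have cl: "evalt M (map fst ws) t \<in> cl (fst ` Z)" by (rule acl_monoD) (use that(2) in auto)
      obtain c' where c': "pair_iso (insert (evalt M (map fst ws) t, c') Z)"
        using extend_acl[OF Z cl] .
      have "elem_map L M (insert (evalt M (map fst ws) t, c') Z)" using c' by (simp add: pair_iso_def)
      from elem_mapD[OF this, of "(evalt M (map fst ws) t, c') # ws" "\<lambda>xs. hd xs = evalt M (tl xs) t"]
      have "c' = evalt M (map snd ws) t" using f that(2) by (auto simp: dfun_def)
      then show ?thesis using c' that(4) by (auto simp: pair_iso_def)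
    qed
    note imp = this
    have swap: "map fst (map prod.swap ws) = map snd ws" "map snd (map prod.swap ws) = map fst ws"
      by (simp_all add: comp_def)
    have "evalt M (map snd (map prod.swap ws)) t \<in> E" if "evalt M (map fst (map prod.swap ws)) t \<in> E"
      using that Rel.prems t(2) by (intro imp[OF pair_iso_converse[OF Rel.prems(1)]]) auto
    then have "evalt M (map fst ws) t \<in> E \<longleftrightarrow> evalt M (map snd ws) t \<in> E"
      using imp[OF Rel.prems(1,2) t(2)] unfolding swap by blast
    moreover have "sat MP xs (Rel r ts) \<longleftrightarrow> evalt M xs t \<in> E" for xs
      unfolding sat.simps None t(1) list.map evalt_pair by (auto simp: pair_struc_def)
    ultimately show ?thesis by (simp only:)
  next
    case (Some r')
    have "wf_fm L (length ws) (Rel r' ts)" using Rel.prems(3) Some by auto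
    then have "dpred L M (length ws) (\<lambda>xs. sat M xs (Rel r' ts))" by (rule dpred_sat)
    then have "sat M (map fst ws) (Rel r' ts) \<longleftrightarrow> sat M (map snd ws) (Rel r' ts)"
      using elem_mapD[of L M Z ws] Rel.prems(1,2) by (simp add: pair_iso_def)
    moreover have "sat MP xs (Rel r ts) \<longleftrightarrow> sat M xs (Rel r' ts)" for xs
      unfolding sat.simps Some evalt_pair by (simp add: pair_struc_def)
    ultimately show ?thesis by (simp only:)
  qed
next
  case (Exi \<phi>)
  have imp: "sat MP (map snd ws) (Exi \<phi>)"
    if "pair_iso Z" "set ws \<subseteq> Z" "wf_fm LP (length ws) (Exi \<phi>)" "sat MP (map fst ws) (Exi \<phi>)" for Z ws
  proof -
    have "\<exists>c\<in>U. sat MP (c # map fst ws) \<phi>" using that(4) by simp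
    then obtain c where c: "c \<in> U" "sat MP (c # map fst ws) \<phi>" ..
    from pair_iso_extend[OF that(1) c(1) c(1)]
    obtain c' Z' where Z': "Z \<subseteq> Z'" "(c, c') \<in> Z'" "pair_iso Z'" by auto
    have "sat MP (map fst ((c, c') # ws)) \<phi> \<longleftrightarrow> sat MP (map snd ((c, c') # ws)) \<phi>"
      using Z' that(2,3) by (intro Exi.IH[OF Z'(3)]) auto
    moreover have "c' \<in> U" using pair_iso_sub[OF Z'(3)] Z'(2) by force
    ultimately show ?thesis using c(2) by auto
  qed
  have swap: "map fst (map prod.swap ws) = map snd ws" "map snd (map prod.swap ws) = map fst ws"
    by (simp_all add: comp_def)
  have "sat MP (map snd (map prod.swap ws)) (Exi \<phi>)"
    if "sat MP (map fst (map prod.swap ws)) (Exi \<phi>)"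
    using that Exi.prems by (intro imp[OF pair_iso_converse[OF Exi.prems(1)]]) auto
  then show ?case using imp[OF Exi.prems] unfolding swap by blast
qed simp_all

lemma pair_iso_Id_on:
  assumes "good E A" "finite A" "A \<subseteq> U" shows "pair_iso (Id_on A)"
proof -
  have "finite (Id_on A)" using assms(2) by (auto simp: Id_on_def)
  then show ?thesis using assms elem_map_Id_on by (auto simp: pair_iso_def)
qed

lemma pair_iso_dpred:
  assumes "pair_iso Z" "set ws \<subseteq> Z" "dpred LP MP (length ws) P"
  shows "P (map fst ws) \<longleftrightarrow> P (map snd ws)"
proof -
  obtain \<phi> where \<phi>: "wf_fm LP (length ws) \<phi>" "\<And>xs. xs \<in> nlists (length ws) U \<Longrightarrow> sat MP xs \<phi> \<longleftrightarrow> P xs"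
    using assms(3) unfolding dpred_def by auto
  have "map fst ws \<in> nlists (length ws) U" "map snd ws \<in> nlists (length ws) U"
    using pair_iso_sub[OF assms(1)] assms(2) by (auto intro!: nlistsI)
  then show ?thesis using \<phi> pair_iso_sat[OF assms(1,2) \<phi>(1)] by blast
qed

section \<open>Finite unions of images of powers of \<open>E\<close>, and smallness\<close>

lemma span_EI: "es \<in> nlists m E \<Longrightarrow> x \<in> U \<Longrightarrow> x = f (es @ ns) \<Longrightarrow> x \<in> span_E ns m f"
  unfolding span_E_def by blast

text \<open>Two extra arguments from \<open>E\<close> act as a switch: equal ones select
  \<open>f\<close>, distinct ones select \<open>g\<close>. The arguments of the function not
  selected are filled arbitrarily.\<close>

lemma span_E_Un:
  assumes "dfun L M (m + length ns) f" "dfun L M (n + length ns) g"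
  shows "\<exists>l h. dfun L M (l + length ns) h \<and> span_E ns m f \<union> span_E ns n g \<subseteq> span_E ns l h"
proof -
  \<comment> \<open>A finite universe would be algebraic over the empty set and hence contained in
    \<open>E\<close>. Infinity is what provides two distinct elements of \<open>E\<close> for the
    switch.\<close>
  have "infinite U"
  proof
    assume "finite U"
    then have "U \<subseteq> cl {}"
      using finite_definable_acl[of "[]" "\<lambda>_. True"] dpred_True[of L M 0] by simp
    also have "\<dots> \<subseteq> cl E" by (rule acl_mono) simp
    finally show False using E_acl E_sub E_proper by auto
  qed
  obtain a where a: "a \<in> E" using generic_in_E[OF dset_univ \<open>infinite U\<close>, of "{}"] by auto
  obtain b where b: "b \<in> E" "b \<notin> cl {a}"
    using generic_in_E[OF dset_univ \<open>infinite U\<close>, of "{a}"] a E_sub by auto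
  have ab: "a \<noteq> b" using b a E_sub acl_superset[of "{a}"] by auto
  let ?l = "Suc (Suc (m + n))" and ?N = "Suc (Suc (m + n)) + length ns"
  define h where "h = (\<lambda>xs. if xs ! 0 = xs ! 1 then f (take m (drop 2 xs) @ drop (m + n) (drop 2 xs))
    else g (take n (drop m (drop 2 xs)) @ drop (m + n) (drop 2 xs)))"
  have s0: "selector (m + n + length ns) ?N (drop 2)"
    using selector_drop[of ?N 2] by simp
  have s1: "selector (length ns) (m + n + length ns) (drop (m + n))"
    by (rule selector_append_right)
  have s2: "selector (n + length ns) (m + n + length ns) (drop m)"
    using selector_drop[of "m + n + length ns" m] by (simp add: add.assoc)
  have "selector (m + length ns) ?N (\<lambda>xs. take m (drop 2 xs) @ drop (m + n) (drop 2 xs))"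
    by (intro selector_append selector_comp[OF _ s0] s1 selector_take) simp
  moreover have "selector (n + length ns) ?N (\<lambda>xs. take n (drop m (drop 2 xs)) @ drop (m + n) (drop 2 xs))"
    using selector_comp[OF selector_take s2, of n]
    by (intro selector_append selector_comp[OF _ s0] s1) simp_all
  ultimately have "dfun L M ?N h"
    unfolding h_def
    by (intro dfun_if dpred_nth_eq dfun_selector[OF assms(1)] dfun_selector[OF assms(2)]) auto
  moreover have "span_E ns m f \<subseteq> span_E ns ?l h"
  proof
    fix x assume "x \<in> span_E ns m f"
    then obtain es where es: "x \<in> U" "es \<in> nlists m E" "x = f (es @ ns)" by (auto simp: span_E_def)
    obtain es' where es': "es' \<in> nlists n E" using nlists_not_empty[of E n] a by auto
    have len: "length es = m" "length es' = n" using es(2) es' by (auto simp: nlistsE_length)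
    have "x = h ((a # a # es @ es') @ ns)" using es(3) len by (simp add: h_def)
    moreover have "a # a # es @ es' \<in> nlists ?l E" using es(2) es' a by (auto simp: nlists_def)
    ultimately show "x \<in> span_E ns ?l h" using es(1) by (intro span_EI)
  qed
  moreover have "span_E ns n g \<subseteq> span_E ns ?l h"
  proof
    fix x assume "x \<in> span_E ns n g"
    then obtain es where es: "x \<in> U" "es \<in> nlists n E" "x = g (es @ ns)" by (auto simp: span_E_def)
    obtain es' where es': "es' \<in> nlists m E" using nlists_not_empty[of E m] a by auto
    have len: "length es = n" "length es' = m" using es(2) es' by (auto simp: nlistsE_length)
    have "x = h ((a # b # es' @ es) @ ns)" using es(3) len ab by (simp add: h_def)
    moreover have "a # b # es' @ es \<in> nlists ?l E" using es(2) es' a b(1) by (auto simp: nlists_def)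
    ultimately show "x \<in> span_E ns ?l h" using es(1) by (intro span_EI)
  qed
  ultimately show ?thesis by (intro exI[of _ ?l] exI[of _ h]) auto
qed

lemma finite_span_compls:
  assumes "finite \<G>" "\<G> \<subseteq> span_compls ns"
  shows "\<exists>m f. dfun L M (m + length ns) f \<and> U - \<Inter>\<G> \<subseteq> span_E ns m f"
  using assms
proof (induction \<G>)
  case empty
  \<comment> \<open>\<open>\<Inter>{}\<close> is the whole type, so there is nothing to cover and
    any function serves.\<close>
  then show ?case using dfun_nth[of 0 "1 + length ns"] by (intro exI[of _ 1]) auto
next
  case (insert Q \<G>)
  then obtain m f where f: "dfun L M (m + length ns) f" "U - \<Inter>\<G> \<subseteq> span_E ns m f" by auto
  obtain n g where g: "dfun L M (n + length ns) g" "Q = U - span_E ns n g"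
    using insert.prems by (auto simp: span_compls_def)
  obtain l h where "dfun L M (l + length ns) h" "span_E ns m f \<union> span_E ns n g \<subseteq> span_E ns l h"
    using span_E_Un[OF f(1) g(1)] by auto
  moreover have "U - \<Inter>(insert Q \<G>) \<subseteq> span_E ns m f \<union> span_E ns n g" using f(2) g(2) by auto
  ultimately show ?case by (meson order_trans)
qed

lemma small_over_span_compls:
  assumes "finite \<G>" "\<G> \<subseteq> span_compls ns" "set ns \<subseteq> U"
  shows "small_over L M E U 1 ((\<lambda>a. [a]) ` (U - \<Inter>\<G>))"
proof -
  obtain m f where f: "dfun L M (m + length ns) f" "U - \<Inter>\<G> \<subseteq> span_E ns m f"
    using finite_span_compls[OF assms(1,2)] by auto
  define h where "h = (\<lambda>es. [f (es @ ns)])"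
  have mem: "f (es @ ns) \<in> U" if "es \<in> nlists m U" for es
    using dfun_mem[OF f(1)] that assms(3) by (auto simp: nlists_def)
  have "dpred L M (m + 1 + length ns) (\<lambda>xs. xs ! m = f (take m xs @ drop (Suc m) xs))"
  proof (rule dfun_dpred[OF f(1)])
    have "selector (length ns) (m + 1 + length ns) (drop (Suc m))"
      using selector_drop[of "m + 1 + length ns" "Suc m"] by simp
    then show "selector (m + length ns) (m + 1 + length ns) (\<lambda>xs. take m xs @ drop (Suc m) xs)"
      by (intro selector_append selector_take) auto
  qed simp
  then have "definable L M U (m + 1) {xs \<in> nlists (m + 1) U. (xs @ ns) ! m = f (take m (xs @ ns) @ drop (Suc m) (xs @ ns))}"
    using assms(3) by (intro definable_dpred) auto
  also have "{xs \<in> nlists (m + 1) U. (xs @ ns) ! m = f (take m (xs @ ns) @ drop (Suc m) (xs @ ns))} =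
      {xs @ h xs |xs. xs \<in> nlists m U}" (is "?A = ?B")
  proof
    show "?B \<subseteq> ?A" using mem by (auto simp: h_def nlists_def nth_append)
    show "?A \<subseteq> ?B"
    proof
      fix xs assume xs: "xs \<in> ?A"
      then have len: "length xs = Suc m" "set xs \<subseteq> U" by (auto simp: nlists_def)
      then obtain ys y where ys: "xs = ys @ [y]" "length ys = m"
        by (metis length_append_singleton length_Suc_conv_rev nat.inject)
      then have "xs = ys @ h ys" "ys \<in> nlists m U"
        using xs len by (auto simp: h_def nth_append nlists_def)
      then show "xs \<in> ?B" by blast
    qed
  qed
  finally have "definable_fun L M U m 1 (nlists m U) h"
    using mem by (auto simp: definable_fun_def h_def nlists_def)
  moreover have "(\<lambda>a. [a]) ` (U - \<Inter>\<G>) \<subseteq> h ` nlists m E"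
    using f(2) by (auto simp: span_E_def h_def)
  moreover have "(\<lambda>a. [a]) ` (U - \<Inter>\<G>) \<subseteq> nlists 1 U" by (auto simp: nlists_def)
  ultimately show ?thesis unfolding small_over_def by blast
qed

section \<open>Definable functions of the pair\<close>

text \<open>Extend the identity on \<open>insert b A\<close> by an image of \<open>F b\<close> that
  avoids \<open>F b\<close> itself: it would be a second value of \<open>F\<close> at
  \<open>b\<close>.\<close>

lemma generic_value_acl:
  assumes "good E A" "finite A" "A \<subseteq> U" "F \<in> U \<rightarrow> U" "set ps \<subseteq> A"
    and P: "dpred LP MP (2 + length ps) P" "\<And>a b. a \<in> U \<Longrightarrow> b \<in> U \<Longrightarrow> F a = b \<longleftrightarrow> P ([a, b] @ ps)"
    and b: "b \<in> U" "b \<notin> cl (E \<union> A)"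
  shows "F b \<in> cl (insert b A)"
proof (rule ccontr)
  assume F: "F b \<notin> cl (insert b A)"
  have "good E (insert b A)" using assms(1) b E_sub assms(3) by (intro good_insert_generic)
  then have Z: "pair_iso (Id_on (insert b A))" using assms(2,3) b by (intro pair_iso_Id_on) auto
  have Fb: "F b \<in> U" using assms(4) b by auto
  obtain c Z' where Z': "Id_on (insert b A) \<subseteq> Z'" "(F b, c) \<in> Z'" "pair_iso Z'" "c \<noteq> F b"
    using pair_iso_extend[OF Z Fb Fb] F by auto
  let ?ws = "(b, b) # (F b, c) # map (\<lambda>p. (p, p)) ps"
  have "set ?ws \<subseteq> Z'" using Z'(1,2) assms(5) by auto
  from pair_iso_dpred[OF Z'(3) this, of P] have "P ([b, F b] @ ps) \<longleftrightarrow> P ([b, c] @ ps)"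
    using P(1) by (simp add: comp_def)
  moreover have "c \<in> U" using pair_iso_sub[OF Z'(3)] Z'(2) by force
  ultimately show False using P(2)[OF b(1)] Fb Z'(4) by auto
qed

text \<open>Both points are generic, so adding the pair \<open>(b, b')\<close> to the identity on
  \<open>ds\<close> keeps both sides good; the hypothesis on \<open>L\<close>-definable sets makes
  the map elementary.\<close>

lemma generic_type_determines:
  assumes "good E (set ds)" "set ds \<subseteq> U" "b \<in> U" "b \<notin> cl (E \<union> set ds)"
    "b' \<in> U" "b' \<notin> cl (E \<union> set ds)"
    "\<And>Y. dset L M (set ds) Y \<Longrightarrow> b \<in> Y \<Longrightarrow> b' \<in> Y"
    "dset LP MP (set ds) X" "b \<in> X"
  shows "b' \<in> X"
proof -
  let ?zs = "(b, b') # map (\<lambda>d. (d, d)) ds"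
  have set: "set ?zs = insert (b, b') (Id_on (set ds))" by (auto simp: Id_on_def)
  have "elem_map L M (set ?zs)"
  proof (rule elem_map_list)
    fix P assume "dpred L M (length ?zs) P" "P (map fst ?zs)"
    then have P: "dpred L M (Suc (length ds)) P" "P (b # ds)" by (simp_all add: comp_def)
    then have "b' \<in> {x \<in> U. P (x # ds)}"
      using assms(3) by (intro assms(7) dset_Collect) auto
    then show "P (map snd ?zs)" by (simp add: comp_def)
  qed (use assms in auto)
  moreover have "fst ` set ?zs = insert b (set ds)" "snd ` set ?zs = insert b' (set ds)"
    unfolding set by simp_all
  moreover have "E \<union> set ds \<subseteq> cl (E \<union> set ds)" using assms(2) E_sub by (intro acl_superset) auto
  then have "b \<notin> E" "b' \<notin> E" using assms(4,6) by auto
  ultimately have Z: "pair_iso (set ?zs)"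
    using assms(1-6) good_insert_generic[OF assms(1) _ _ E_sub assms(2)]
    by (auto simp: pair_iso_def)
  obtain P where P: "dpred LP MP (Suc (length ds)) P" "X = {x \<in> univ MP. P (x # ds)}"
    using assms(8) by (rule dset_list)
  have "P (map fst ?zs) \<longleftrightarrow> P (map snd ?zs)"
    using P(1) by (intro pair_iso_dpred[OF Z]) simp_all
  then show ?thesis using P(2) assms(5,9) by (simp add: comp_def)
qed

lemma finite_inconsistent:
  assumes "finite A" "A \<subseteq> U" "\<And>X. X \<in> \<F> \<Longrightarrow> dset LP MP A X" "U \<inter> \<Inter>\<F> = {}"
  shows "\<exists>\<G>\<subseteq>\<F>. finite \<G> \<and> U \<inter> \<Inter>\<G> = {}"
proof (rule ccontr)
  assume neg: "\<not> (\<exists>\<G>\<subseteq>\<F>. finite \<G> \<and> U \<inter> \<Inter>\<G> = {})"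
  have "U \<inter> \<Inter>\<G> \<noteq> {}" if "finite \<G>" "\<G> \<subseteq> \<F>" for \<G> using neg that by metis
  from saturated[OF assms(1-3) this] assms(4) show False by simp
qed

text \<open>An \<open>L\<close>-definable piece on which one definable function gives
  \<open>F\<close>. The finite \<open>\<G>\<close> records the small set of exceptions, where
  \<open>F\<close> may behave differently.\<close>

definition agree_set :: "'a list \<Rightarrow> ('a \<Rightarrow> 'a) \<Rightarrow> 'a set \<Rightarrow> bool" where
  "agree_set ds F Y \<longleftrightarrow> dset L M (set ds) Y \<and> (\<exists>f \<G>. dfun L M (Suc (length ds)) f \<and>
     finite \<G> \<and> \<G> \<subseteq> span_compls ds \<and> (\<forall>x\<in>Y \<inter> \<Inter>\<G>. F x = f (x # ds)))"

text \<open>The equation \<open>F x = f (x # ds)\<close> holds at \<open>b\<close>, hence at every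
  generic point of the same \<open>L\<close>-type over \<open>ds\<close>. Compactness replaces the
  type by one definable set \<open>Y\<close> and genericity by finitely many conditions.\<close>

lemma generic_agree_set:
  assumes "good E (set ds)" "set ds \<subseteq> U" "F \<in> U \<rightarrow> U" "set ps \<subseteq> set ds"
    and P: "dpred LP MP (2 + length ps) P" "\<And>a b. a \<in> U \<Longrightarrow> b \<in> U \<Longrightarrow> F a = b \<longleftrightarrow> P ([a, b] @ ps)"
    and b: "b \<in> U" "b \<notin> cl (E \<union> set ds)"
  shows "\<exists>Y. agree_set ds F Y \<and> b \<in> Y"
proof -
  have "F b \<in> cl (set (b # ds))"
    using generic_value_acl[OF assms(1) _ assms(2-4) P b] by simp
  then obtain f where f: "dfun L M (Suc (length ds)) f" "F b = f (b # ds)"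
    using in_acl_iff[of "b # ds"] b(1) assms(2) by auto
  define X where "X = {x \<in> U. F x = f (x # ds)}"
  have fU: "f (x # ds) \<in> U" if "x \<in> U" for x
    using that assms(2) by (intro dfun_mem[OF f(1)]) (auto simp: nlists_def)
  \<comment> \<open>\<open>F\<close> is available only through the formula \<open>P\<close> of its
    graph, so the equation is written as: some \<open>y\<close> equals \<open>f (x # ds)\<close> and
    is the value of \<open>F\<close> at \<open>x\<close>.\<close>
  have "dset LP MP (set ds) X"
  proof -
    let ?n = "Suc (length (ps @ ds))"
    have "selector (length ds) ?n (drop (Suc (length ps)))"
      using selector_drop[of ?n "Suc (length ps)"] by simp
    then have "dfun L M ?n (\<lambda>xs. f (xs ! 0 # drop (Suc (length ps)) xs))"
      by (intro dfun_selector[OF f(1)] selector_Cons) auto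
    then have "dpred L M (Suc ?n) (\<lambda>xs. hd xs = f (tl xs ! 0 # drop (Suc (length ps)) (tl xs)))"
      by (simp add: dfun_def)
    then have 1: "dpred LP MP (Suc ?n) (\<lambda>xs. hd xs = f (tl xs ! 0 # drop (Suc (length ps)) (tl xs)))"
      by (rule dpred_pair)
    have s: "selector (length ps) (Suc ?n) (\<lambda>xs. take (length ps) (drop 2 xs))"
    proof (rule selector_comp[of "length ps" "length ps + length ds" "take (length ps)"])
      show "selector (length ps) (length ps + length ds) (take (length ps))" by (rule selector_append_left)
      show "selector (length ps + length ds) (Suc ?n) (drop 2)"
        using selector_drop[of "Suc ?n" 2] by simp
    qed
    have "selector (Suc (Suc (length ps))) (Suc ?n) (\<lambda>xs. xs ! 1 # xs ! 0 # take (length ps) (drop 2 xs))"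
      by (intro selector_Cons s) auto
    then have "dpred LP MP (Suc ?n) (\<lambda>xs. P (xs ! 1 # xs ! 0 # take (length ps) (drop 2 xs)))"
      by (rule dpred_selector[rotated]) (use P(1) in simp)
    from dpred_ex[OF dpred_conj[OF 1 this]]
    have "dset LP MP (set ds) {x \<in> univ MP. \<exists>y\<in>univ MP.
        hd (y # x # ps @ ds) = f (tl (y # x # ps @ ds) ! 0 # drop (Suc (length ps)) (tl (y # x # ps @ ds))) \<and>
        P ((y # x # ps @ ds) ! 1 # (y # x # ps @ ds) ! 0 # take (length ps) (drop 2 (y # x # ps @ ds)))}"
      using assms(4) by (intro dset_Collect) auto
    moreover have "\<dots> = X" using P(2) fU unfolding X_def by auto
    ultimately show ?thesis by simp
  qed
  then have dX: "dset LP MP (set ds) (U - X)" using dset_Compl by fastforce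
  let ?T = "{Y. dset L M (set ds) Y \<and> b \<in> Y}"
  have "U \<inter> \<Inter>(?T \<union> {U - X} \<union> span_compls ds) = {}"
  proof (rule ccontr)
    assume "U \<inter> \<Inter>(?T \<union> {U - X} \<union> span_compls ds) \<noteq> {}"
    then obtain b' where b': "b' \<in> U" "\<And>Y. dset L M (set ds) Y \<Longrightarrow> b \<in> Y \<Longrightarrow> b' \<in> Y" "b' \<notin> X"
      "b' \<in> \<Inter>(span_compls ds)" by blast
    have "b' \<notin> cl (E \<union> set ds)" using in_acl_E_iff[OF assms(2) b'(1)] b'(4) by simp
    moreover have "b \<in> X" using f(2) b(1) by (simp add: X_def)
    ultimately show False
      using generic_type_determines[OF assms(1,2) b b'(1) _ b'(2) \<open>dset LP MP (set ds) X\<close>] b'(3) by blast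
  qed
  moreover have "dset LP MP (set ds) Y" if Y: "Y \<in> ?T \<union> {U - X} \<union> span_compls ds" for Y
  proof -
    consider "Y \<in> ?T" | "Y = U - X" | "Y \<in> span_compls ds" using Y by (elim UnE singletonE)
    then show ?thesis
    proof cases
      case 1
      then show ?thesis by (simp add: dset_pair)
    qed (use dX rich_span_compls[OF assms(2)] in \<open>simp_all add: rich_def\<close>)
  qed
  ultimately have "\<exists>\<H>\<subseteq>?T \<union> {U - X} \<union> span_compls ds. finite \<H> \<and> U \<inter> \<Inter>\<H> = {}"
    by (intro finite_inconsistent[OF _ assms(2)]) simp_all
  then obtain \<H> where \<H>: "finite \<H>" "\<H> \<subseteq> ?T \<union> {U - X} \<union> span_compls ds" "U \<inter> \<Inter>\<H> = {}"
    by (elim exE conjE)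
  define Y where "Y = U \<inter> \<Inter>(\<H> \<inter> ?T)"
  have "dset L M (set ds) Y" unfolding Y_def using \<H>(1) by (intro dset_Inter) auto
  moreover have "\<forall>x\<in>Y \<inter> \<Inter>(\<H> \<inter> span_compls ds). F x = f (x # ds)"
  proof
    fix x assume x: "x \<in> Y \<inter> \<Inter>(\<H> \<inter> span_compls ds)"
    then have "x \<in> U" by (simp add: Y_def)
    then obtain Q where Q: "Q \<in> \<H>" "x \<notin> Q" using \<H>(3) by blast
    then have "Q = U - X" using x \<H>(2) unfolding Y_def by blast
    then show "F x = f (x # ds)" using Q(2) \<open>x \<in> U\<close> by (simp add: X_def)
  qed
  ultimately have "agree_set ds F Y"
    unfolding agree_set_def using f(1) \<H>(1)
    by (intro conjI exI[of _ f] exI[of _ "\<H> \<inter> span_compls ds"]) auto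
  moreover have "b \<in> Y" using b(1) by (auto simp: Y_def)
  ultimately show ?thesis by blast
qed

text \<open>Pieces may overlap; a definable case distinction lets the newly added piece take
  precedence, and the exceptional sets are united.\<close>

lemma agree_on_Union:
  assumes "finite \<Y>" "\<And>Y. Y \<in> \<Y> \<Longrightarrow> agree_set ds F Y"
  shows "\<exists>g \<G>. dfun L M (Suc (length ds)) g \<and> finite \<G> \<and> \<G> \<subseteq> span_compls ds \<and>
    (\<forall>x\<in>\<Union>\<Y> \<inter> \<Inter>\<G>. F x = g (x # ds))"
  using assms
proof (induction \<Y>)
  case empty
  then show ?case using dfun_nth[of 0 "Suc (length ds)"] by (intro exI[of _ "\<lambda>xs. xs ! 0"] exI[of _ "{}"]) auto
next
  case (insert Y \<Y>)
  then obtain g \<G> where g: "dfun L M (Suc (length ds)) g" "finite \<G>" "\<G> \<subseteq> span_compls ds"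
    "\<forall>x\<in>\<Union>\<Y> \<inter> \<Inter>\<G>. F x = g (x # ds)" by auto
  obtain f \<G>' where f: "dset L M (set ds) Y" "dfun L M (Suc (length ds)) f" "finite \<G>'"
    "\<G>' \<subseteq> span_compls ds" "\<forall>x\<in>Y \<inter> \<Inter>\<G>'. F x = f (x # ds)"
    using insert.prems[of Y] by (auto simp: agree_set_def)
  obtain P where P: "dpred L M (Suc (length ds)) P" "Y = {x \<in> U. P (x # ds)}"
    using f(1) by (rule dset_list)
  have YU: "\<Union>(insert Y \<Y>) \<subseteq> U"
    using insert.prems dset_subset_univ unfolding agree_set_def by (meson Union_least)
  have "\<forall>x\<in>\<Union>(insert Y \<Y>) \<inter> \<Inter>(\<G> \<union> \<G>'). F x = (if P (x # ds) then f (x # ds) else g (x # ds))"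
  proof
    fix x assume x: "x \<in> \<Union>(insert Y \<Y>) \<inter> \<Inter>(\<G> \<union> \<G>')"
    then have "x \<in> U" using YU by auto
    show "F x = (if P (x # ds) then f (x # ds) else g (x # ds))"
    proof (cases "P (x # ds)")
      case True
      then have "x \<in> Y" using P(2) \<open>x \<in> U\<close> by simp
      then show ?thesis using f(5) x True by auto
    next
      case False
      then have "x \<notin> Y" using P(2) by simp
      then show ?thesis using g(4) x False by auto
    qed
  qed
  then show ?case using dfun_if[OF f(2) g(1) P(1)] f(3,4) g(2,3)
    by (intro exI[of _ "\<lambda>xs. if P xs then f xs else g xs"] exI[of _ "\<G> \<union> \<G>'"]) auto
qed

theorem definable_unary_fun_agrees:
  assumes "special L M E D" "definable_unary_fun LP MP D F"
  shows "\<exists>Fhat. definable_unary_fun L M D Fhat \<and>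
    (\<exists>S\<subseteq>U. small_over L M E U 1 ((\<lambda>a. [a]) ` S) \<and> (\<forall>a\<in>U - S. F a = Fhat a))"
proof -
  have D: "D \<subseteq> U" using assms(1) by (simp add: special_def)
  have F: "F \<in> U \<rightarrow> U" using assms(2) by (simp add: definable_unary_fun_def)
  obtain k \<phi> ps where \<phi>: "wf_fm LP (2 + k) \<phi>" "ps \<in> nlists k D"
    "{[a, F a] |a. a \<in> U} = {xs \<in> nlists 2 U. sat MP (xs @ ps) \<phi>}"
    using assms(2) by (auto simp: definable_unary_fun_def definable_def)
  have ps: "set ps \<subseteq> D" "length ps = k" using \<phi>(2) by (auto simp: nlists_def)
  define P where "P = (\<lambda>xs. sat MP xs \<phi>)"
  have P1: "dpred LP MP (2 + length ps) P" unfolding P_def using \<phi>(1) ps(2) by (intro dpred_sat) simp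
  have P2: "F a = b \<longleftrightarrow> P ([a, b] @ ps)" if "a \<in> U" "b \<in> U" for a b
  proof -
    have "P ([a, b] @ ps) \<longleftrightarrow> [a, b] \<in> {[a, F a] |a. a \<in> U}"
      unfolding \<phi>(3) P_def using that by (simp add: nlists_def)
    then show ?thesis using that(1) by auto
  qed
  \<comment> \<open>Specialness enters here: the parameters of \<open>F\<close> are enlarged to a
    good set, so that the back and forth applies, but stay inside \<open>D\<close>, so that
    \<open>Fhat\<close> is definable over \<open>D\<close>.\<close>
  obtain A where A: "set ps \<subseteq> A" "A \<subseteq> D" "finite A" "good E A"
    using special_good[OF assms(1) _ ps(1) E_sub] by auto
  obtain ds where ds: "set ds = A" using finite_list[OF A(3)] ..
  have dsU: "set ds \<subseteq> U" using ds A(2) D by auto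
  have good: "good E (set ds)" "set ps \<subseteq> set ds" using A ds by auto
  let ?C = "(\<lambda>Y. U - Y) ` {Y. agree_set ds F Y}"
  \<comment> \<open>Every generic point lies in some piece, so by compactness finitely many pieces
    cover everything outside finitely many sets \<open>span_E\<close>.\<close>
  have "U \<inter> \<Inter>(?C \<union> span_compls ds) = {}"
  proof (rule ccontr)
    assume "U \<inter> \<Inter>(?C \<union> span_compls ds) \<noteq> {}"
    then obtain b where b: "b \<in> U" "b \<in> \<Inter>(span_compls ds)" "b \<in> \<Inter>?C" by blast
    have "b \<notin> cl (E \<union> set ds)" using in_acl_E_iff[OF dsU b(1)] b(2) by simp
    then obtain Y where Y: "agree_set ds F Y" "b \<in> Y"
      using generic_agree_set[OF good(1) dsU F good(2) P1 P2 b(1)] by auto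
    then have "U - Y \<in> ?C" by simp
    then have "b \<in> U - Y" by (rule InterD[OF b(3)])
    then show False using Y(2) by simp
  qed
  moreover have "dset LP MP (set ds) Y" if "Y \<in> ?C \<union> span_compls ds" for Y
    using that
  proof
    assume "Y \<in> ?C"
    then obtain Y' where "dset L M (set ds) Y'" "Y = U - Y'" by (auto simp: agree_set_def)
    then show ?thesis using dset_pair[OF dset_Compl] by simp
  qed (use rich_span_compls[OF dsU] in \<open>simp add: rich_def\<close>)
  ultimately have "\<exists>\<H>\<subseteq>?C \<union> span_compls ds. finite \<H> \<and> U \<inter> \<Inter>\<H> = {}"
    by (intro finite_inconsistent[OF _ dsU]) simp_all
  then obtain \<H> where \<H>: "finite \<H>" "\<H> \<subseteq> ?C \<union> span_compls ds" "U \<inter> \<Inter>\<H> = {}"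
    by (elim exE conjE)
  have "finite (\<H> \<inter> ?C)" "\<H> \<inter> ?C \<subseteq> ?C" using \<H>(1) by auto
  then obtain \<Y> where \<Y>: "\<Y> \<subseteq> {Y. agree_set ds F Y}" "finite \<Y>" "\<H> \<inter> ?C = (\<lambda>Y. U - Y) ` \<Y>"
    by (meson finite_subset_image)
  have "\<exists>g \<G>. dfun L M (Suc (length ds)) g \<and> finite \<G> \<and> \<G> \<subseteq> span_compls ds \<and>
      (\<forall>x\<in>\<Union>\<Y> \<inter> \<Inter>\<G>. F x = g (x # ds))"
    by (rule agree_on_Union[OF \<Y>(2)]) (use \<Y>(1) in auto)
  then obtain g \<G> where g: "dfun L M (Suc (length ds)) g" "finite \<G>" "\<G> \<subseteq> span_compls ds"
    "\<forall>x\<in>\<Union>\<Y> \<inter> \<Inter>\<G>. F x = g (x # ds)"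
    by (elim exE conjE)
  \<comment> \<open>Two kinds of exceptions are excluded: points of the pieces where
    \<open>g\<close> may differ from \<open>F\<close>, and points that the pieces may fail to
    cover.\<close>
  define \<G>' where "\<G>' = \<G> \<union> (\<H> \<inter> span_compls ds)"
  define Fhat where "Fhat = (\<lambda>x. g (x # ds))"
  have agree: "F x = Fhat x" if "x \<in> U - (U - \<Inter>\<G>')" for x
  proof -
    have x: "x \<in> U" "x \<in> \<Inter>\<G>" "x \<in> \<Inter>(\<H> \<inter> span_compls ds)" using that by (auto simp: \<G>'_def)
    obtain Q where Q: "Q \<in> \<H>" "x \<notin> Q" using \<H>(3) x(1) by blast
    then have "Q \<in> \<H> \<inter> ?C" using x(3) \<H>(2) by blast
    then have "Q \<in> (\<lambda>Y. U - Y) ` \<Y>" unfolding \<Y>(3) .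
    then obtain Y where "Y \<in> \<Y>" "x \<in> Y" using Q(2) x(1) by auto
    then show ?thesis using g(4) x(2) unfolding Fhat_def by blast
  qed
  have gU: "g (x # ds) \<in> U" if "x \<in> U" for x
    using that dsU by (intro dfun_mem[OF g(1)]) (auto simp: nlists_def)
  have "selector (length ds) (2 + length ds) (drop 2)" by (rule selector_append_right)
  then have "dpred L M (2 + length ds) (\<lambda>xs. xs ! 1 = g (xs ! 0 # drop 2 xs))"
    by (intro dfun_dpred[OF g(1)] selector_Cons) auto
  then have "definable L M D 2 {xs \<in> nlists 2 U. (xs @ ds) ! 1 = g ((xs @ ds) ! 0 # drop 2 (xs @ ds))}"
    using ds A(2) D by (intro definable_dpred) auto
  also have "{xs \<in> nlists 2 U. (xs @ ds) ! 1 = g ((xs @ ds) ! 0 # drop 2 (xs @ ds))} =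
      {[a, Fhat a] |a. a \<in> U}"
    using gU by (auto simp: Fhat_def numeral_2_eq_2 in_nlists_Suc_iff)
  finally have "definable_unary_fun L M D Fhat"
    using gU by (simp add: definable_unary_fun_def Fhat_def)
  moreover have "small_over L M E U 1 ((\<lambda>a. [a]) ` (U - \<Inter>\<G>'))"
    using g(2,3) \<H>(1) by (intro small_over_span_compls[OF _ _ dsU]) (auto simp: \<G>'_def)
  ultimately show ?thesis using agree by (intro exI[of _ Fhat] conjI exI[of _ "U - \<Inter>\<G>'"]) auto
qed

end

section \<open>Dense pairs of models\<close>

lemma definable_skolem_functions_dfun:
  fixes M :: "('u, 'f, 'r) struc"
  assumes "definable_skolem_functions TYPE('u) L T" "model L T M" "dpred L M (Suc n) P"
  shows "\<exists>f. dfun L M n f \<and> (\<forall>b\<in>nlists n (univ M). (\<exists>a\<in>univ M. P (a # b)) \<longrightarrow> P (f b # b))"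
proof -
  obtain \<phi> where \<phi>: "wf_fm L (Suc n) \<phi>" "\<And>xs. xs \<in> nlists (Suc n) (univ M) \<Longrightarrow> sat M xs \<phi> \<longleftrightarrow> P xs"
    using assms(3) unfolding dpred_def by auto
  from assms(1)[unfolded definable_skolem_functions_def, rule_format, OF \<phi>(1)]
  obtain \<psi> where \<psi>: "wf_fm L (Suc n) \<psi>" and sk: "\<forall>b\<in>nlists n (univ M).
      (\<exists>!a. a \<in> univ M \<and> sat M (a # b) \<psi>) \<and> ((\<exists>a\<in>univ M. sat M (a # b) \<phi>) \<longrightarrow>
        (\<forall>a\<in>univ M. sat M (a # b) \<psi> \<longrightarrow> sat M (a # b) \<phi>))"
    using assms(2) by (elim exE conjE) simp
  define f where "f b = (THE a. a \<in> univ M \<and> sat M (a # b) \<psi>)" for b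
  have f: "f b \<in> univ M" "sat M (f b # b) \<psi>" if "b \<in> nlists n (univ M)" for b
    using theI'[OF conjunct1[OF bspec[OF sk that]]] by (auto simp: f_def)
  have eq: "sat M (a # b) \<psi> \<longleftrightarrow> a = f b" if "b \<in> nlists n (univ M)" "a \<in> univ M" for a b
    using conjunct1[OF bspec[OF sk that(1)]] f[OF that(1)] that(2) by auto
  have "dpred L M (Suc n) (\<lambda>xs. hd xs = f (tl xs))"
    by (rule dpred_cong[OF dpred_sat[OF \<psi>]]) (auto simp: in_nlists_Suc_iff eq)
  then have "dfun L M n f" using f(1) by (auto simp: dfun_def)
  moreover have "P (f b # b)" if b: "b \<in> nlists n (univ M)" and "\<exists>a\<in>univ M. P (a # b)" for b
  proof -
    have "\<exists>a\<in>univ M. sat M (a # b) \<phi>" using that \<phi>(2) by auto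
    then have "sat M (f b # b) \<phi>" using conjunct2[OF bspec[OF sk b]] f[OF b] by blast
    then show ?thesis using \<phi>(2) f(1)[OF b] b by auto
  qed
  ultimately show ?thesis by blast
qed

text \<open>Saturation is measured by the set of formulas; its infinity makes every finite parameter
  set admissible.\<close>

lemma infinite_formulas: "infinite {\<phi>. \<exists>n. wf_fm L n \<phi>}"
proof -
  have "range (\<lambda>i. Eql (Var i) (Var i)) \<subseteq> {\<phi>. \<exists>n. wf_fm L n \<phi>}"
    by (auto intro: exI[of _ "Suc _"])
  moreover have "infinite (range (\<lambda>i. Eql (Var i) (Var i)))"
    by (rule range_inj_infinite) (auto simp: inj_def)
  ultimately show ?thesis by (rule infinite_super)
qed

text \<open>Choosing a formula and parameters for every set of the family turns it into a type in
  the sense of \<open>succ_saturated\<close>.\<close>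

lemma succ_saturated_dset:
  assumes "succ_saturated L M K" "infinite K" "finite A" "A \<subseteq> univ M"
    and \<F>: "\<And>X. X \<in> \<F> \<Longrightarrow> dset L M A X"
    and fip: "\<And>\<G>. finite \<G> \<Longrightarrow> \<G> \<subseteq> \<F> \<Longrightarrow> univ M \<inter> \<Inter>\<G> \<noteq> {}"
  shows "univ M \<inter> \<Inter>\<F> \<noteq> {}"
proof -
  have "\<forall>X\<in>\<F>. \<exists>w. set (snd w) \<subseteq> A \<and> wf_fm L (Suc (length (snd w))) (fst w) \<and>
      X = {a \<in> univ M. sat M (a # snd w) (fst w)}"
  proof
    fix X assume X: "X \<in> \<F>"
    obtain ps P where p: "set ps \<subseteq> A" "dpred L M (Suc (length ps)) P" "X = {x \<in> univ M. P (x # ps)}"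
      using \<F>[OF X] unfolding dset_def by auto
    obtain \<phi> where \<phi>: "wf_fm L (Suc (length ps)) \<phi>"
      "\<And>xs. xs \<in> nlists (Suc (length ps)) (univ M) \<Longrightarrow> sat M xs \<phi> \<longleftrightarrow> P xs"
      using p(2) unfolding dpred_def by auto
    have "ps \<in> nlists (length ps) (univ M)" using p(1) assms(4) by (intro nlistsI) auto
    then have "X = {a \<in> univ M. sat M (a # ps) \<phi>}" unfolding p(3) using \<phi>(2) by auto
    then show "\<exists>w. set (snd w) \<subseteq> A \<and> wf_fm L (Suc (length (snd w))) (fst w) \<and>
        X = {a \<in> univ M. sat M (a # snd w) (fst w)}"
      using p(1) \<phi>(1) by (intro exI[of _ "(\<phi>, ps)"]) simp
  qed
  from bchoice[OF this] obtain w where w: "\<forall>X\<in>\<F>. set (snd (w X)) \<subseteq> A \<and>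
      wf_fm L (Suc (length (snd (w X)))) (fst (w X)) \<and>
      X = {a \<in> univ M. sat M (a # snd (w X)) (fst (w X))}" ..
  have mem: "a \<in> X \<longleftrightarrow> sat M (a # snd (w X)) (fst (w X))" if "a \<in> univ M" "X \<in> \<F>" for a X
    using w that by blast
  define p where "p = w ` \<F>"
  have "\<exists>a\<in>univ M. \<forall>(\<psi>, qs)\<in>p. sat M (a # qs) \<psi>"
  proof (rule assms(1)[unfolded succ_saturated_def, rule_format], intro conjI allI impI)
    show "A \<lesssim> K" using assms(3,2) by (rule finite_lepoll_infinite[rotated])
    show "\<forall>(\<psi>, qs)\<in>p. wf_fm L (Suc (length qs)) \<psi> \<and> set qs \<subseteq> A"
      using w by (auto simp: p_def case_prod_unfold)
    fix q assume "q \<subseteq> p" "finite q"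
    then obtain \<G> where \<G>: "\<G> \<subseteq> \<F>" "finite \<G>" "q = w ` \<G>"
      unfolding p_def by (meson finite_subset_image)
    obtain a where a: "a \<in> univ M" "a \<in> \<Inter>\<G>" using fip[OF \<G>(2,1)] by auto
    have "sat M (a # snd (w X)) (fst (w X))" if "X \<in> \<G>" for X
      using mem[OF a(1)] a(2) that \<G>(1) by blast
    then show "\<exists>a\<in>univ M. \<forall>(\<psi>, qs)\<in>q. sat M (a # qs) \<psi>"
      using a(1) \<G>(3) by (auto simp: case_prod_unfold)
  qed (rule assms(4))
  then obtain a where a: "a \<in> univ M" "\<forall>X\<in>\<F>. sat M (a # snd (w X)) (fst (w X))"
    by (auto simp: p_def case_prod_unfold)
  then have "a \<in> X" if "X \<in> \<F>" for X using mem[OF a(1) that] that by simp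
  then show ?thesis using a(1) by auto
qed

text \<open>An element of the closure is the only solution in the model of a formula over
  \<open>E\<close>, and by elementarity \<open>E\<close> contains a solution.\<close>

lemma (in geometric_struc) elem_substruc_acl:
  assumes "elem_substruc L E M" shows "cl E \<subseteq> E"
proof
  fix x assume "x \<in> cl E"
  then obtain bs where bs: "set bs \<subseteq> E" "x \<in> cl (set bs)" by (rule acl_finitary)
  have E: "E \<subseteq> U" "\<And>n \<phi> xs. wf_fm L n \<phi> \<Longrightarrow> xs \<in> nlists n E \<Longrightarrow> sat (M\<lparr>univ := E\<rparr>) xs \<phi> \<longleftrightarrow> sat M xs \<phi>"
    using assms unfolding elem_substruc_def by auto
  obtain f where f: "dfun L M (length bs) f" "x = f bs" using in_acl_iff bs E(1) by auto
  have bsE: "bs \<in> nlists (length bs) E" "bs \<in> nlists (length bs) U"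
    using bs(1) E(1) by (auto intro!: nlistsI)
  obtain \<phi> where \<phi>: "wf_fm L (Suc (length bs)) \<phi>"
    "\<And>xs. xs \<in> nlists (Suc (length bs)) U \<Longrightarrow> sat M xs \<phi> \<longleftrightarrow> hd xs = f (tl xs)"
    using f(1) unfolding dfun_def dpred_def by auto
  have "sat M (x # bs) \<phi>" using \<phi>(2)[of "x # bs"] f dfun_mem[OF f(1) bsE(2)] bsE(2) by auto
  then have "sat M bs (Exi \<phi>)" using f(2) dfun_mem[OF f(1) bsE(2)] by auto
  then have "sat (M\<lparr>univ := E\<rparr>) bs (Exi \<phi>)" using E(2)[of "length bs" "Exi \<phi>" bs] \<phi>(1) bsE(1) by simp
  then obtain a where a: "a \<in> E" "sat (M\<lparr>univ := E\<rparr>) (a # bs) \<phi>" by auto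
  then have "sat M (a # bs) \<phi>" using E(2)[OF \<phi>(1), of "a # bs"] bsE(1) by auto
  then have "a = x" using \<phi>(2)[of "a # bs"] f(2) a(1) E(1) bsE(2) by auto
  then show "x \<in> E" using a(1) by simp
qed

section \<open>Consequences of the definable topology\<close>

context
  fixes L :: "('f, 'r) lang" and \<iota> k \<theta> and M :: "('u, 'f, 'r) struc"
  assumes top: "topological_ring_structure L \<iota> k \<theta> M" and \<theta>: "wf_fm L (Suc k) \<theta>"
begin

abbreviation (input) "\<tau> \<equiv> theta_top M k \<theta>"

lemma topspace_theta: "topspace \<tau> = univ M"
  using top by (simp add: topological_ring_structure_def Let_def)

lemma dset_theta:
  assumes "a \<in> nlists k (univ M)" shows "dset L M (univ M) (theta_set M \<theta> a)"
proof -
  have "dset L M (univ M) {x \<in> univ M. sat M (x # a) \<theta>}"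
    using assms \<theta> by (intro dset_Collect dpred_sat) (auto simp: nlists_def)
  then show ?thesis by (simp add: theta_set_def)
qed

lemma openin_theta_subset:
  assumes "openin \<tau> V" "v \<in> V"
  obtains a where "a \<in> nlists k (univ M)" "v \<in> theta_set M \<theta> a" "theta_set M \<theta> a \<subseteq> V"
proof -
  have "theta_open M k \<theta> V"
    using assms(1) top unfolding theta_top_def topological_ring_structure_def Let_def
    by (simp add: topology_inverse')
  then show ?thesis
    using assms(2) that unfolding theta_open_def union_of_def arbitrary_def by blast
qed

lemma openin_theta_set:
  assumes "a \<in> nlists k (univ M)" shows "openin \<tau> (theta_set M \<theta> a)"
proof -
  have "theta_open M k \<theta> (theta_set M \<theta> a)"
    unfolding theta_open_def using assms by (intro arbitrary_union_of_inc) auto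
  then show ?thesis
    using top unfolding theta_top_def topological_ring_structure_def Let_def
    by (simp add: topology_inverse')
qed

text \<open>In a \<open>t1_space\<close>, removing the other points of a finite open set leaves an
  open singleton, but there are no isolated points.\<close>

lemma infinite_openin: assumes "openin \<tau> V" "v \<in> V" shows "infinite V"
proof
  assume "finite V"
  have "t1_space \<tau>" "\<not> openin \<tau> {v}"
    using top assms openin_subset[OF assms(1)] topspace_theta
    unfolding topological_ring_structure_def Let_def by auto
  moreover have "closedin \<tau> (V - {v})"
    using \<open>t1_space \<tau>\<close> \<open>finite V\<close> openin_subset[OF assms(1)] unfolding t1_space_closedin_finite by auto
  then have "openin \<tau> (V - (V - {v}))" using assms(1) by (rule openin_diff[rotated])
  moreover have "V - (V - {v}) = {v}" using assms(2) by auto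
  ultimately show False by simp
qed

lemma infinite_dset_interior:
  assumes "dset L M (univ M) Y" "infinite Y"
  obtains V v where "openin \<tau> V" "V \<subseteq> Y" "v \<in> V"
proof -
  obtain ps P where p: "set ps \<subseteq> univ M" "dpred L M (1 + length ps) P" "Y = {x \<in> univ M. P (x # ps)}"
    using assms(1) unfolding dset_def by auto
  let ?Z = "{xs \<in> nlists 1 (univ M). P (xs @ ps)}"
  have "definable L M (univ M) 1 ?Z" using p(1,2) by (intro definable_dpred) auto
  moreover have Z: "{a. [a] \<in> ?Z} = Y" using p(3) by auto
  moreover have "infinite ?Z"
  proof
    assume "finite ?Z"
    moreover have "(\<lambda>a. [a]) ` Y \<subseteq> ?Z" using Z by auto
    ultimately have "finite ((\<lambda>a. [a]) ` Y)" by (rule finite_subset[rotated])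
    then show False using assms(2) finite_imageD[of "\<lambda>a. [a]" Y] by (auto simp: inj_on_def)
  qed
  moreover have "\<forall>Z. definable L M (univ M) 1 Z \<longrightarrow> finite Z \<or> \<tau> interior_of {a. [a] \<in> Z} \<noteq> {}"
    using top unfolding topological_ring_structure_def Let_def by (elim conjE)
  ultimately have "\<tau> interior_of Y \<noteq> {}" by (metis (no_types))
  then show ?thesis using that interior_of_subset openin_interior_of by (metis ex_in_conv)
qed

text \<open>The map from \<open>(y, z)\<close> to \<open>y + t z\<close> sends \<open>(v, 0)\<close>
  to \<open>v\<close>, so by continuity it sends a product of basic neighbourhoods of
  \<open>v\<close> and \<open>0\<close> into an open subset of \<open>Y\<close>. Basic sets are
  definable, and nonempty open sets are infinite.\<close>

lemma affine_open:
  assumes "dset L M (univ M) Y" "infinite Y" "t \<in> univ M"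
  shows "\<exists>V W. dset L M (univ M) V \<and> infinite V \<and> dset L M (univ M) W \<and> infinite W \<and>
    (\<forall>v\<in>V. \<forall>w\<in>W. v \<oplus>\<^bsub>ring_of \<iota> M\<^esub> t \<otimes>\<^bsub>ring_of \<iota> M\<^esub> w \<in> Y)"
proof -
  let ?R = "ring_of \<iota> M"
  have ring: "domain ?R"
    and add: "continuous_map (prod_topology \<tau> \<tau>) \<tau> (\<lambda>(x, y). fint M (\<iota> AddS) [x, y])"
    and mul: "continuous_map (prod_topology \<tau> \<tau>) \<tau> (\<lambda>(x, y). fint M (\<iota> MulS) [x, y])"
    using top unfolding topological_ring_structure_def topological_domain_def Let_def by auto
  interpret R: domain ?R by (rule ring)
  obtain V v where V: "openin \<tau> V" "V \<subseteq> Y" "v \<in> V"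
    using assms(1,2) by (rule infinite_dset_interior)
  have v: "v \<in> univ M" using openin_subset[OF V(1)] V(3) topspace_theta by auto
  let ?g = "\<lambda>p. fint M (\<iota> AddS) [fst p, fint M (\<iota> MulS) [t, snd p]]"
  have "continuous_map (prod_topology \<tau> \<tau>) (prod_topology \<tau> \<tau>) (\<lambda>p. (t, snd p))"
    using assms(3) topspace_theta by (intro continuous_map_pairedI continuous_map_snd) auto
  from continuous_map_compose[OF this mul]
  have "continuous_map (prod_topology \<tau> \<tau>) \<tau> (\<lambda>p. fint M (\<iota> MulS) [t, snd p])"
    by (simp add: comp_def)
  then have "continuous_map (prod_topology \<tau> \<tau>) (prod_topology \<tau> \<tau>) (\<lambda>p. (fst p, fint M (\<iota> MulS) [t, snd p]))"
    by (intro continuous_map_pairedI continuous_map_fst)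
  from continuous_map_compose[OF this add] have g: "continuous_map (prod_topology \<tau> \<tau>) \<tau> ?g"
    by (simp add: comp_def)
  have "openin (prod_topology \<tau> \<tau>) {p \<in> topspace (prod_topology \<tau> \<tau>). ?g p \<in> V}"
    by (rule openin_continuous_map_preimage[OF g V(1)])
  moreover have "?g (v, \<zero>\<^bsub>?R\<^esub>) = v"
  proof -
    have "v \<oplus>\<^bsub>?R\<^esub> t \<otimes>\<^bsub>?R\<^esub> \<zero>\<^bsub>?R\<^esub> = v" using v assms(3) by (simp add: ring_of_simps(1))
    then show ?thesis by (simp add: ring_of_simps)
  qed
  then have "(v, \<zero>\<^bsub>?R\<^esub>) \<in> {p \<in> topspace (prod_topology \<tau> \<tau>). ?g p \<in> V}"
    using v V(3) R.zero_closed topspace_theta by (simp add: ring_of_simps(1))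
  ultimately obtain V1 V2 where V12: "openin \<tau> V1" "openin \<tau> V2" "v \<in> V1" "\<zero>\<^bsub>?R\<^esub> \<in> V2"
    and sub: "V1 \<times> V2 \<subseteq> {p \<in> topspace (prod_topology \<tau> \<tau>). ?g p \<in> V}"
    unfolding openin_prod_topology_alt by meson
  obtain a where a: "a \<in> nlists k (univ M)" "v \<in> theta_set M \<theta> a" "theta_set M \<theta> a \<subseteq> V1"
    using V12(1,3) by (rule openin_theta_subset)
  obtain b where b: "b \<in> nlists k (univ M)" "\<zero>\<^bsub>?R\<^esub> \<in> theta_set M \<theta> b" "theta_set M \<theta> b \<subseteq> V2"
    using V12(2,4) by (rule openin_theta_subset)
  have "x \<oplus>\<^bsub>?R\<^esub> t \<otimes>\<^bsub>?R\<^esub> y \<in> Y" if "x \<in> theta_set M \<theta> a" "y \<in> theta_set M \<theta> b" for x y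
  proof -
    have "(x, y) \<in> V1 \<times> V2" using that a(3) b(3) by auto
    then have "?g (x, y) \<in> V" using sub by blast
    then show ?thesis using V(2) by (auto simp: ring_of_simps)
  qed
  then show ?thesis
    using dset_theta[OF a(1)] dset_theta[OF b(1)] infinite_openin[OF openin_theta_set[OF a(1)] a(2)]
      infinite_openin[OF openin_theta_set[OF b(1)] b(2)] by blast
qed

end

lemma dense_pair_strucI:
  fixes M :: "('u, 'f, 'r) struc"
  assumes "geometric_theory_top_rings TYPE('u) L \<iota> T k \<theta>" "dense_pair L T k \<theta> M E"
    "sufficiently_saturated_pair L M E"
  shows "dense_pair_struc L M E \<iota>"
proof -
  have M: "model L T M" "elem_substruc L E M" "E \<noteq> univ M" "theta_top M k \<theta> closure_of E = univ M"
    using assms(2) by (auto simp: dense_pair_def)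
  have T: "contains_ring_lang L \<iota>" "acl_exchange L M" "definable_skolem_functions TYPE('u) L T"
    "wf_fm L (Suc k) \<theta>" "topological_ring_structure L \<iota> k \<theta> M"
    using assms(1) M(1) by (auto simp: geometric_theory_top_rings_def)
  interpret geometric_struc L M
    by unfold_locales (fact T(2), rule definable_skolem_functions_dfun[OF T(3) M(1)])
  show ?thesis
  proof (intro dense_pair_struc.intro dense_pair_struc_axioms.intro)
    show "is_struc L M" using M(1) by (simp add: model_def)
    show "E \<subseteq> U" using M(2) by (simp add: elem_substruc_def)
    show "cl E \<subseteq> E" using M(2) by (rule elem_substruc_acl)
    show "domain (ring_of \<iota> M)"
      using T(5) by (simp add: topological_ring_structure_def topological_domain_def Let_def)
  next
    fix Y assume "dset L M U Y" "infinite Y"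
    then obtain V v where V: "openin (theta_top M k \<theta>) V" "V \<subseteq> Y" "v \<in> V"
      by (rule infinite_dset_interior[OF T(5,4)])
    then have "v \<in> theta_top M k \<theta> closure_of E"
      using openin_subset[OF V(1)] topspace_theta[OF T(5,4)] M(4) by auto
    then show "Y \<inter> E \<noteq> {}" using V unfolding in_closure_of by blast
  next
    fix A \<F>
    assume A: "finite A" "A \<subseteq> U" "\<And>X. X \<in> \<F> \<Longrightarrow> dset (pair_lang L) (pair_struc M E) A X"
      and fip: "\<And>\<G>. finite \<G> \<Longrightarrow> \<G> \<subseteq> \<F> \<Longrightarrow> U \<inter> \<Inter>\<G> \<noteq> {}"
    show "U \<inter> \<Inter>\<F> \<noteq> {}"
      using succ_saturated_dset[OF assms(3)[unfolded sufficiently_saturated_pair_def] infinite_formulas A(1) _ A(3)]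
        A(2) fip by simp
  qed (fact geometric_struc_axioms M(3) T(1) affine_open[OF T(5,4)])+
qed

theorem theorem5p6:
  fixes L :: "('f, 'r) lang" and \<iota> :: "ring_sym \<Rightarrow> 'f" and T :: "('f, 'r) fm set"
    and k :: nat and \<theta> :: "('f, 'r) fm"
    and M :: "('u, 'f, 'r) struc" and E D :: "'u set" and F :: "'u \<Rightarrow> 'u"
  assumes "geometric_theory_top_rings TYPE('u) L \<iota> T k \<theta>"
    and "dense_pair L T k \<theta> M E"
    and "sufficiently_saturated_pair L M E"
    and "special L M E D"
    and "definable_unary_fun (pair_lang L) (pair_struc M E) D F"
  shows "\<exists>Fhat. definable_unary_fun L M D Fhat \<and>
           (\<exists>S\<subseteq>univ M. small_over L M E (univ M) 1 ((\<lambda>a. [a]) ` S) \<and>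
              (\<forall>a\<in>univ M - S. F a = Fhat a))"
proof -
  interpret dense_pair_struc L M E \<iota> using assms(1-3) by (rule dense_pair_strucI)
  show ?thesis using assms(4,5) by (rule definable_unary_fun_agrees)
qed

end
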